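(* Let $T$ be a complete first-order theory in discrete or continuous logic with monster model $\mathcal{U}$, and let $M\prec\mathcal{U}$. Suppose $p\in S_x(\mathcal{U})$ and $q\in S_y(\mathcal{U})$ are generically stable over $M$. Then $p\otimes q$ is generically stable over $M$.
   Context: $\mathcal{U}$ is a monster model of $T$, $M\prec\mathcal{U}$ means that $M$ is a small elementary substructure, and $S_x(\mathcal{U})$ is the space of complete (continuous-logic) types over $\mathcal{U}$ in variables $x$, with the logic topology. For an $M$-invariant $p\in S_x(\mathcal{U})$ and any $q\in S_y(\mathcal{U})$, the Morley product is $p\otimes q=\mathrm{tp}(ab/\mathcal{U})\in S_{xy}(\mathcal{U})$ where (in a larger monster model) $b\models q$ and $a$ realizes the canonical $M$-invariant extension of $p$ to $\mathcal{U}b$. A *Morley sequence* in an $M$-invariant type $p\in S_x(\mathcal{U})$ over $M$ is a sequence $(a_i)_{i<\omega}$ in $\mathcal{U}^x$ with $a_i\models p|_{Ma_{<i}}$ for all $i<\omega$. A type $p\in S_x(\mathcal{U})$ is *generically stable over $M$* if $p$ is $M$-invariant and, for every Morley sequence $(a_i)_{i<\omega}$ in $p$ over $M$, $\lim_{i\to\infty}\mathrm{tp}(a_i/\mathcal{U})=p$. *)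

theory Defs
  imports "HOL-Analysis.Analysis"
begin

unbundle cardinal_syntax

section \<open>Continuous and discrete first-order logic\<close>

text \<open>
  Both logics are treated uniformly.  Truth values lie in the real unit interval, with \<open>0\<close> as
  ``true''; equality is the relation \<open>d x y = 0\<close>, the supremum is the universal quantifier and the
  infimum the existential one.  Discrete logic is the case in which the metric and the relations are
  \<open>0\<close>--\<open>1\<close>-valued and only Boolean connectives are formulas.  Then every formula is \<open>0\<close>--\<open>1\<close>-valued,
  and structures, formulas, types and the type spaces are the classical ones.
\<close>

record ('f, 'r) language =
  is_discrete :: bool
  funs :: "'f set"
  rels :: "'r set"
  fun_arity :: "'f \<Rightarrow> nat"
  rel_arity :: "'r \<Rightarrow> nat"

record ('f, 'r, 'a) mstruct =
  universe :: "'a set"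
  mdistance :: "'a \<Rightarrow> 'a \<Rightarrow> real"
  fun_interp :: "'f \<Rightarrow> 'a list \<Rightarrow> 'a"
  rel_interp :: "'r \<Rightarrow> 'a list \<Rightarrow> real"

definition tuples :: "('f, 'r, 'a) mstruct \<Rightarrow> nat \<Rightarrow> 'a list set" where
  "tuples U n = {xs. set xs \<subseteq> universe U \<and> length xs = n}"

definition unif_cont :: "('f, 'r, 'a) mstruct \<Rightarrow> nat \<Rightarrow> ('b \<Rightarrow> 'b \<Rightarrow> real) \<Rightarrow> ('a list \<Rightarrow> 'b) \<Rightarrow> bool" where
  "unif_cont U n e F \<longleftrightarrow>
     (\<forall>\<epsilon>>0. \<exists>\<delta>>0. \<forall>xs\<in>tuples U n. \<forall>ys\<in>tuples U n.
        list_all2 (\<lambda>x y. mdistance U x y < \<delta>) xs ys \<longrightarrow> e (F xs) (F ys) \<le> \<epsilon>)"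

text \<open>
  Moduli of uniform continuity are not recorded in the language: we always work with elementary
  extensions and substructures of one structure, and a modulus that is valid in that structure is
  expressed by sentences of its theory.
\<close>

definition is_structure :: "('f, 'r) language \<Rightarrow> ('f, 'r, 'a) mstruct \<Rightarrow> bool" where
  "is_structure L U \<longleftrightarrow>
     universe U \<noteq> {} \<and>
     Metric_space (universe U) (mdistance U) \<and>
     Metric_space.mcomplete (universe U) (mdistance U) \<and>
     (\<forall>x\<in>universe U. \<forall>y\<in>universe U. mdistance U x y \<le> 1) \<and>
     (\<forall>f\<in>funs L. (\<forall>xs\<in>tuples U (fun_arity L f). fun_interp U f xs \<in> universe U) \<and>
        unif_cont U (fun_arity L f) (mdistance U) (fun_interp U f)) \<and>
     (\<forall>R\<in>rels L. (\<forall>xs\<in>tuples U (rel_arity L R). rel_interp U R xs \<in> {0..1}) \<and>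
        unif_cont U (rel_arity L R) dist (rel_interp U R)) \<and>
     (is_discrete L \<longrightarrow>
        (\<forall>x\<in>universe U. \<forall>y\<in>universe U. mdistance U x y \<in> {0, 1}) \<and>
        (\<forall>R\<in>rels L. \<forall>xs\<in>tuples U (rel_arity L R). rel_interp U R xs \<in> {0, 1}))"

text \<open>
  Formulas may contain elements of a structure as parameters.  An \<open>n\<close>-ary connective is given by a
  function \<open>u\<close> on sequences, applied to the list of its \<open>n\<close> arguments padded by zeros.
\<close>

datatype ('f, 'a, 'v) trm =
  Var 'v
| Param 'a
| App 'f "('f, 'a, 'v) trm list"

datatype ('f, 'r, 'a, 'v) fm =
  Dist "('f, 'a, 'v) trm" "('f, 'a, 'v) trm"
| Rel 'r "('f, 'a, 'v) trm list"
| Conn "(nat \<Rightarrow> real) \<Rightarrow> real" "('f, 'r, 'a, 'v) fm list"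
| Sup 'v "('f, 'r, 'a, 'v) fm"
| Inf 'v "('f, 'r, 'a, 'v) fm"

primrec wf_trm :: "('f, 'r) language \<Rightarrow> ('f, 'a, 'v) trm \<Rightarrow> bool" where
  "wf_trm L (Var v) = True"
| "wf_trm L (Param a) = True"
| "wf_trm L (App f ts) = (f \<in> funs L \<and> length ts = fun_arity L f \<and> list_all (wf_trm L) ts)"

definition is_connective :: "('f, 'r) language \<Rightarrow> ((nat \<Rightarrow> real) \<Rightarrow> real) \<Rightarrow> bool" where
  "is_connective L u \<longleftrightarrow>
     continuous_on {x. \<forall>i. x i \<in> {0..1}} u \<and>
     (\<forall>x. (\<forall>i. x i \<in> {0..1}) \<longrightarrow> u x \<in> {0..1}) \<and>
     (is_discrete L \<longrightarrow> (\<forall>x. (\<forall>i. x i \<in> {0, 1}) \<longrightarrow> u x \<in> {0, 1}))"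

primrec wf_fm :: "('f, 'r) language \<Rightarrow> ('f, 'r, 'a, 'v) fm \<Rightarrow> bool" where
  "wf_fm L (Dist t t') = (wf_trm L t \<and> wf_trm L t')"
| "wf_fm L (Rel R ts) = (R \<in> rels L \<and> length ts = rel_arity L R \<and> list_all (wf_trm L) ts)"
| "wf_fm L (Conn u \<phi>s) = (is_connective L u \<and> list_all (wf_fm L) \<phi>s)"
| "wf_fm L (Sup v \<phi>) = wf_fm L \<phi>"
| "wf_fm L (Inf v \<phi>) = wf_fm L \<phi>"

primrec trm_vars :: "('f, 'a, 'v) trm \<Rightarrow> 'v set" where
  "trm_vars (Var v) = {v}"
| "trm_vars (Param a) = {}"
| "trm_vars (App f ts) = \<Union>(set (map trm_vars ts))"

primrec free_vars :: "('f, 'r, 'a, 'v) fm \<Rightarrow> 'v set" where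
  "free_vars (Dist t t') = trm_vars t \<union> trm_vars t'"
| "free_vars (Rel R ts) = \<Union>(set (map trm_vars ts))"
| "free_vars (Conn u \<phi>s) = \<Union>(set (map free_vars \<phi>s))"
| "free_vars (Sup v \<phi>) = free_vars \<phi> - {v}"
| "free_vars (Inf v \<phi>) = free_vars \<phi> - {v}"

primrec trm_params :: "('f, 'a, 'v) trm \<Rightarrow> 'a set" where
  "trm_params (Var v) = {}"
| "trm_params (Param a) = {a}"
| "trm_params (App f ts) = \<Union>(set (map trm_params ts))"

primrec params :: "('f, 'r, 'a, 'v) fm \<Rightarrow> 'a set" where
  "params (Dist t t') = trm_params t \<union> trm_params t'"
| "params (Rel R ts) = \<Union>(set (map trm_params ts))"
| "params (Conn u \<phi>s) = \<Union>(set (map params \<phi>s))"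
| "params (Sup v \<phi>) = params \<phi>"
| "params (Inf v \<phi>) = params \<phi>"

primrec trm_val :: "('f, 'r, 'a) mstruct \<Rightarrow> ('f, 'a, 'v) trm \<Rightarrow> ('v \<Rightarrow> 'a) \<Rightarrow> 'a" where
  "trm_val U (Var v) s = s v"
| "trm_val U (Param a) s = a"
| "trm_val U (App f ts) s = fun_interp U f (map (\<lambda>t. trm_val U t s) ts)"

primrec fm_val :: "('f, 'r, 'a) mstruct \<Rightarrow> ('f, 'r, 'a, 'v) fm \<Rightarrow> ('v \<Rightarrow> 'a) \<Rightarrow> real" where
  "fm_val U (Dist t t') s = mdistance U (trm_val U t s) (trm_val U t' s)"
| "fm_val U (Rel R ts) s = rel_interp U R (map (\<lambda>t. trm_val U t s) ts)"
| "fm_val U (Conn u \<phi>s) s =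
     u (\<lambda>i. if i < length \<phi>s then map (\<lambda>\<phi>. fm_val U \<phi> s) \<phi>s ! i else 0)"
| "fm_val U (Sup v \<phi>) s = (SUP a\<in>universe U. fm_val U \<phi> (s(v := a)))"
| "fm_val U (Inf v \<phi>) s = (INF a\<in>universe U. fm_val U \<phi> (s(v := a)))"

text \<open>The formulas over \<open>A\<close> in the (possibly infinite) tuple of variables \<open>X\<close>.\<close>

definition formulas :: "('f, 'r) language \<Rightarrow> 'v set \<Rightarrow> 'a set \<Rightarrow> ('f, 'r, 'a, 'v) fm set" where
  "formulas L X A = {\<phi>. wf_fm L \<phi> \<and> free_vars \<phi> \<subseteq> X \<and> params \<phi> \<subseteq> A}"

text \<open>A sentence \<open>\<phi>\<close> in a theory stands for the axiom \<open>\<phi> = 0\<close>.\<close>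

definition theory_of :: "('f, 'r) language \<Rightarrow> ('f, 'r, 'a) mstruct \<Rightarrow> ('f, 'r, 'a, 'v) fm set" where
  "theory_of L U = {\<phi>\<in>formulas L {} {}. \<forall>s. fm_val U \<phi> s = 0}"

definition elem_substructure ::
  "'v itself \<Rightarrow> ('f, 'r) language \<Rightarrow> ('f, 'r, 'a) mstruct \<Rightarrow> ('f, 'r, 'a) mstruct \<Rightarrow> bool" where
  "elem_substructure V L M U \<longleftrightarrow>
     is_structure L M \<and> is_structure L U \<and> universe M \<subseteq> universe U \<and>
     (\<forall>f\<in>funs L. \<forall>xs\<in>tuples M (fun_arity L f). fun_interp M f xs = fun_interp U f xs) \<and>
     (\<forall>\<phi>\<in>(formulas L UNIV {} :: ('f, 'r, 'a, 'v) fm set). \<forall>s\<in>UNIV \<rightarrow> universe M.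
        fm_val M \<phi> s = fm_val U \<phi> s)"

section \<open>Types\<close>

text \<open>
  A complete type over \<open>A\<close> assigns to each formula over \<open>A\<close> its value; it is consistent with the
  elementary diagram of \<open>U\<close> iff it is finitely approximately satisfiable in \<open>U\<close>.
\<close>

definition types ::
  "('f, 'r) language \<Rightarrow> ('f, 'r, 'a) mstruct \<Rightarrow> 'v set \<Rightarrow> 'a set \<Rightarrow> (('f, 'r, 'a, 'v) fm \<Rightarrow> real) set" where
  "types L U X A =
     {p\<in>extensional (formulas L X A).
        \<forall>F \<epsilon>. finite F \<and> F \<subseteq> formulas L X A \<and> \<epsilon> > 0 \<longrightarrow>
          (\<exists>a\<in>X \<rightarrow> universe U. \<forall>\<phi>\<in>F. \<bar>fm_val U \<phi> a - p \<phi>\<bar> < \<epsilon>)}"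

definition tp ::
  "('f, 'r) language \<Rightarrow> ('f, 'r, 'a) mstruct \<Rightarrow> 'v set \<Rightarrow> 'a set \<Rightarrow> ('v \<Rightarrow> 'a) \<Rightarrow> ('f, 'r, 'a, 'v) fm \<Rightarrow> real" where
  "tp L U X A a = restrict (\<lambda>\<phi>. fm_val U \<phi> a) (formulas L X A)"

definition realizes ::
  "('f, 'r) language \<Rightarrow> ('f, 'r, 'a) mstruct \<Rightarrow> 'v set \<Rightarrow> 'a set \<Rightarrow> ('v \<Rightarrow> 'a) \<Rightarrow>
   (('f, 'r, 'a, 'v) fm \<Rightarrow> real) \<Rightarrow> bool" where
  \<comment> \<open>\<open>a\<close> realizes \<open>p\<close> restricted to \<open>A\<close>\<close>
  "realizes L U X A a p \<longleftrightarrow> a \<in> X \<rightarrow> universe U \<and> tp L U X A a = restrict p (formulas L X A)"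

text \<open>The logic topology is the coarsest one making the evaluation at every formula continuous.\<close>

definition type_space ::
  "('f, 'r) language \<Rightarrow> ('f, 'r, 'a) mstruct \<Rightarrow> 'v set \<Rightarrow> 'a set \<Rightarrow> (('f, 'r, 'a, 'v) fm \<Rightarrow> real) topology" where
  "type_space L U X A =
     subtopology (product_topology (\<lambda>_. euclideanreal) (formulas L X A)) (types L U X A)"

section \<open>Monster models\<close>

definition automorphism :: "('f, 'r) language \<Rightarrow> ('f, 'r, 'a) mstruct \<Rightarrow> ('a \<Rightarrow> 'a) \<Rightarrow> bool" where
  "automorphism L U \<sigma> \<longleftrightarrow>
     bij_betw \<sigma> (universe U) (universe U) \<and>
     (\<forall>x\<in>universe U. \<forall>y\<in>universe U. mdistance U (\<sigma> x) (\<sigma> y) = mdistance U x y) \<and>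
     (\<forall>f\<in>funs L. \<forall>xs\<in>tuples U (fun_arity L f). \<sigma> (fun_interp U f xs) = fun_interp U f (map \<sigma> xs)) \<and>
     (\<forall>R\<in>rels L. \<forall>xs\<in>tuples U (rel_arity L R). rel_interp U R (map \<sigma> xs) = rel_interp U R xs)"

definition saturated ::
  "'v itself \<Rightarrow> ('f, 'r) language \<Rightarrow> 'k rel \<Rightarrow> ('f, 'r, 'a) mstruct \<Rightarrow> bool" where
  "saturated V L \<kappa> U \<longleftrightarrow>
     (\<forall>A X. A \<subseteq> universe U \<and> |A| <o \<kappa> \<and> |X :: 'v set| <o \<kappa> \<longrightarrow>
        (\<forall>p\<in>types L U X A. \<exists>a. realizes L U X A a p))"

definition partial_elementary ::
  "'v itself \<Rightarrow> ('f, 'r) language \<Rightarrow> ('f, 'r, 'a) mstruct \<Rightarrow> 'a set \<Rightarrow> ('a \<Rightarrow> 'a) \<Rightarrow> bool" where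
  "partial_elementary V L U A f \<longleftrightarrow>
     f \<in> A \<rightarrow> universe U \<and>
     (\<forall>\<phi>\<in>(formulas L UNIV {} :: ('f, 'r, 'a, 'v) fm set). \<forall>s\<in>UNIV \<rightarrow> A.
        fm_val U \<phi> (f \<circ> s) = fm_val U \<phi> s)"

definition strongly_homogeneous ::
  "'v itself \<Rightarrow> ('f, 'r) language \<Rightarrow> 'k rel \<Rightarrow> ('f, 'r, 'a) mstruct \<Rightarrow> bool" where
  "strongly_homogeneous V L \<kappa> U \<longleftrightarrow>
     (\<forall>A f. A \<subseteq> universe U \<and> |A| <o \<kappa> \<and> partial_elementary V L U A f \<longrightarrow>
        (\<exists>\<sigma>. automorphism L U \<sigma> \<and> (\<forall>a\<in>A. \<sigma> a = f a)))"

text \<open>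
  \<open>\<kappa>\<close> is an uncountable cardinal above the size of the language; ``small'' means of cardinality less
  than \<open>\<kappa>\<close>.  A complete theory is identified with the set of all its consequences, that is, with the
  full theory of any of its models.
\<close>

definition monster_model ::
  "('f, 'r) language \<Rightarrow> ('f, 'r, 'a, 'v) fm set \<Rightarrow> 'k rel \<Rightarrow> ('f, 'r, 'a) mstruct \<Rightarrow> bool" where
  "monster_model L T \<kappa> U \<longleftrightarrow>
     Card_order \<kappa> \<and> natLeq <o \<kappa> \<and> |funs L| <o \<kappa> \<and> |rels L| <o \<kappa> \<and>
     is_structure L U \<and> T = theory_of L U \<and>
     saturated TYPE('v) L \<kappa> U \<and> strongly_homogeneous TYPE('v) L \<kappa> U"

section \<open>Invariant types, Morley products and generic stability\<close>

definition invariant_type ::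
  "('f, 'r) language \<Rightarrow> ('f, 'r, 'a) mstruct \<Rightarrow> ('f, 'r, 'a) mstruct \<Rightarrow> 'v set \<Rightarrow>
   (('f, 'r, 'a, 'v) fm \<Rightarrow> real) \<Rightarrow> bool" where
  \<comment> \<open>\<open>map_fm id id \<sigma> id\<close> applies \<open>\<sigma>\<close> to the parameters of a formula\<close>
  "invariant_type L U M X p \<longleftrightarrow>
     p \<in> types L U X (universe U) \<and>
     (\<forall>\<sigma>. automorphism L U \<sigma> \<and> (\<forall>m\<in>universe M. \<sigma> m = m) \<longrightarrow>
        (\<forall>\<phi>\<in>formulas L X (universe U). p (map_fm id id \<sigma> id \<phi>) = p \<phi>))"

text \<open>The canonical \<open>M\<close>-invariant extension of \<open>p\<close> to the larger monster model \<open>U'\<close>.\<close>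

definition invariant_extension ::
  "('f, 'r) language \<Rightarrow> ('f, 'r, 'a) mstruct \<Rightarrow> ('f, 'r, 'a) mstruct \<Rightarrow> ('f, 'r, 'a) mstruct \<Rightarrow>
   'v set \<Rightarrow> (('f, 'r, 'a, 'v) fm \<Rightarrow> real) \<Rightarrow> ('f, 'r, 'a, 'v) fm \<Rightarrow> real" where
  "invariant_extension L U' U M X p =
     (THE r. invariant_type L U' M X r \<and> restrict r (formulas L X (universe U)) = p)"

definition morley_product ::
  "('f, 'r) language \<Rightarrow> ('f, 'r, 'a) mstruct \<Rightarrow> ('f, 'r, 'a) mstruct \<Rightarrow> ('f, 'r, 'a) mstruct \<Rightarrow>
   'v set \<Rightarrow> 'v set \<Rightarrow> (('f, 'r, 'a, 'v) fm \<Rightarrow> real) \<Rightarrow> (('f, 'r, 'a, 'v) fm \<Rightarrow> real) \<Rightarrow>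
   ('f, 'r, 'a, 'v) fm \<Rightarrow> real" where
  "morley_product L U' U M X Y p q =
     (THE s. \<exists>a b.
        realizes L U' Y (universe U) b q \<and>
        realizes L U' X (universe U \<union> b ` Y) a (invariant_extension L U' U M X p) \<and>
        s = tp L U' (X \<union> Y) (universe U) (override_on b a X))"

definition morley_sequence ::
  "('f, 'r) language \<Rightarrow> ('f, 'r, 'a) mstruct \<Rightarrow> ('f, 'r, 'a) mstruct \<Rightarrow> 'v set \<Rightarrow>
   (('f, 'r, 'a, 'v) fm \<Rightarrow> real) \<Rightarrow> (nat \<Rightarrow> 'v \<Rightarrow> 'a) \<Rightarrow> bool" where
  "morley_sequence L U M X p a \<longleftrightarrow>
     (\<forall>i. realizes L U X (universe M \<union> (\<Union>j<i. a j ` X)) (a i) p)"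

definition generically_stable ::
  "('f, 'r) language \<Rightarrow> ('f, 'r, 'a) mstruct \<Rightarrow> ('f, 'r, 'a) mstruct \<Rightarrow> 'v set \<Rightarrow>
   (('f, 'r, 'a, 'v) fm \<Rightarrow> real) \<Rightarrow> bool" where
  "generically_stable L U M X p \<longleftrightarrow>
     invariant_type L U M X p \<and>
     (\<forall>a. morley_sequence L U M X p a \<longrightarrow>
        limitin (type_space L U X (universe U)) (\<lambda>i. tp L U X (universe U) (a i)) p sequentially)"

end

theory Submission
  imports Defs
begin

text \<open>
  If the limit fails along a Morley sequence \<open>(a\<^sub>i, b\<^sub>i)\<close> of \<open>p \<otimes> q\<close>, then after passing to a subsequence
  some \<open>\<phi>(x, y, c)\<close> differs on every \<open>(a\<^sub>i, b\<^sub>i)\<close> by at least \<open>\<epsilon>\<close> from its value in \<open>p \<otimes> q\<close>; say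
  that \<open>(a\<^sub>i, b\<^sub>i, c)\<close> is bad.  The contradiction comes from a conjugate of \<open>c\<close>, independent of a single
  \<open>a \<Turnstile> p\<close>, for which \<open>(a, y\<^sub>j, c)\<close> is bad for a whole Morley sequence \<open>(y\<^sub>j)\<close> in \<open>q\<close> over \<open>Ma\<close>: as \<open>q\<close> is
  generically stable and commutes with \<open>p\<close>, the values must converge to the one in \<open>p \<otimes> q\<close>.

  To find it, choose a Morley sequence \<open>a\<^sub>i\<close> together with independent Morley sequences \<open>b\<^sub>i\<^sub>,\<^sub>k\<close> in \<open>q\<close>.  For
  each \<open>l\<close> the sequence \<open>(a\<^sub>i, b\<^sub>i\<^sub>,\<^sub>l\<^sub>(\<^sub>i\<^sub>))\<close> is Morley in \<open>p \<otimes> q\<close>, so it is bad for some conjugate \<open>c\<^sub>l\<close> of \<open>c\<close>.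
  Split the indices into infinite blocks, with \<open>l\<close> constant on each of them.  Since \<open>a\<^sub>i\<close> converges to \<open>p\<close>,
  letting \<open>i\<close> tend to infinity inside the \<open>m\<close>-th block moves all \<open>a\<^sub>i\<close> to one \<open>a\<close> that realizes \<open>p\<close> over all \<open>c\<^sub>l\<close>,
  and turns the \<open>b\<^sub>i\<^sub>,\<^sub>k\<close> into Morley sequences \<open>(b\<^sub>m\<^sub>,\<^sub>k)\<^sub>k\<close> such that \<open>(a, b\<^sub>m\<^sub>,\<^sub>k, c\<^sub>l)\<close> is bad whenever \<open>l\<close> has value
  \<open>k\<close> on block \<open>m\<close>.  Since \<open>b\<^sub>m\<^sub>,\<^sub>k\<close> converges to \<open>q\<close> for \<open>k \<rightarrow> \<infinity>\<close>, taking limits block after block replaces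
  \<open>b\<^sub>0\<^sub>,\<^sub>k, b\<^sub>1\<^sub>,\<^sub>k, \<dots>\<close> by a Morley sequence \<open>y\<^sub>0, y\<^sub>1, \<dots>\<close> over \<open>Ma\<close>.
\<close>

section \<open>Substitution\<close>

text \<open>Parameters are substituted together with variables, because making a formula
  parameter-free means turning each parameter into a variable.\<close>

primrec tsub :: "('v \<Rightarrow> ('f, 'a, 'v) trm) \<Rightarrow> ('a \<Rightarrow> ('f, 'a, 'v) trm) \<Rightarrow> ('f, 'a, 'v) trm \<Rightarrow> ('f, 'a, 'v) trm" where
  "tsub \<theta> \<pi> (Var v) = \<theta> v"
| "tsub \<theta> \<pi> (Param a) = \<pi> a"
| "tsub \<theta> \<pi> (App f ts) = App f (map (tsub \<theta> \<pi>) ts)"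

text \<open>Bound variables are renamed by \<open>\<rho>\<close>, which avoids capture if the range of \<open>\<rho>\<close> is fresh.\<close>

primrec fsub ::
  "('v \<Rightarrow> 'v) \<Rightarrow> ('a \<Rightarrow> ('f, 'a, 'v) trm) \<Rightarrow> ('f, 'r, 'a, 'v) fm \<Rightarrow> ('v \<Rightarrow> ('f, 'a, 'v) trm) \<Rightarrow> ('f, 'r, 'a, 'v) fm" where
  "fsub \<rho> \<pi> (Dist t t') = (\<lambda>\<theta>. Dist (tsub \<theta> \<pi> t) (tsub \<theta> \<pi> t'))"
| "fsub \<rho> \<pi> (Rel R ts) = (\<lambda>\<theta>. Rel R (map (tsub \<theta> \<pi>) ts))"
| "fsub \<rho> \<pi> (Conn u \<phi>s) = (\<lambda>\<theta>. Conn u (map (\<lambda>f. f \<theta>) (map (fsub \<rho> \<pi>) \<phi>s)))"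
| "fsub \<rho> \<pi> (Sup v \<phi>) = (\<lambda>\<theta>. Sup (\<rho> v) (fsub \<rho> \<pi> \<phi> (\<theta>(v := Var (\<rho> v)))))"
| "fsub \<rho> \<pi> (Inf v \<phi>) = (\<lambda>\<theta>. Inf (\<rho> v) (fsub \<rho> \<pi> \<phi> (\<theta>(v := Var (\<rho> v)))))"

section \<open>Renaming of parameters and dependence of values on variables\<close>

lemma map_trm_simps:
  "map_trm id g id (Var v) = Var v"
  "map_trm id g id (Param a) = Param (g a)"
  "map_trm id g id (App f ts) = App f (map (map_trm id g id) ts)"
  by (simp_all add: id_def)

lemma map_fm_simps:
  "map_fm id id g id (Dist t t') = Dist (map_trm id g id t) (map_trm id g id t')"
  "map_fm id id g id (Rel R ts) = Rel R (map (map_trm id g id) ts)"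
  "map_fm id id g id (Conn u \<phi>s) = Conn u (map (map_fm id id g id) \<phi>s)"
  "map_fm id id g id (Sup v \<phi>) = Sup v (map_fm id id g id \<phi>)"
  "map_fm id id g id (Inf v \<phi>) = Inf v (map_fm id id g id \<phi>)"
  by (simp_all add: id_def)

text \<open>Formulas are mapped only in their parameters below. The general map equations are
  therefore replaced by this special case, for both spellings of the identity.\<close>

declare fm.map [simp del] trm.map [simp del]
  map_trm_simps [simp] map_fm_simps [simp] map_trm_simps [unfolded id_def, simp] map_fm_simps [unfolded id_def, simp]

lemma trm_params_eq: "trm_params t = set2_trm t"
  by (induction t) auto

lemma trm_vars_eq: "trm_vars t = set3_trm t"
  by (induction t) auto

lemma params_eq: "params \<phi> = set3_fm \<phi>"
  by (induction \<phi>) (auto simp: trm_params_eq)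

text \<open>\<open>set4_fm\<close> is the set of all variables of a formula, bound ones included; it
  is the set against which freshness is measured.\<close>

lemma free_vars_subset: "free_vars \<phi> \<subseteq> set4_fm \<phi>"
  by (induction \<phi>) (auto simp: trm_vars_eq)

lemma finite_trm_vars: "finite (set3_trm t)"
  by (induction t) auto

lemma finite_trm_params: "finite (set2_trm t)"
  by (induction t) auto

lemma finite_vars: "finite (set4_fm \<phi>)"
  by (induction \<phi>) (auto simp: finite_trm_vars)

lemma finite_free_vars: "finite (free_vars \<phi>)"
  using finite_subset[OF free_vars_subset finite_vars] .

lemma finite_params: "finite (params \<phi>)"
  unfolding params_eq by (induction \<phi>) (auto simp: finite_trm_params)

lemma trm_val_cong: "(\<And>v. v \<in> trm_vars t \<Longrightarrow> s v = s' v) \<Longrightarrow> trm_val N t s = trm_val N t s'"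
proof (induction t)
  case (App f ts)
  have "map (\<lambda>t. trm_val N t s) ts = map (\<lambda>t. trm_val N t s') ts"
    using App by (intro map_cong) auto
  then show ?case by (simp only: trm_val.simps)
qed auto

lemma fm_val_cong: "(\<And>v. v \<in> free_vars \<phi> \<Longrightarrow> s v = s' v) \<Longrightarrow> fm_val N \<phi> s = fm_val N \<phi> s'"
proof (induction \<phi> arbitrary: s s')
  case (Dist t t')
  then show ?case using trm_val_cong[of t s s' N] trm_val_cong[of t' s s' N] by auto
next
  case (Rel R ts)
  have "map (\<lambda>t. trm_val N t s) ts = map (\<lambda>t. trm_val N t s') ts"
    using Rel by (intro map_cong refl trm_val_cong) auto
  then show ?case by (simp only: fm_val.simps)
next
  case (Conn u \<phi>s)
  have *: "map (\<lambda>\<phi>. fm_val N \<phi> s) \<phi>s = map (\<lambda>\<phi>. fm_val N \<phi> s') \<phi>s"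
  proof (rule map_cong[OF refl])
    fix \<psi> assume "\<psi> \<in> set \<phi>s"
    then show "fm_val N \<psi> s = fm_val N \<psi> s'" using Conn.prems by (intro Conn.IH) auto
  qed
  show ?case unfolding fm_val.simps * ..
next
  case (Sup v \<phi>)
  have "fm_val N \<phi> (s(v := a)) = fm_val N \<phi> (s'(v := a))" for a
    using Sup.prems by (intro Sup.IH) auto
  then show ?case by simp
next
  case (Inf v \<phi>)
  have "fm_val N \<phi> (s(v := a)) = fm_val N \<phi> (s'(v := a))" for a
    using Inf.prems by (intro Inf.IH) auto
  then show ?case by simp
qed

lemma map_params_cong:
  "(\<And>a. a \<in> params \<phi> \<Longrightarrow> g a = h a) \<Longrightarrow> map_fm id id g id \<phi> = map_fm id id h id \<phi>"
  by (intro fm.map_cong) (auto simp: params_eq)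

lemma map_params_id: "(\<And>a. a \<in> params \<phi> \<Longrightarrow> g a = a) \<Longrightarrow> map_fm id id g id \<phi> = \<phi>"
  using map_params_cong[of \<phi> g id] by (simp add: fm.map_id id_def[symmetric])

lemma params_map [simp, unfolded id_def, simp]: "params (map_fm id id g id \<phi>) = g ` params \<phi>"
  by (simp add: params_eq fm.set_map)

lemma trm_vars_map [simp, unfolded id_def, simp]: "trm_vars (map_trm id g id t) = trm_vars t"
  by (simp add: trm_vars_eq trm.set_map)

lemma free_vars_map [simp, unfolded id_def, simp]: "free_vars (map_fm id id g id \<phi>) = free_vars \<phi>"
  by (induction \<phi>) (simp_all add: image_image)

lemma wf_trm_map [simp, unfolded id_def, simp]: "wf_trm L (map_trm id g id t) = wf_trm L t"
  by (induction t) (auto simp: list_all_iff)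

lemma wf_fm_map [simp, unfolded id_def, simp]: "wf_fm L (map_fm id id g id \<phi>) = wf_fm L \<phi>"
  by (induction \<phi>) (simp_all add: list_all_iff)

lemma map_params_comp:
  "map_fm id id g id (map_fm id id h id \<phi>) = map_fm id id (g \<circ> h) id \<phi>"
  by (simp add: fm.map_comp)

lemma map_formulas:
  assumes "\<phi> \<in> formulas L X A" "g ` params \<phi> \<subseteq> B"
  shows "map_fm id id g id \<phi> \<in> formulas L X B"
  using assms by (auto simp: formulas_def)

section \<open>The substitution lemma\<close>

lemma trm_val_tsub:
  "trm_val N (tsub \<theta> \<pi> t) s =
     trm_val N (map_trm id (\<lambda>a. trm_val N (\<pi> a) s) id t) (\<lambda>u. trm_val N (\<theta> u) s)"
proof (induction t)
  case (App f ts)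
  have "map (\<lambda>t. trm_val N (tsub \<theta> \<pi> t) s) ts =
      map (\<lambda>t. trm_val N (map_trm id (\<lambda>a. trm_val N (\<pi> a) s) id t) (\<lambda>u. trm_val N (\<theta> u) s)) ts"
    by (rule map_cong[OF refl]) (rule App.IH)
  then show ?case by (simp only: map_trm_simps tsub.simps trm_val.simps map_map comp_def)
qed auto

text \<open>The step under a quantifier, common to \<open>Sup\<close> and \<open>Inf\<close> in the
  induction for \<open>fm_val_fsub\<close>. The induction hypothesis is taken for all \<theta> and
  \<open>s\<close>, since both are updated at the bound variable.\<close>

lemma quant_aux:
  assumes "inj_on \<rho> (insert v (set4_fm \<phi>))"
    and "\<And>a. a \<in> params \<phi> \<Longrightarrow> trm_vars (\<pi> a) \<inter> \<rho> ` (insert v (set4_fm \<phi>)) = {}"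
    and "\<And>u. u \<in> free_vars \<phi> - {v} \<Longrightarrow>
           \<theta> u = Var (\<rho> u) \<or> trm_vars (\<theta> u) \<inter> \<rho> ` (insert v (set4_fm \<phi>)) = {}"
    and IH: "\<And>\<theta> s. (\<And>u. u \<in> free_vars \<phi> \<Longrightarrow>
           \<theta> u = Var (\<rho> u) \<or> trm_vars (\<theta> u) \<inter> \<rho> ` set4_fm \<phi> = {}) \<Longrightarrow>
           fm_val N (fsub \<rho> \<pi> \<phi> \<theta>) s =
             fm_val N (map_fm id id (\<lambda>a. trm_val N (\<pi> a) s) id \<phi>) (\<lambda>u. trm_val N (\<theta> u) s)"
  shows "fm_val N (fsub \<rho> \<pi> \<phi> (\<theta>(v := Var (\<rho> v)))) (s(\<rho> v := x)) =
     fm_val N (map_fm id id (\<lambda>a. trm_val N (\<pi> a) s) id \<phi>) ((\<lambda>u. trm_val N (\<theta> u) s)(v := x))"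
proof -
  let ?\<theta> = "\<theta>(v := Var (\<rho> v))" and ?s = "s(\<rho> v := x)"
  have 1: "fm_val N (fsub \<rho> \<pi> \<phi> ?\<theta>) ?s =
             fm_val N (map_fm id id (\<lambda>a. trm_val N (\<pi> a) ?s) id \<phi>) (\<lambda>u. trm_val N (?\<theta> u) ?s)"
    using assms(3) by (intro IH) auto
  have 2: "map_fm id id (\<lambda>a. trm_val N (\<pi> a) ?s) id \<phi> = map_fm id id (\<lambda>a. trm_val N (\<pi> a) s) id \<phi>"
    using assms(2) by (intro map_params_cong trm_val_cong) fastforce
  \<comment> \<open>A variable other than \<open>v\<close> does not notice the new value at
    \<open>\<rho> v\<close>: either its term omits \<open>\<rho> v\<close>, or it is the variable
    \<open>\<rho> u\<close>, which differs from \<open>\<rho> v\<close> by injectivity.\<close>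
  have 3: "trm_val N (?\<theta> u) ?s = ((\<lambda>u. trm_val N (\<theta> u) s)(v := x)) u" if u: "u \<in> free_vars \<phi>" for u
  proof (cases "u = v")
    case False
    then have "\<theta> u = Var (\<rho> u) \<or> \<rho> v \<notin> trm_vars (\<theta> u)" using assms(3)[of u] u by auto
    moreover have "\<rho> u \<noteq> \<rho> v"
      using assms(1) False u free_vars_subset[of \<phi>] by (auto simp: inj_on_def)
    ultimately show ?thesis
      using False trm_val_cong[of "\<theta> u" ?s s N] by (auto intro!: trm_val_cong)
  qed auto
  show ?thesis unfolding 1 2 using 3 by (intro fm_val_cong) auto
qed

text \<open>Capture is excluded because the substituted terms avoid the renamed variables. The
  alternative \<open>\<theta> u = Var (\<rho> u)\<close> describes a variable whose quantifier the
  recursion has already passed; without it the induction would not go through.\<close>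

lemma fm_val_fsub:
  fixes \<phi> :: "('f, 'r, 'a, 'v) fm" and \<theta> :: "'v \<Rightarrow> ('f, 'a, 'v) trm"
  assumes "inj_on \<rho> (set4_fm \<phi>)"
    and "\<And>a. a \<in> params \<phi> \<Longrightarrow> trm_vars (\<pi> a) \<inter> \<rho> ` set4_fm \<phi> = {}"
    and "\<And>u. u \<in> free_vars \<phi> \<Longrightarrow> \<theta> u = Var (\<rho> u) \<or> trm_vars (\<theta> u) \<inter> \<rho> ` set4_fm \<phi> = {}"
  shows "fm_val N (fsub \<rho> \<pi> \<phi> \<theta>) s =
     fm_val N (map_fm id id (\<lambda>a. trm_val N (\<pi> a) s) id \<phi>) (\<lambda>u. trm_val N (\<theta> u) s)"
  using assms
proof (induction \<phi> arbitrary: \<theta> s)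
  case (Rel R ts)
  have "map (\<lambda>t. trm_val N (tsub \<theta> \<pi> t) s) ts =
      map (\<lambda>t. trm_val N (map_trm id (\<lambda>a. trm_val N (\<pi> a) s) id t) (\<lambda>u. trm_val N (\<theta> u) s)) ts"
    by (simp add: trm_val_tsub)
  then show ?case by (simp only: map_fm_simps fsub.simps fm_val.simps map_map comp_def)
next
  case (Conn u \<phi>s)
  have "fm_val N (fsub \<rho> \<pi> \<psi> \<theta>) s =
     fm_val N (map_fm id id (\<lambda>a. trm_val N (\<pi> a) s) id \<psi>) (\<lambda>u. trm_val N (\<theta> u) s)"
    if \<psi>: "\<psi> \<in> set \<phi>s" for \<psi>
  proof (rule Conn.IH[OF \<psi>])
    show "inj_on \<rho> (set4_fm \<psi>)" using Conn.prems(1) \<psi> by (auto elim!: inj_on_subset)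
    show "trm_vars (\<pi> a) \<inter> \<rho> ` set4_fm \<psi> = {}" if "a \<in> params \<psi>" for a
      using Conn.prems(2)[of a] that \<psi> by fastforce
    show "\<theta> u = Var (\<rho> u) \<or> trm_vars (\<theta> u) \<inter> \<rho> ` set4_fm \<psi> = {}" if "u \<in> free_vars \<psi>" for u
      using Conn.prems(3)[of u] that \<psi> by fastforce
  qed
  then have "map (\<lambda>\<psi>. fm_val N (fsub \<rho> \<pi> \<psi> \<theta>) s) \<phi>s =
      map (\<lambda>\<psi>. fm_val N (map_fm id id (\<lambda>a. trm_val N (\<pi> a) s) id \<psi>) (\<lambda>u. trm_val N (\<theta> u) s)) \<phi>s"
    by (intro map_cong) auto
  then show ?case by (simp only: map_fm_simps fsub.simps fm_val.simps map_map comp_def length_map)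
next
  case (Sup v \<phi>)
  have "fm_val N (fsub \<rho> \<pi> \<phi> (\<theta>(v := Var (\<rho> v)))) (s(\<rho> v := x)) =
     fm_val N (map_fm id id (\<lambda>a. trm_val N (\<pi> a) s) id \<phi>) ((\<lambda>u. trm_val N (\<theta> u) s)(v := x))" for x
    proof (rule quant_aux)
    show "inj_on \<rho> (insert v (set4_fm \<phi>))" using Sup.prems(1) by simp
    then have inj: "inj_on \<rho> (set4_fm \<phi>)" by (rule inj_on_subset) auto
    have \<pi>: "trm_vars (\<pi> a) \<inter> \<rho> ` set4_fm \<phi> = {}" if "a \<in> params \<phi>" for a
      using Sup.prems(2)[of a] that by auto
    fix \<theta> :: "'v \<Rightarrow> ('f, 'a, 'v) trm" and s
    assume "\<And>u. u \<in> free_vars \<phi> \<Longrightarrow> \<theta> u = Var (\<rho> u) \<or> trm_vars (\<theta> u) \<inter> \<rho> ` set4_fm \<phi> = {}"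
    from Sup.IH[OF inj \<pi> this]
    show "fm_val N (fsub \<rho> \<pi> \<phi> \<theta>) s =
       fm_val N (map_fm id id (\<lambda>a. trm_val N (\<pi> a) s) id \<phi>) (\<lambda>u. trm_val N (\<theta> u) s)" by blast
  qed (use Sup.prems(2,3) in auto)
  then show ?case by (simp only: map_fm_simps fsub.simps fm_val.simps)
next
  case (Inf v \<phi>)
  have "fm_val N (fsub \<rho> \<pi> \<phi> (\<theta>(v := Var (\<rho> v)))) (s(\<rho> v := x)) =
     fm_val N (map_fm id id (\<lambda>a. trm_val N (\<pi> a) s) id \<phi>) ((\<lambda>u. trm_val N (\<theta> u) s)(v := x))" for x
    proof (rule quant_aux)
    show "inj_on \<rho> (insert v (set4_fm \<phi>))" using Inf.prems(1) by simp
    then have inj: "inj_on \<rho> (set4_fm \<phi>)" by (rule inj_on_subset) auto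
    have \<pi>: "trm_vars (\<pi> a) \<inter> \<rho> ` set4_fm \<phi> = {}" if "a \<in> params \<phi>" for a
      using Inf.prems(2)[of a] that by auto
    fix \<theta> :: "'v \<Rightarrow> ('f, 'a, 'v) trm" and s
    assume "\<And>u. u \<in> free_vars \<phi> \<Longrightarrow> \<theta> u = Var (\<rho> u) \<or> trm_vars (\<theta> u) \<inter> \<rho> ` set4_fm \<phi> = {}"
    from Inf.IH[OF inj \<pi> this]
    show "fm_val N (fsub \<rho> \<pi> \<phi> \<theta>) s =
       fm_val N (map_fm id id (\<lambda>a. trm_val N (\<pi> a) s) id \<phi>) (\<lambda>u. trm_val N (\<theta> u) s)" by blast
  qed (use Inf.prems(2,3) in auto)
  then show ?case by (simp only: map_fm_simps fsub.simps fm_val.simps)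
qed (auto simp: trm_val_tsub)

lemma wf_tsub:
  "(\<And>u. wf_trm L (\<theta> u)) \<Longrightarrow> (\<And>a. wf_trm L (\<pi> a)) \<Longrightarrow> wf_trm L t \<Longrightarrow> wf_trm L (tsub \<theta> \<pi> t)"
  by (induction t) (auto simp: list_all_iff)

lemma wf_fsub:
  "(\<And>u. wf_trm L (\<theta> u)) \<Longrightarrow> (\<And>a. wf_trm L (\<pi> a)) \<Longrightarrow> wf_fm L \<phi> \<Longrightarrow> wf_fm L (fsub \<rho> \<pi> \<phi> \<theta>)"
proof (induction \<phi> arbitrary: \<theta>)
  case (Sup v \<phi>)
  then show ?case using Sup.IH[of "\<theta>(v := Var (\<rho> v))"] by auto
next
  case (Inf v \<phi>)
  then show ?case using Inf.IH[of "\<theta>(v := Var (\<rho> v))"] by auto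
qed (auto simp: list_all_iff wf_tsub)

lemma trm_vars_tsub:
  "trm_vars (tsub \<theta> \<pi> t) = (\<Union>u\<in>trm_vars t. trm_vars (\<theta> u)) \<union> (\<Union>a\<in>trm_params t. trm_vars (\<pi> a))"
  by (induction t) auto

lemma trm_params_tsub:
  "trm_params (tsub \<theta> \<pi> t) = (\<Union>u\<in>trm_vars t. trm_params (\<theta> u)) \<union> (\<Union>a\<in>trm_params t. trm_params (\<pi> a))"
  by (induction t) auto

lemma free_vars_fsub:
  "free_vars (fsub \<rho> \<pi> (\<phi> :: ('f, 'r, 'a, 'v) fm) \<theta>) \<subseteq> (\<Union>u\<in>free_vars \<phi>. trm_vars (\<theta> u)) \<union> (\<Union>a\<in>params \<phi>. trm_vars (\<pi> a))"
proof -
  \<comment> \<open>Applied with \<open>x\<close> the renamed bound variable: it enters through the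
    updated substitution and is removed again by the quantifier.\<close>
  have aux: "S \<subseteq> P \<union> R \<Longrightarrow> P \<subseteq> insert x Q \<Longrightarrow> S - {x} \<subseteq> Q \<union> R" for S P Q R :: "'v set" and x
    by blast
  show ?thesis
  proof (induction \<phi> arbitrary: \<theta>)
    case (Conn u \<phi>s)
    have "free_vars (fsub \<rho> \<pi> \<psi> \<theta>) \<subseteq>
        (\<Union>u\<in>free_vars (Conn u \<phi>s). trm_vars (\<theta> u)) \<union> (\<Union>a\<in>params (Conn u \<phi>s). trm_vars (\<pi> a))"
      if "\<psi> \<in> set \<phi>s" for \<psi>
      by (rule order_trans[OF Conn.IH[OF that, of \<theta>]]) (use that in \<open>simp, blast\<close>)
    then show ?case unfolding fsub.simps free_vars.simps(3) set_map image_image by (rule UN_least)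
  next
    case (Sup v \<phi>)
    have "(\<Union>u\<in>free_vars \<phi>. trm_vars ((\<theta>(v := Var (\<rho> v))) u)) \<subseteq>
        insert (\<rho> v) (\<Union>u\<in>free_vars \<phi> - {v}. trm_vars (\<theta> u))"
      by (auto split: if_splits)
    then show ?case unfolding fsub.simps free_vars.simps params.simps
      by (rule aux[OF Sup.IH[of "\<theta>(v := Var (\<rho> v))"]])
  next
    case (Inf v \<phi>)
    have "(\<Union>u\<in>free_vars \<phi>. trm_vars ((\<theta>(v := Var (\<rho> v))) u)) \<subseteq>
        insert (\<rho> v) (\<Union>u\<in>free_vars \<phi> - {v}. trm_vars (\<theta> u))"
      by (auto split: if_splits)
    then show ?case unfolding fsub.simps free_vars.simps params.simps
      by (rule aux[OF Inf.IH[of "\<theta>(v := Var (\<rho> v))"]])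
  qed (auto simp: trm_vars_tsub)
qed

lemma params_fsub:
  "params (fsub \<rho> \<pi> \<phi> \<theta>) \<subseteq> (\<Union>u\<in>free_vars \<phi>. trm_params (\<theta> u)) \<union> (\<Union>a\<in>params \<phi>. trm_params (\<pi> a))"
proof (induction \<phi> arbitrary: \<theta>)
  case (Conn u \<phi>s)
  have "params (fsub \<rho> \<pi> \<psi> \<theta>) \<subseteq>
      (\<Union>u\<in>free_vars (Conn u \<phi>s). trm_params (\<theta> u)) \<union> (\<Union>a\<in>params (Conn u \<phi>s). trm_params (\<pi> a))"
    if "\<psi> \<in> set \<phi>s" for \<psi>
    by (rule order_trans[OF Conn.IH[OF that, of \<theta>]]) (use that in \<open>simp, blast\<close>)
  then show ?case unfolding fsub.simps params.simps(3) set_map image_image by (rule UN_least)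
next
  case (Sup v \<phi>)
  have "(\<Union>u\<in>free_vars \<phi>. trm_params ((\<theta>(v := Var (\<rho> v))) u)) \<subseteq>
      (\<Union>u\<in>free_vars \<phi> - {v}. trm_params (\<theta> u))"
    by (auto split: if_splits)
  then show ?case unfolding fsub.simps free_vars.simps params.simps
    by (rule order_trans[OF Sup.IH[of "\<theta>(v := Var (\<rho> v))"] Un_mono[OF _ order_refl]])
next
  case (Inf v \<phi>)
  have "(\<Union>u\<in>free_vars \<phi>. trm_params ((\<theta>(v := Var (\<rho> v))) u)) \<subseteq>
      (\<Union>u\<in>free_vars \<phi> - {v}. trm_params (\<theta> u))"
    by (auto split: if_splits)
  then show ?case unfolding fsub.simps free_vars.simps params.simps
    by (rule order_trans[OF Inf.IH[of "\<theta>(v := Var (\<rho> v))"] Un_mono[OF _ order_refl]])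
qed (auto simp: trm_params_tsub)

text \<open>
  A formula with parameters is handled as a pair of a parameter-free formula \<open>\<phi>\<close> and a map \<open>\<theta>\<close> that
  sends each variable to an index (\<open>Inl\<close>) or to a parameter (\<open>Inr\<close>).
\<close>

definition sforms :: "('f, 'r) language \<Rightarrow> 'i set \<Rightarrow> 'a set \<Rightarrow> (('f, 'r, 'a, 'v) fm \<times> ('v \<Rightarrow> 'i + 'a)) set" where
  "sforms L I A = {(\<phi>, \<theta>). \<phi> \<in> formulas L UNIV {} \<and> \<theta> ` free_vars \<phi> \<subseteq> I <+> A}"

text \<open>Indices are substituted as variables and parameters as parameters. Since \<theta> may
  send a free variable to one that is bound in \<phi>, the bound variables are renamed into a fresh
  set \<open>B\<close>, which exists as there are infinitely many variables.\<close>

lemma formula_of_sform: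
  fixes \<phi> :: "('f, 'r, 'a, 'v) fm" and \<theta> :: "'v \<Rightarrow> 'v + 'a"
  assumes inf: "infinite (UNIV :: 'v set)" and "(\<phi>, \<theta>) \<in> sforms L X A"
  obtains \<psi> where "\<psi> \<in> formulas L X A"
    and "\<And>(N :: ('f, 'r, 'a) mstruct) s. fm_val N \<psi> s = fm_val N \<phi> (case_sum s id \<circ> \<theta>)"
proof -
  let ?t = "case_sum Var Param \<circ> \<theta> :: 'v \<Rightarrow> ('f, 'a, 'v) trm"
  let ?V = "\<Union>u\<in>free_vars \<phi>. trm_vars (?t u)"
  have wf: "wf_fm L \<phi>" "params \<phi> = {}" and \<theta>: "\<theta> ` free_vars \<phi> \<subseteq> X <+> A"
    using assms by (auto simp: sforms_def formulas_def)
  have "finite ?V" by (intro finite_UN_I finite_free_vars) (simp add: trm_vars_eq finite_trm_vars)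
  then have "infinite (- ?V)" using inf by (metis Compl_eq_Diff_UNIV Diff_infinite_finite)
  then obtain B where B: "B \<subseteq> - ?V" "finite B" "card B = card (set4_fm \<phi>)"
    by (meson infinite_arbitrarily_large)
  then obtain \<rho> where \<rho>: "bij_betw \<rho> (set4_fm \<phi>) B"
    using finite_vars finite_same_card_bij by metis
  have val: "fm_val N (fsub \<rho> Param \<phi> ?t) s = fm_val N \<phi> (case_sum s id \<circ> \<theta>)"
    for N :: "('f, 'r, 'a) mstruct" and s
  proof -
    have "fm_val N (fsub \<rho> Param \<phi> ?t) s =
        fm_val N (map_fm id id (\<lambda>a. trm_val N (Param a :: ('f, 'a, 'v) trm) s) id \<phi>) (\<lambda>u. trm_val N (?t u) s)"
      using \<rho> B(1) wf(2) by (intro fm_val_fsub) (auto simp: bij_betw_def)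
    also have "map_fm id id (\<lambda>a. trm_val N (Param a :: ('f, 'a, 'v) trm) s) id \<phi> = \<phi>"
      using wf(2) by (intro map_params_id) auto
    also have "(\<lambda>u. trm_val N (?t u) s) = case_sum s id \<circ> \<theta>"
      by (auto simp: fun_eq_iff split: sum.split)
    finally show ?thesis .
  qed
  have wt: "wf_trm L (?t u)" for u by (auto split: sum.split)
  have "trm_vars (?t u) \<subseteq> X \<and> trm_params (?t u) \<subseteq> A" if "u \<in> free_vars \<phi>" for u
    using \<theta> that by (auto split: sum.split)
  then have "(\<Union>u\<in>free_vars \<phi>. trm_vars (?t u)) \<subseteq> X" "(\<Union>u\<in>free_vars \<phi>. trm_params (?t u)) \<subseteq> A"
    by blast+
  then have "free_vars (fsub \<rho> Param \<phi> ?t) \<subseteq> X" "params (fsub \<rho> Param \<phi> ?t) \<subseteq> A"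
    using free_vars_fsub[of \<rho> Param \<phi> ?t] params_fsub[of \<rho> Param \<phi> ?t] wf(2) by simp_all
  then have "fsub \<rho> Param \<phi> ?t \<in> formulas L X A"
    using wf_fsub[of L ?t Param \<phi> \<rho>] wf(1) wt by (simp add: formulas_def)
  then show ?thesis using val that by blast
qed

text \<open>Each parameter is replaced by a fresh variable of \<open>B\<close>, and \<theta>
  remembers which one. The value is stated for all maps \<open>g\<close>, so that one pair describes
  \<phi> and all its images under maps of the parameters.\<close>

lemma sform_of_formula:
  fixes \<phi> :: "('f, 'r, 'a, 'v) fm"
  assumes inf: "infinite (UNIV :: 'v set)" and wf: "wf_fm L \<phi>"
  obtains \<psi> :: "('f, 'r, 'a, 'v) fm" and \<theta> :: "'v \<Rightarrow> 'v + 'a" where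
    "(\<psi>, \<theta>) \<in> sforms L (free_vars \<phi>) (params \<phi>)"
    "\<And>(N :: ('f, 'r, 'a) mstruct) g s. fm_val N (map_fm id id g id \<phi>) s = fm_val N \<psi> (case_sum s g \<circ> \<theta>)"
proof -
  have "infinite (- set4_fm \<phi>)" using inf finite_vars by (metis Compl_eq_Diff_UNIV Diff_infinite_finite)
  then obtain B where B: "B \<subseteq> - set4_fm \<phi>" "finite B" "card B = card (params \<phi>)"
    by (meson infinite_arbitrarily_large)
  then obtain j where j: "bij_betw j (params \<phi>) B"
    using finite_params finite_same_card_bij by metis
  \<comment> \<open>As \<open>B\<close> avoids every variable of \<phi>, bound variables can keep
    their names.\<close>
  define \<psi> :: "('f, 'r, 'a, 'v) fm" where "\<psi> = fsub id (Var \<circ> j) \<phi> Var"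
  define \<theta> where "\<theta> v = (if v \<in> B then Inr (inv_into (params \<phi>) j v) else Inl v)" for v
  have inv: "inv_into (params \<phi>) j (j a) = a" if "a \<in> params \<phi>" for a
    using j that by (simp add: bij_betw_inv_into_left)
  have jB: "j a \<in> B" if "a \<in> params \<phi>" for a using j that by (auto simp: bij_betw_def)
  have fv: "free_vars \<psi> \<subseteq> free_vars \<phi> \<union> B"
    using free_vars_fsub[of id "Var \<circ> j" \<phi> Var] jB unfolding \<psi>_def by auto
  have "params \<psi> \<subseteq> {}"
    using params_fsub[of id "Var \<circ> j" \<phi> Var] unfolding \<psi>_def by auto
  moreover have "wf_fm L \<psi>" unfolding \<psi>_def using wf by (intro wf_fsub) auto
  moreover have "\<theta> ` free_vars \<psi> \<subseteq> free_vars \<phi> <+> params \<phi>"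
  proof
    fix x assume "x \<in> \<theta> ` free_vars \<psi>"
    then obtain v where "v \<in> free_vars \<psi>" "x = \<theta> v" by auto
    then show "x \<in> free_vars \<phi> <+> params \<phi>"
      using fv j by (auto simp: \<theta>_def bij_betw_def inv_into_into)
  qed
  ultimately have 1: "(\<psi>, \<theta>) \<in> sforms L (free_vars \<phi>) (params \<phi>)"
    by (auto simp: sforms_def formulas_def)
  have 2: "fm_val N (map_fm id id g id \<phi>) s = fm_val N \<psi> (case_sum s g \<circ> \<theta>)"
    for N :: "('f, 'r, 'a) mstruct" and g s
  proof -
    let ?s = "case_sum s g \<circ> \<theta>"
    have "fm_val N \<psi> ?s = fm_val N (map_fm id id (\<lambda>a. trm_val N ((Var \<circ> j) a :: ('f, 'a, 'v) trm) ?s) id \<phi>)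
        (\<lambda>u. trm_val N (Var u :: ('f, 'a, 'v) trm) ?s)"
      unfolding \<psi>_def using B jB by (intro fm_val_fsub) auto
    also have "map_fm id id (\<lambda>a. trm_val N ((Var \<circ> j) a :: ('f, 'a, 'v) trm) ?s) id \<phi> = map_fm id id g id \<phi>"
      using jB inv by (intro map_params_cong) (auto simp: \<theta>_def)
    also have "fm_val N \<dots> (\<lambda>u. trm_val N (Var u :: ('f, 'a, 'v) trm) ?s) = fm_val N \<dots> s"
      using B free_vars_subset[of \<phi>] by (intro fm_val_cong) (auto simp: \<theta>_def)
    finally show ?thesis by (rule sym)
  qed
  show ?thesis using that 1 2 by blast
qed

lemma sforms_mono: "(\<phi>, \<theta>) \<in> sforms L I A \<Longrightarrow> A \<subseteq> B \<Longrightarrow> (\<phi>, \<theta>) \<in> sforms L I B"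
proof -
  assume "(\<phi>, \<theta>) \<in> sforms L I A" "A \<subseteq> B"
  moreover from \<open>A \<subseteq> B\<close> have "I <+> A \<subseteq> I <+> B" by auto
  ultimately show ?thesis unfolding sforms_def by blast
qed

text \<open>Used to let some variables and parameters of \<phi> move along a sequence
  (\<open>Inl\<close>) while the others stay fixed (\<open>Inr\<close>): \<eta> treats the free
  variables and \<open>\<eta>'\<close> the parameters. One pair works for all assignments
  \<open>s\<close>, so the values along the sequence and in the limit are values of the same
  formula.\<close>

lemma sform_assign:
  fixes \<phi> :: "('f, 'r, 'a, 'v) fm" and \<eta> :: "'v \<Rightarrow> 'i + 'a" and \<eta>' :: "'a \<Rightarrow> 'i + 'a"
  assumes inf: "infinite (UNIV :: 'v set)" and wf: "wf_fm L \<phi>"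
    and \<eta>: "\<forall>v\<in>free_vars \<phi>. \<eta> v \<in> I <+> A" and \<eta>': "\<forall>c\<in>params \<phi>. \<eta>' c \<in> I <+> A"
  shows "\<exists>(\<psi> :: ('f, 'r, 'a, 'v) fm) \<theta>. (\<psi>, \<theta>) \<in> sforms L I A \<and>
    (\<forall>(N :: ('f, 'r, 'a) mstruct) s b g. (\<forall>v\<in>free_vars \<phi>. b v = case_sum s id (\<eta> v)) \<longrightarrow>
       (\<forall>c\<in>params \<phi>. g c = case_sum s id (\<eta>' c)) \<longrightarrow>
       fm_val N (map_fm id id g id \<phi>) b = fm_val N \<psi> (case_sum s id \<circ> \<theta>))"
proof -
  obtain \<psi> :: "('f, 'r, 'a, 'v) fm" and \<theta> where \<psi>: "(\<psi>, \<theta>) \<in> sforms L (free_vars \<phi>) (params \<phi>)"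
    and val: "\<And>(N :: ('f, 'r, 'a) mstruct) g s.
      fm_val N (map_fm id id g id \<phi>) s = fm_val N \<psi> (case_sum s g \<circ> \<theta>)"
    using sform_of_formula[OF inf wf] by metis
  have \<theta>: "\<theta> v \<in> free_vars \<phi> <+> params \<phi>" if "v \<in> free_vars \<psi>" for v
    using \<psi> that by (auto simp: sforms_def)
  show ?thesis
  proof (intro exI[of _ \<psi>] exI[of _ "case_sum \<eta> \<eta>' \<circ> \<theta>"] conjI allI impI)
    have "case_sum \<eta> \<eta>' x \<in> I <+> A" if "x \<in> free_vars \<phi> <+> params \<phi>" for x
      using that \<eta> \<eta>' by auto
    then show "(\<psi>, case_sum \<eta> \<eta>' \<circ> \<theta>) \<in> sforms L I A"
      using \<psi> \<theta> unfolding sforms_def by (simp add: image_subset_iff)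
    fix N :: "('f, 'r, 'a) mstruct" and s b g
    assume b: "\<forall>v\<in>free_vars \<phi>. b v = case_sum s id (\<eta> v)"
      and g: "\<forall>c\<in>params \<phi>. g c = case_sum s id (\<eta>' c)"
    have "case_sum b g x = case_sum s id (case_sum \<eta> \<eta>' x)" if "x \<in> free_vars \<phi> <+> params \<phi>" for x
      using that b g by auto
    then show "fm_val N (map_fm id id g id \<phi>) b = fm_val N \<psi> (case_sum s id \<circ> (case_sum \<eta> \<eta>' \<circ> \<theta>))"
      unfolding val using \<theta> by (intro fm_val_cong) simp
  qed
qed

lemma formulas_mono: "\<phi> \<in> formulas L X A \<Longrightarrow> A \<subseteq> B \<Longrightarrow> \<phi> \<in> formulas L X B"
  by (auto simp: formulas_def)

lemma map_fm_id: "map_fm id id id id \<phi> = \<phi>"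
  by (simp add: fm.map_id)

section \<open>Structures and automorphisms\<close>

lemma trm_val_in_universe:
  assumes "is_structure L N"
  shows "wf_trm L t \<Longrightarrow> trm_params t \<subseteq> universe N \<Longrightarrow> s ` trm_vars t \<subseteq> universe N \<Longrightarrow>
    trm_val N t s \<in> universe N"
proof (induction t)
  case (App f ts)
  have "trm_val N t s \<in> universe N" if "t \<in> set ts" for t
    using App.prems that by (intro App.IH) (auto simp: list_all_iff image_subset_iff)
  then have "map (\<lambda>t. trm_val N t s) ts \<in> tuples N (fun_arity L f)"
    using App.prems(1) by (auto simp: tuples_def)
  then show ?case using App.prems(1) assms by (auto simp: is_structure_def)
qed auto

text \<open>The flag \<open>d\<close> is the discrete case: there the set of values is finite, so
  supremum and infimum are attained and are again 0 or 1.\<close>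

lemma SUP_INF_in_unit:
  fixes f :: "'b \<Rightarrow> real"
  assumes "A \<noteq> {}" "\<And>x. x \<in> A \<Longrightarrow> f x \<in> {0..1} \<and> (d \<longrightarrow> f x \<in> {0, 1})"
  shows "(SUP x\<in>A. f x) \<in> {0..1} \<and> (d \<longrightarrow> (SUP x\<in>A. f x) \<in> {0, 1})"
    and "(INF x\<in>A. f x) \<in> {0..1} \<and> (d \<longrightarrow> (INF x\<in>A. f x) \<in> {0, 1})"
proof -
  have bdd: "bdd_above (f ` A)" "bdd_below (f ` A)"
    using assms(2) by (auto intro!: bdd_aboveI[of _ 1] bdd_belowI[of _ 0])
  have fin: "d \<Longrightarrow> finite (f ` A)"
    using assms(2) by (intro finite_subset[of "f ` A" "{0, 1}"]) auto
  obtain x where x: "x \<in> A" using assms(1) by auto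
  have "d \<Longrightarrow> (SUP x\<in>A. f x) \<in> f ` A" "d \<Longrightarrow> (INF x\<in>A. f x) \<in> f ` A"
    using fin assms(1) by (auto simp: cSup_eq_Max cInf_eq_Min simp del: Max_in Min_in intro!: Max_in[of "f ` A"] Min_in[of "f ` A"])
  moreover have "0 \<le> (SUP x\<in>A. f x)" "(INF x\<in>A. f x) \<le> 1"
    using assms(2)[OF x] cSUP_upper[OF x bdd(1)] cINF_lower[OF bdd(2) x] by auto
  moreover have "(SUP x\<in>A. f x) \<le> 1" "0 \<le> (INF x\<in>A. f x)"
    using assms by (auto intro!: cSUP_least cINF_greatest)
  ultimately show "(SUP x\<in>A. f x) \<in> {0..1} \<and> (d \<longrightarrow> (SUP x\<in>A. f x) \<in> {0, 1})"
    and "(INF x\<in>A. f x) \<in> {0..1} \<and> (d \<longrightarrow> (INF x\<in>A. f x) \<in> {0, 1})"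
    using assms(2) by fastforce+
qed

lemma fm_val_in_unit:
  assumes N: "is_structure L N"
  shows "wf_fm L \<phi> \<Longrightarrow> params \<phi> \<subseteq> universe N \<Longrightarrow> s ` free_vars \<phi> \<subseteq> universe N \<Longrightarrow>
    fm_val N \<phi> s \<in> {0..1} \<and> (is_discrete L \<longrightarrow> fm_val N \<phi> s \<in> {0, 1})"
proof (induction \<phi> arbitrary: s)
  case (Dist t t')
  then have "trm_val N t s \<in> universe N" "trm_val N t' s \<in> universe N"
    by (auto intro!: trm_val_in_universe[OF N])
  moreover have "Metric_space (universe N) (mdistance N)" using N by (auto simp: is_structure_def)
  ultimately show ?case
    using N Metric_space.nonneg[of "universe N" "mdistance N"] by (auto simp: is_structure_def)
next
  case (Rel R ts)
  have "trm_val N t s \<in> universe N" if "t \<in> set ts" for t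
    using Rel that by (intro trm_val_in_universe[OF N]) (auto simp: list_all_iff image_subset_iff)
  then have "map (\<lambda>t. trm_val N t s) ts \<in> tuples N (rel_arity L R)"
    using Rel(1) by (auto simp: tuples_def)
  then show ?case using Rel(1) N by (auto simp: is_structure_def)
next
  case (Conn u \<phi>s)
  define x where "x = (\<lambda>i. if i < length \<phi>s then map (\<lambda>\<phi>. fm_val N \<phi> s) \<phi>s ! i else 0)"
  have "fm_val N \<phi> s \<in> {0..1} \<and> (is_discrete L \<longrightarrow> fm_val N \<phi> s \<in> {0, 1})" if "\<phi> \<in> set \<phi>s" for \<phi>
    using Conn.prems that by (intro Conn.IH) (auto simp: list_all_iff image_subset_iff)
  then have "x i \<in> {0..1} \<and> (is_discrete L \<longrightarrow> x i \<in> {0, 1})" for i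
    by (auto simp: x_def)
  then have "u x \<in> {0..1} \<and> (is_discrete L \<longrightarrow> u x \<in> {0, 1})"
    using Conn.prems(1) unfolding is_connective_def wf_fm.simps by blast
  moreover have "fm_val N (Conn u \<phi>s) s = u x" by (simp add: x_def)
  ultimately show ?case by metis
next
  case (Sup v \<phi>)
  have "fm_val N \<phi> (s(v := a)) \<in> {0..1} \<and> (is_discrete L \<longrightarrow> fm_val N \<phi> (s(v := a)) \<in> {0, 1})"
    if "a \<in> universe N" for a
    using Sup.prems that by (intro Sup.IH) auto
  moreover have "universe N \<noteq> {}" using N by (simp add: is_structure_def)
  ultimately show ?case unfolding fm_val.simps by (intro SUP_INF_in_unit(1))
next
  case (Inf v \<phi>)
  have "fm_val N \<phi> (s(v := a)) \<in> {0..1} \<and> (is_discrete L \<longrightarrow> fm_val N \<phi> (s(v := a)) \<in> {0, 1})"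
    if "a \<in> universe N" for a
    using Inf.prems that by (intro Inf.IH) auto
  moreover have "universe N \<noteq> {}" using N by (simp add: is_structure_def)
  ultimately show ?case unfolding fm_val.simps by (intro SUP_INF_in_unit(2))
qed

lemma trm_val_automorphism:
  assumes N: "is_structure L N" and \<sigma>: "automorphism L N \<sigma>"
  shows "wf_trm L t \<Longrightarrow> trm_params t \<subseteq> universe N \<Longrightarrow> s ` trm_vars t \<subseteq> universe N \<Longrightarrow>
    trm_val N (map_trm id \<sigma> id t) (\<sigma> \<circ> s) = \<sigma> (trm_val N t s)"
proof (induction t)
  case (App f ts)
  have 1: "trm_val N (map_trm id \<sigma> id t) (\<sigma> \<circ> s) = \<sigma> (trm_val N t s)" "trm_val N t s \<in> universe N"
    if "t \<in> set ts" for t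
    using App.prems that
    by (auto intro!: App.IH trm_val_in_universe[OF N] simp: list_all_iff image_subset_iff)
  have "map (\<lambda>t. trm_val N t s) ts \<in> tuples N (fun_arity L f)"
    using App.prems(1) 1 by (auto simp: tuples_def)
  then have "\<sigma> (fun_interp N f (map (\<lambda>t. trm_val N t s) ts)) =
      fun_interp N f (map \<sigma> (map (\<lambda>t. trm_val N t s) ts))"
    using \<sigma> App.prems(1) unfolding automorphism_def wf_trm.simps by blast
  also have "map \<sigma> (map (\<lambda>t. trm_val N t s) ts) = map (\<lambda>t. trm_val N (map_trm id \<sigma> id t) (\<sigma> \<circ> s)) ts"
    using 1 by simp
  finally show ?case by (simp only: map_trm_simps trm_val.simps map_map comp_def)
qed auto

lemma fm_val_automorphism:
  assumes N: "is_structure L N" and \<sigma>: "automorphism L N \<sigma>"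
  shows "wf_fm L \<phi> \<Longrightarrow> params \<phi> \<subseteq> universe N \<Longrightarrow> s ` free_vars \<phi> \<subseteq> universe N \<Longrightarrow>
    fm_val N (map_fm id id \<sigma> id \<phi>) (\<sigma> \<circ> s) = fm_val N \<phi> s"
proof (induction \<phi> arbitrary: s)
  case (Dist t t')
  then have "trm_val N t s \<in> universe N" "trm_val N t' s \<in> universe N"
    by (auto intro!: trm_val_in_universe[OF N])
  moreover have "trm_val N (map_trm id \<sigma> id t) (\<sigma> \<circ> s) = \<sigma> (trm_val N t s)"
    "trm_val N (map_trm id \<sigma> id t') (\<sigma> \<circ> s) = \<sigma> (trm_val N t' s)"
    using Dist by (auto intro!: trm_val_automorphism[OF N \<sigma>])
  ultimately show ?case using \<sigma> unfolding map_fm_simps fm_val.simps automorphism_def by metis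
next
  case (Rel R ts)
  have 1: "trm_val N (map_trm id \<sigma> id t) (\<sigma> \<circ> s) = \<sigma> (trm_val N t s)" "trm_val N t s \<in> universe N"
    if "t \<in> set ts" for t
    using Rel that
    by (auto intro!: trm_val_automorphism[OF N \<sigma>] trm_val_in_universe[OF N] simp: list_all_iff image_subset_iff)
  have "map (\<lambda>t. trm_val N t s) ts \<in> tuples N (rel_arity L R)"
    using Rel(1) 1 by (auto simp: tuples_def)
  then have "rel_interp N R (map \<sigma> (map (\<lambda>t. trm_val N t s) ts)) = rel_interp N R (map (\<lambda>t. trm_val N t s) ts)"
    using \<sigma> Rel(1) unfolding automorphism_def wf_fm.simps by blast
  moreover have "map \<sigma> (map (\<lambda>t. trm_val N t s) ts) = map (\<lambda>t. trm_val N (map_trm id \<sigma> id t) (\<sigma> \<circ> s)) ts"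
    using 1 by simp
  ultimately show ?case by (simp only: map_fm_simps fm_val.simps map_map comp_def)
next
  case (Conn u \<phi>s)
  have "fm_val N (map_fm id id \<sigma> id \<phi>) (\<sigma> \<circ> s) = fm_val N \<phi> s" if "\<phi> \<in> set \<phi>s" for \<phi>
    using Conn.prems that by (intro Conn.IH) (auto simp: list_all_iff image_subset_iff)
  then have "map (\<lambda>\<phi>. fm_val N (map_fm id id \<sigma> id \<phi>) (\<sigma> \<circ> s)) \<phi>s = map (\<lambda>\<phi>. fm_val N \<phi> s) \<phi>s"
    by simp
  then show ?case by (simp only: map_fm_simps fm_val.simps map_map comp_def length_map)
next
  case (Sup v \<phi>)
  have "fm_val N (map_fm id id \<sigma> id \<phi>) ((\<sigma> \<circ> s)(v := \<sigma> a)) = fm_val N \<phi> (s(v := a))" if "a \<in> universe N" for a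
    unfolding fun_upd_comp[symmetric] using Sup.prems that
    by (intro Sup.IH) (auto simp: image_subset_iff)
  then have "(\<lambda>a. fm_val N (map_fm id id \<sigma> id \<phi>) ((\<sigma> \<circ> s)(v := a))) ` \<sigma> ` universe N =
      (\<lambda>a. fm_val N \<phi> (s(v := a))) ` universe N"
    unfolding image_image by (rule image_cong[OF refl])
  moreover have "\<sigma> ` universe N = universe N" using \<sigma> by (auto simp: automorphism_def bij_betw_def)
  ultimately show ?case by (simp only: map_fm_simps fm_val.simps)
next
  case (Inf v \<phi>)
  have "fm_val N (map_fm id id \<sigma> id \<phi>) ((\<sigma> \<circ> s)(v := \<sigma> a)) = fm_val N \<phi> (s(v := a))" if "a \<in> universe N" for a
    unfolding fun_upd_comp[symmetric] using Inf.prems that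
    by (intro Inf.IH) (auto simp: image_subset_iff)
  then have "(\<lambda>a. fm_val N (map_fm id id \<sigma> id \<phi>) ((\<sigma> \<circ> s)(v := a))) ` \<sigma> ` universe N =
      (\<lambda>a. fm_val N \<phi> (s(v := a))) ` universe N"
    unfolding image_image by (rule image_cong[OF refl])
  moreover have "\<sigma> ` universe N = universe N" using \<sigma> by (auto simp: automorphism_def bij_betw_def)
  ultimately show ?case by (simp only: map_fm_simps fm_val.simps)
qed

section \<open>Automorphisms fixing a set pointwise\<close>

definition Aut :: "('f, 'r) language \<Rightarrow> ('f, 'r, 'a) mstruct \<Rightarrow> 'a set \<Rightarrow> ('a \<Rightarrow> 'a) set" where
  "Aut L N A = {\<sigma>. automorphism L N \<sigma> \<and> (\<forall>a\<in>A. \<sigma> a = a)}"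

lemma Aut_mono: "A \<subseteq> B \<Longrightarrow> Aut L N B \<subseteq> Aut L N A"
  by (auto simp: Aut_def)

lemma Aut_in: "\<sigma> \<in> Aut L N A \<Longrightarrow> x \<in> universe N \<Longrightarrow> \<sigma> x \<in> universe N"
  by (auto simp: Aut_def automorphism_def bij_betw_def)

lemma Aut_image: "\<sigma> \<in> Aut L N A \<Longrightarrow> B \<subseteq> universe N \<Longrightarrow> \<sigma> ` B \<subseteq> universe N"
  by (auto dest: Aut_in)

lemma Aut_fixes: "\<sigma> \<in> Aut L N A \<Longrightarrow> a \<in> A \<Longrightarrow> \<sigma> a = a"
  by (auto simp: Aut_def)

lemma image_Aut: "\<sigma> \<in> Aut L N A \<Longrightarrow> B \<subseteq> A \<Longrightarrow> \<sigma> ` B = B"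
  by (force simp: Aut_def)

lemma Aut_id: "id \<in> Aut L N A"
  by (auto simp: Aut_def automorphism_def)

lemma Aut_comp:
  assumes "\<sigma> \<in> Aut L N A" "\<tau> \<in> Aut L N A"
  shows "\<sigma> \<circ> \<tau> \<in> Aut L N A"
proof -
  have \<tau>: "\<And>x. x \<in> universe N \<Longrightarrow> \<tau> x \<in> universe N" using Aut_in assms by metis
  have t: "map \<tau> xs \<in> tuples N n" if "xs \<in> tuples N n" for xs n
    using that \<tau> by (auto simp: tuples_def)
  have "rel_interp N R (map (\<sigma> \<circ> \<tau>) xs) = rel_interp N R xs"
    if "R \<in> rels L" "xs \<in> tuples N (rel_arity L R)" for R xs
    using assms that t by (simp add: Aut_def automorphism_def flip: map_map)
  moreover have "(\<sigma> \<circ> \<tau>) (fun_interp N f xs) = fun_interp N f (map (\<sigma> \<circ> \<tau>) xs)"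
    if "f \<in> funs L" "xs \<in> tuples N (fun_arity L f)" for f xs
    using assms that t unfolding Aut_def automorphism_def map_map[symmetric] by simp
  ultimately show ?thesis
    using assms \<tau> unfolding Aut_def automorphism_def by (auto intro: bij_betw_trans)
qed

text \<open>An automorphism is a function on the whole type with arbitrary values off the universe,
  so it is inverted only on the universe.\<close>

lemma Aut_inv:
  assumes N: "is_structure L N" and \<sigma>: "\<sigma> \<in> Aut L N A" and A: "A \<subseteq> universe N"
  obtains \<tau> where "\<tau> \<in> Aut L N A"
    and "\<And>x. x \<in> universe N \<Longrightarrow> \<tau> (\<sigma> x) = x" and "\<And>x. x \<in> universe N \<Longrightarrow> \<sigma> (\<tau> x) = x"
proof
  let ?\<tau> = "inv_into (universe N) \<sigma>"
  have bij: "bij_betw \<sigma> (universe N) (universe N)" using \<sigma> by (auto simp: Aut_def automorphism_def)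
  show 1: "?\<tau> (\<sigma> x) = x" if "x \<in> universe N" for x using bij that by (simp add: bij_betw_inv_into_left)
  show 2: "\<sigma> (?\<tau> x) = x" if "x \<in> universe N" for x using bij that by (simp add: bij_betw_inv_into_right)
  have bij': "bij_betw ?\<tau> (universe N) (universe N)" using bij by (rule bij_betw_inv_into)
  then have in': "?\<tau> x \<in> universe N" if "x \<in> universe N" for x using that by (auto simp: bij_betw_def)
  have t: "map ?\<tau> xs \<in> tuples N n" "map \<sigma> (map ?\<tau> xs) = xs" if "xs \<in> tuples N n" for xs n
    using that in' 2 by (auto simp: tuples_def intro!: map_idI)
  have "mdistance N (?\<tau> x) (?\<tau> y) = mdistance N x y" if "x \<in> universe N" "y \<in> universe N" for x y
  proof -
    have "mdistance N (\<sigma> (?\<tau> x)) (\<sigma> (?\<tau> y)) = mdistance N (?\<tau> x) (?\<tau> y)"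
      using \<sigma> in' that unfolding Aut_def automorphism_def by blast
    then show ?thesis using 2 that by simp
  qed
  moreover have "?\<tau> (fun_interp N f xs) = fun_interp N f (map ?\<tau> xs)"
    if "f \<in> funs L" "xs \<in> tuples N (fun_arity L f)" for f xs
  proof -
    have "\<sigma> (fun_interp N f (map ?\<tau> xs)) = fun_interp N f (map \<sigma> (map ?\<tau> xs))"
      using \<sigma> t(1)[OF that(2)] that(1) unfolding Aut_def automorphism_def by blast
    then have "fun_interp N f xs = \<sigma> (fun_interp N f (map ?\<tau> xs))" using t(2)[OF that(2)] by simp
    moreover have "fun_interp N f (map ?\<tau> xs) \<in> universe N"
      using N t(1)[OF that(2)] that(1) unfolding is_structure_def by blast
    ultimately show ?thesis using 1 by metis
  qed
  moreover have "rel_interp N R (map ?\<tau> xs) = rel_interp N R xs"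
    if "R \<in> rels L" "xs \<in> tuples N (rel_arity L R)" for R xs
  proof -
    have "rel_interp N R (map \<sigma> (map ?\<tau> xs)) = rel_interp N R (map ?\<tau> xs)"
      using \<sigma> t(1)[OF that(2)] that(1) unfolding Aut_def automorphism_def by blast
    then show ?thesis using t(2)[OF that(2)] by simp
  qed
  moreover have "?\<tau> a = a" if "a \<in> A" for a
    using 1[of a] that A \<sigma> by (auto simp: Aut_def)
  ultimately show "?\<tau> \<in> Aut L N A" using bij' unfolding Aut_def automorphism_def by blast
qed

lemma fm_val_Aut:
  assumes "is_structure L N" "\<sigma> \<in> Aut L N A" "\<phi> \<in> formulas L X B" "B \<subseteq> universe N" "s \<in> X \<rightarrow> universe N"
  shows "fm_val N (map_fm id id \<sigma> id \<phi>) (\<sigma> \<circ> s) = fm_val N \<phi> s"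
  using assms by (intro fm_val_automorphism) (auto simp: Aut_def formulas_def)

lemma sform_val_Aut:
  assumes N: "is_structure L N" and \<sigma>: "\<sigma> \<in> Aut L N B" and \<phi>: "(\<phi>, \<theta>) \<in> sforms L I A"
    and A: "A \<subseteq> universe N" and s: "s \<in> I \<rightarrow> universe N"
  shows "fm_val N \<phi> (case_sum (\<sigma> \<circ> s) \<sigma> \<circ> \<theta>) = fm_val N \<phi> (case_sum s id \<circ> \<theta>)"
proof -
  have \<theta>: "\<theta> ` free_vars \<phi> \<subseteq> I <+> A" "wf_fm L \<phi>" "params \<phi> = {}"
    using \<phi> by (auto simp: sforms_def formulas_def)
  have "case_sum (\<sigma> \<circ> s) \<sigma> \<circ> \<theta> = \<sigma> \<circ> (case_sum s id \<circ> \<theta>)"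
    by (auto simp: fun_eq_iff split: sum.split)
  moreover have "(case_sum s id \<circ> \<theta>) ` free_vars \<phi> \<subseteq> universe N"
    using \<theta>(1) A s by fastforce
  ultimately have "fm_val N (map_fm id id \<sigma> id \<phi>) (case_sum (\<sigma> \<circ> s) \<sigma> \<circ> \<theta>) = fm_val N \<phi> (case_sum s id \<circ> \<theta>)"
    using fm_val_automorphism[OF N, of \<sigma> \<phi> "case_sum s id \<circ> \<theta>"] \<sigma> \<theta> by (simp add: Aut_def)
  then show ?thesis using map_params_id[of \<phi> \<sigma>] \<theta>(3) by simp
qed

lemma sform_val_cong:
  assumes "(\<phi>, \<theta>) \<in> sforms L I A" "\<And>i. i \<in> I \<Longrightarrow> s i = s' i" "\<And>a. a \<in> A \<Longrightarrow> g a = g' a"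
  shows "fm_val N \<phi> (case_sum s g \<circ> \<theta>) = fm_val N \<phi> (case_sum s' g' \<circ> \<theta>)"
proof (rule fm_val_cong)
  fix v assume "v \<in> free_vars \<phi>"
  then have "\<theta> v \<in> I <+> A" using assms(1) by (auto simp: sforms_def)
  then show "(case_sum s g \<circ> \<theta>) v = (case_sum s' g' \<circ> \<theta>) v" using assms(2,3) by auto
qed

section \<open>Realizations of types and invariance\<close>

lemma realizes_iff:
  "realizes L N X A a p \<longleftrightarrow> a \<in> X \<rightarrow> universe N \<and> (\<forall>\<phi>\<in>formulas L X A. fm_val N \<phi> a = p \<phi>)"
  unfolding realizes_def tp_def by (auto simp: restrict_def fun_eq_iff)

lemma realizes_mono: "realizes L N X B a p \<Longrightarrow> A \<subseteq> B \<Longrightarrow> realizes L N X A a p"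
  unfolding realizes_iff formulas_def by blast

lemma realizes_cong: "(\<And>x. x \<in> X \<Longrightarrow> a x = b x) \<Longrightarrow> realizes L N X A a p = realizes L N X A b p"
proof -
  assume *: "\<And>x. x \<in> X \<Longrightarrow> a x = b x"
  have "fm_val N \<phi> a = fm_val N \<phi> b" if "\<phi> \<in> formulas L X A" for \<phi> :: "('c, 'd, 'b, 'a) fm"
    using that * by (intro fm_val_cong) (auto simp: formulas_def)
  then show ?thesis using * unfolding realizes_iff by (auto simp: Pi_iff)
qed

lemma types_restrict:
  assumes "p \<in> types L N X B" "A \<subseteq> B"
  shows "restrict p (formulas L X A) \<in> types L N X A"
proof -
  have sub: "formulas L X A \<subseteq> formulas L X B" using assms(2) by (auto simp: formulas_def)
  have "\<exists>a\<in>X \<rightarrow> universe N. \<forall>\<phi>\<in>F. \<bar>fm_val N \<phi> a - restrict p (formulas L X A) \<phi>\<bar> < \<epsilon>"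
    if "finite F" "F \<subseteq> formulas L X A" "0 < \<epsilon>" for F \<epsilon>
  proof -
    have "finite F \<and> F \<subseteq> formulas L X B \<and> 0 < \<epsilon>" using that sub by blast
    then obtain a where "a \<in> X \<rightarrow> universe N" "\<forall>\<phi>\<in>F. \<bar>fm_val N \<phi> a - p \<phi>\<bar> < \<epsilon>"
      using assms(1) unfolding types_def mem_Collect_eq by meson
    then show ?thesis using that(2) by (intro bexI[of _ a]) auto
  qed
  then show ?thesis by (simp add: types_def)
qed

text \<open>A formula over the image of \<open>A\<close> is pulled back along the inverse of
  \<sigma> to a formula over \<open>A\<close>; there \<open>a\<close> has the value given by
  \<open>p\<close>, and invariance carries this value back.\<close>

lemma invariant_realizes_Aut:
  assumes N: "is_structure L N" and M: "universe M \<subseteq> universe N" and p: "invariant_type L N M X p"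
    and \<sigma>: "\<sigma> \<in> Aut L N (universe M)" and A: "A \<subseteq> universe N" and a: "realizes L N X A a p"
  shows "realizes L N X (\<sigma> ` A) (\<sigma> \<circ> a) p"
  unfolding realizes_iff
proof (intro conjI ballI)
  have a': "a \<in> X \<rightarrow> universe N" using a by (simp add: realizes_iff)
  then show "\<sigma> \<circ> a \<in> X \<rightarrow> universe N" using Aut_in[OF \<sigma>] by (auto simp: Pi_iff)
  obtain \<tau> where \<tau>: "\<tau> \<in> Aut L N (universe M)" "\<And>x. x \<in> universe N \<Longrightarrow> \<tau> (\<sigma> x) = x"
    "\<And>x. x \<in> universe N \<Longrightarrow> \<sigma> (\<tau> x) = x"
    using Aut_inv[OF N \<sigma> M] by blast
  fix \<phi> assume \<phi>: "\<phi> \<in> formulas L X (\<sigma> ` A)"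
  then have par: "params \<phi> \<subseteq> universe N" using Aut_image[OF \<sigma> A] by (auto simp: formulas_def)
  let ?\<psi> = "map_fm id id \<tau> id \<phi>"
  have \<psi>: "?\<psi> \<in> formulas L X A"
  proof (rule map_formulas[OF \<phi>])
    have "\<tau> ` params \<phi> \<subseteq> \<tau> ` \<sigma> ` A" using \<phi> by (intro image_mono) (simp add: formulas_def)
    also have "\<dots> = A" using \<tau>(2) A by (force simp: image_image)
    finally show "\<tau> ` params \<phi> \<subseteq> A" .
  qed
  have eq: "map_fm id id \<sigma> id ?\<psi> = \<phi>"
    unfolding map_params_comp using par \<tau>(3) by (intro map_params_id) auto
  have "fm_val N \<phi> (\<sigma> \<circ> a) = fm_val N ?\<psi> a"
    using fm_val_Aut[OF N \<sigma> \<psi> A a'] eq by simp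
  also have "\<dots> = p ?\<psi>" using a \<psi> by (simp add: realizes_iff)
  also have "\<dots> = p (map_fm id id \<sigma> id ?\<psi>)"
    using p \<sigma> \<psi> A by (auto simp: invariant_type_def Aut_def formulas_def)
  finally show "fm_val N \<phi> (\<sigma> \<circ> a) = p \<phi>" using eq by simp
qed

section \<open>Saturation and homogeneity\<close>

text \<open>\<open>V\<close> only fixes the type of variables, which does not occur in the types of \<open>L\<close>, \<open>\<kappa>\<close> and \<open>U\<close>.\<close>

locale monster =
  fixes L :: "('f, 'r) language" and \<kappa> :: "'k rel" and U :: "('f, 'r, 'a) mstruct" and V :: "'v itself"
  assumes infinite_vars: "infinite (UNIV :: 'v set)"
    and card: "Card_order \<kappa>" and uncountable: "natLeq <o \<kappa>"
    and struct: "is_structure L U"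
    and sat: "saturated TYPE('v) L \<kappa> U" and hom: "strongly_homogeneous TYPE('v) L \<kappa> U"
begin

section \<open>Small sets and index sets\<close>

lemma infinite_Field: "infinite (Field \<kappa>)"
proof -
  have "\<kappa> \<le>o |Field \<kappa>|" using card by (simp add: Card_order_iff_ordLeq_card_of)
  then have "natLeq \<le>o |Field \<kappa>|" using uncountable ordLess_ordLeq_trans ordLess_imp_ordLeq by blast
  then show ?thesis using infinite_iff_natLeq_ordLeq by blast
qed

lemma small_Un: "|A| <o \<kappa> \<Longrightarrow> |B| <o \<kappa> \<Longrightarrow> |A \<union> B| <o \<kappa>"
  using card_of_Un_ordLess_infinite_Field[OF infinite_Field card] .

lemma small_Plus: "|A| <o \<kappa> \<Longrightarrow> |B| <o \<kappa> \<Longrightarrow> |A <+> B| <o \<kappa>"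
  using card_of_Plus_ordLess_infinite_Field[OF infinite_Field card] .

lemma small_image: "|A| <o \<kappa> \<Longrightarrow> |f ` A| <o \<kappa>"
  using card_of_image ordLeq_ordLess_trans by blast

lemma small_subset: "|B| <o \<kappa> \<Longrightarrow> A \<subseteq> B \<Longrightarrow> |A| <o \<kappa>"
  using card_of_mono1 ordLeq_ordLess_trans by blast

lemma small_nat: "|UNIV :: nat set| <o \<kappa>"
  using card_of_nat uncountable ordIso_ordLess_trans by blast

lemma small_countable: "countable A \<Longrightarrow> |A| <o \<kappa>"
  using small_subset[OF small_image[OF small_nat, of "from_nat_into A"]] subset_range_from_nat_into
  by blast

lemma small_finite: "finite A \<Longrightarrow> |A| <o \<kappa>"
  by (intro small_countable countable_finite)

lemma small_nat_Times:
  assumes "|J| <o \<kappa>"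
  shows "|(UNIV :: nat set) \<times> J| <o \<kappa>"
proof (cases "finite J")
  case True
  then show ?thesis by (intro small_countable) (auto intro: countable_finite)
next
  case False
  then have "|UNIV :: nat set| \<le>o |J|" using infinite_iff_card_of_nat by blast
  then have "|(UNIV :: nat set) \<times> J| =o |J|" using False card_of_Times_infinite_simps(3) by blast
  then show ?thesis using assms ordIso_ordLess_trans by blast
qed

lemma small_UN_image:
  fixes x :: "nat \<Rightarrow> 'j \<Rightarrow> 'b"
  assumes "|J| <o \<kappa>"
  shows "|\<Union>i\<in>I. x i ` J| <o \<kappa>"
proof (rule small_subset)
  show "|(\<lambda>(i, j). x i j) ` ((UNIV :: nat set) \<times> J)| <o \<kappa>"
    by (intro small_image small_nat_Times assms)
qed force

text \<open>Saturation concerns types in variables from \<open>'v\<close>. To use it for tuples with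
  other indices, the index set must embed into the set of variables, hence this bound next to
  smallness.\<close>

lemma nat_Times_vars: "|(UNIV :: nat set) \<times> (Y :: 'v set)| \<le>o |UNIV :: 'v set|"
proof -
  have "|UNIV :: nat set| \<le>o |UNIV :: 'v set|" using infinite_vars infinite_iff_card_of_nat by blast
  then have "|(UNIV :: nat set) \<times> (UNIV :: 'v set)| =o |UNIV :: 'v set|"
    using infinite_vars card_of_Times_infinite_simps(3) by blast
  moreover have "|(UNIV :: nat set) \<times> Y| \<le>o |(UNIV :: nat set) \<times> (UNIV :: 'v set)|"
    by (rule card_of_mono1) auto
  ultimately show ?thesis using ordLeq_ordIso_trans by blast
qed

lemma Plus_vars:
  assumes "|A| \<le>o |UNIV :: 'v set|" "|B| \<le>o |UNIV :: 'v set|"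
  shows "|A <+> B| \<le>o |UNIV :: 'v set|"
  using card_of_Plus_ordLeq_infinite_Field[OF _ assms card_of_Card_order] infinite_vars
  by (simp add: Field_card_of)

lemma finite_vars_card: "finite A \<Longrightarrow> |A| \<le>o |UNIV :: 'v set|"
  using infinite_vars infinite_iff_natLeq_ordLeq finite_iff_ordLess_natLeq
    ordLess_ordLeq_trans ordLess_imp_ordLeq by metis

section \<open>Equality of types and conjugacy\<close>

lemmas formula_of_sform' = formula_of_sform[OF infinite_vars]

text \<open>Equality of the types over \<open>A\<close> of two tuples with an arbitrary index set,
  so that whole sequences and tuples of parameters can be compared without naming variables for
  them.\<close>

definition eqtp :: "'i set \<Rightarrow> 'a set \<Rightarrow> ('i \<Rightarrow> 'a) \<Rightarrow> ('i \<Rightarrow> 'a) \<Rightarrow> bool" where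
  "eqtp I A s t \<longleftrightarrow> (\<forall>(\<phi> :: ('f, 'r, 'a, 'v) fm, \<theta>) \<in> sforms L I A.
     fm_val U \<phi> (case_sum s id \<circ> \<theta>) = fm_val U \<phi> (case_sum t id \<circ> \<theta>))"

lemma eqtpD:
  fixes \<phi> :: "('f, 'r, 'a, 'v) fm"
  shows "eqtp I A s t \<Longrightarrow> (\<phi>, \<theta>) \<in> sforms L I A \<Longrightarrow>
    fm_val U \<phi> (case_sum s id \<circ> \<theta>) = fm_val U \<phi> (case_sum t id \<circ> \<theta>)"
  unfolding eqtp_def by blast

lemma eqtpI:
  assumes "\<And>(\<phi> :: ('f, 'r, 'a, 'v) fm) \<theta>. (\<phi>, \<theta>) \<in> sforms L I A \<Longrightarrow>
    fm_val U \<phi> (case_sum s id \<circ> \<theta>) = fm_val U \<phi> (case_sum t id \<circ> \<theta>)"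
  shows "eqtp I A s t"
  using assms unfolding eqtp_def by blast

text \<open>Equality of types makes the assignment of \<open>t i\<close> to \<open>s i\<close>,
  together with the identity on \<open>A\<close>, a well-defined partial elementary map on a small
  set, which strong homogeneity extends.\<close>

lemma homogeneity:
  assumes A: "A \<subseteq> universe U" "|A| <o \<kappa>" and I: "|I| <o \<kappa>"
    and s: "s \<in> I \<rightarrow> universe U" and t: "t \<in> I \<rightarrow> universe U" and eq: "eqtp I A s t"
  obtains \<sigma> where "\<sigma> \<in> Aut L U A" "\<And>i. i \<in> I \<Longrightarrow> \<sigma> (s i) = t i"
proof -
  let ?s = "case_sum s id" and ?t = "case_sum t id" and ?K = "I <+> A"
  define f where "f = ?t \<circ> inv_into ?K ?s"
  have in_U: "?s k \<in> universe U" "?t k \<in> universe U" if "k \<in> ?K" for k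
    using that s t A by auto
  have eq': "fm_val U \<phi> (?s \<circ> \<theta>) = fm_val U \<phi> (?t \<circ> \<theta>)"
    if "\<phi> \<in> formulas L UNIV {}" "\<theta> ` free_vars \<phi> \<subseteq> ?K" for \<phi> :: "('f, 'r, 'a, 'v) fm" and \<theta>
    using eqtpD[OF eq] that by (simp add: sforms_def)
  obtain u v :: 'v where uv: "u \<noteq> v" using infinite_vars by (metis UNIV_I finite.emptyI finite_insert finite_subset insertI1 subsetI)
  have ms: "Metric_space (universe U) (mdistance U)" using struct by (simp add: is_structure_def)
  \<comment> \<open>Equal entries stay equal because the distance of two entries is part of the
    type.\<close>
  have wd: "?t k = ?t k'" if k: "k \<in> ?K" "k' \<in> ?K" "?s k = ?s k'" for k k'
  proof -
    let ?\<phi> = "Dist (Var u) (Var v) :: ('f, 'r, 'a, 'v) fm"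
    let ?\<theta> = "(\<lambda>_. k)(v := k')"
    have "fm_val U ?\<phi> (?s \<circ> ?\<theta>) = fm_val U ?\<phi> (?t \<circ> ?\<theta>)"
      using k by (intro eq') (auto simp: formulas_def)
    then have "mdistance U (?t k) (?t k') = mdistance U (?s k) (?s k')" using uv by simp
    then show ?thesis using k in_U[of k] in_U[of k'] Metric_space.zero[OF ms] by metis
  qed
  have fs: "f (?s k) = ?t k" if "k \<in> ?K" for k
    unfolding f_def comp_def using that
    by (intro wd inv_into_into imageI) (auto intro!: f_inv_into_f)
  have "partial_elementary TYPE('v) L U (?s ` ?K) f"
    unfolding partial_elementary_def
  proof (intro conjI ballI)
    show "f \<in> ?s ` ?K \<rightarrow> universe U"
    proof
      fix b assume "b \<in> ?s ` ?K"
      then obtain k where "b = ?s k" "k \<in> ?K" by (rule imageE)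
      then show "f b \<in> universe U" using fs[of k] in_U(2)[of k] by (simp only:)
    qed
    fix \<phi> :: "('f, 'r, 'a, 'v) fm" and r :: "'v \<Rightarrow> 'a"
    assume \<phi>: "\<phi> \<in> formulas L UNIV {}" and r: "r \<in> UNIV \<rightarrow> ?s ` ?K"
    \<comment> \<open>Each value of \<open>r\<close> is the entry at some index; choosing such
      indices turns evaluation at \<open>r\<close> into a formula about the tuples.\<close>
    let ?\<theta> = "inv_into ?K ?s \<circ> r"
    have r': "r v \<in> ?s ` ?K" for v using r by auto
    then have k: "?\<theta> v \<in> ?K" "?s (?\<theta> v) = r v" for v
      using inv_into_into[OF r'] f_inv_into_f[OF r'] by auto
    then have "?s \<circ> ?\<theta> = r" "?t \<circ> ?\<theta> = f \<circ> r" by (auto simp: f_def)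
    moreover have "fm_val U \<phi> (?s \<circ> ?\<theta>) = fm_val U \<phi> (?t \<circ> ?\<theta>)"
      using \<phi> k by (intro eq') auto
    ultimately show "fm_val U \<phi> (f \<circ> r) = fm_val U \<phi> r" by metis
  qed
  moreover have "?s ` ?K \<subseteq> universe U" using in_U by blast
  moreover have "|?s ` ?K| <o \<kappa>" using I A by (intro small_image small_Plus)
  ultimately obtain \<sigma> where \<sigma>: "automorphism L U \<sigma>" "\<forall>a\<in>?s ` ?K. \<sigma> a = f a"
    using hom unfolding strongly_homogeneous_def by blast
  have "\<sigma> (?s k) = ?t k" if "k \<in> ?K" for k using \<sigma>(2) fs that by auto
  from this[of "Inl _"] this[of "Inr _"] \<sigma>(1) that[of \<sigma>] show ?thesis by (auto simp: Aut_def)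
qed

lemma eqtp_Aut:
  assumes "\<sigma> \<in> Aut L U A" "A \<subseteq> universe U" "s \<in> I \<rightarrow> universe U" "\<And>i. i \<in> I \<Longrightarrow> \<sigma> (s i) = t i"
  shows "eqtp I A s t"
proof (rule eqtpI)
  fix \<phi> :: "('f, 'r, 'a, 'v) fm" and \<theta> assume \<phi>: "(\<phi>, \<theta>) \<in> sforms L I A"
  have "fm_val U \<phi> (case_sum (\<sigma> \<circ> s) \<sigma> \<circ> \<theta>) = fm_val U \<phi> (case_sum s id \<circ> \<theta>)"
    using sform_val_Aut[OF struct assms(1) \<phi> assms(2,3)] .
  moreover have "fm_val U \<phi> (case_sum (\<sigma> \<circ> s) \<sigma> \<circ> \<theta>) = fm_val U \<phi> (case_sum t id \<circ> \<theta>)"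
    using \<phi> assms(4) Aut_fixes[OF assms(1)] by (intro sform_val_cong) auto
  ultimately show "fm_val U \<phi> (case_sum s id \<circ> \<theta>) = fm_val U \<phi> (case_sum t id \<circ> \<theta>)" by simp
qed

lemma realization_exists:
  assumes p: "p \<in> types L U X (universe U)" and X: "|X :: 'v set| <o \<kappa>"
    and A: "A \<subseteq> universe U" "|A| <o \<kappa>"
  obtains a where "realizes L U X A a p"
proof -
  have "restrict p (formulas L X A) \<in> types L U X A" using types_restrict[OF p A(1)] .
  then obtain a where "realizes L U X A a (restrict p (formulas L X A))"
    using sat A X unfolding saturated_def by blast
  then have "realizes L U X A a p" by (simp add: realizes_iff)
  then show ?thesis using that by blast
qed

lemma realizations_conjugate:
  assumes X: "|X :: 'v set| <o \<kappa>" and A: "A \<subseteq> universe U" "|A| <o \<kappa>"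
    and a: "realizes L U X A a p" and b: "realizes L U X A b p"
  obtains \<sigma> where "\<sigma> \<in> Aut L U A" "\<And>x. x \<in> X \<Longrightarrow> \<sigma> (a x) = b x"
proof (rule homogeneity[OF A X])
  show "a \<in> X \<rightarrow> universe U" "b \<in> X \<rightarrow> universe U" using a b by (auto simp: realizes_iff)
  show "eqtp X A a b"
  proof (rule eqtpI)
    fix \<phi> :: "('f, 'r, 'a, 'v) fm" and \<theta> assume "(\<phi>, \<theta>) \<in> sforms L X A"
    then obtain \<psi> where "\<psi> \<in> formulas L X A" "\<And>s. fm_val U \<psi> s = fm_val U \<phi> (case_sum s id \<circ> \<theta>)"
      using formula_of_sform' by metis
    then show "fm_val U \<phi> (case_sum a id \<circ> \<theta>) = fm_val U \<phi> (case_sum b id \<circ> \<theta>)"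
      using a b unfolding realizes_iff by metis
  qed
qed (use that in blast)

section \<open>Compactness and limits of tuples\<close>

lemma compact_unit_functions: "compact {f :: 'b \<Rightarrow> real. \<forall>x. f x \<in> {0..1}}"
proof -
  have "compactin (product_topology (\<lambda>_ :: 'b. euclideanreal) UNIV) (PiE UNIV (\<lambda>_. {0..1}))"
    by (subst compactin_PiE) auto
  then show ?thesis by (simp add: euclidean_product_topology PiE_UNIV_domain Pi_def)
qed

text \<open>
  The type of \<open>t\<close> is a cluster point of the types of the \<open>s k\<close>, so it satisfies every closed condition
  that eventually holds of them.
\<close>

lemma limit_tuple:
  fixes s :: "nat \<Rightarrow> 'i \<Rightarrow> 'a"
  assumes I: "|I| <o \<kappa>" "|I| \<le>o |UNIV :: 'v set|" and A: "A \<subseteq> universe U" "|A| <o \<kappa>"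
    and s: "\<And>k. s k \<in> I \<rightarrow> universe U"
  shows "\<exists>t\<in>I \<rightarrow> universe U. \<forall>(\<phi> :: ('f, 'r, 'a, 'v) fm) \<theta> K. (\<phi>, \<theta>) \<in> sforms L I A \<longrightarrow> closed K \<longrightarrow>
       eventually (\<lambda>k. fm_val U \<phi> (case_sum (s k) id \<circ> \<theta>) \<in> K) sequentially \<longrightarrow>
       fm_val U \<phi> (case_sum t id \<circ> \<theta>) \<in> K"
proof -
  \<comment> \<open>The indices are renamed into variables by \<open>e\<close>, with inverse
    \<open>g\<close>, to make saturation applicable.\<close>
  obtain e :: "'i \<Rightarrow> 'v" where e: "inj_on e I" using I(2) card_of_ordLeq[of I "UNIV :: 'v set"] by auto
  define g where "g = inv_into I e"
  let ?X = "e ` I"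
  let ?F = "formulas L ?X A :: ('f, 'r, 'a, 'v) fm set"
  have ge: "g (e i) = i" if "i \<in> I" for i using e that by (simp add: g_def)
  have sg: "s k \<circ> g \<in> ?X \<rightarrow> universe U" for k using s ge by (auto simp: Pi_iff)
  \<comment> \<open>The type of \<open>s k\<close> over \<open>A\<close>, set to 0 off the formulas
    so that it is a point of the compact cube.\<close>
  define T where "T k \<psi> = (if \<psi> \<in> ?F then fm_val U \<psi> (s k \<circ> g) else 0)" for k and \<psi> :: "('f, 'r, 'a, 'v) fm"
  have T01: "T k \<psi> \<in> {0..1}" for k \<psi>
  proof (cases "\<psi> \<in> ?F")
    case True
    then have "fm_val U \<psi> (s k \<circ> g) \<in> {0..1}"
      using fm_val_in_unit[OF struct, of \<psi> "s k \<circ> g"] sg[of k] A(1)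
      by (force simp: formulas_def Pi_iff)
    then show ?thesis by (simp add: T_def)
  qed (simp add: T_def)
  \<comment> \<open>Compactness gives a cluster point of the types \<open>T k\<close>; on finitely
    many formulas it is approximated by some \<open>T k\<close>, hence it is itself a type.\<close>
  obtain \<tau> where \<tau>: "inf (nhds \<tau>) (filtermap T sequentially) \<noteq> bot"
  proof -
    have "filtermap T sequentially \<noteq> bot" by (simp add: filtermap_bot_iff)
    moreover have "eventually (\<lambda>f. f \<in> {f. \<forall>x. f x \<in> {0..1}}) (filtermap T sequentially)"
      using T01 by (simp add: eventually_filtermap)
    ultimately show ?thesis using compact_unit_functions that unfolding compact_filter by blast
  qed
  have freq: "\<exists>k\<ge>n. T k \<in> O'" if "open O'" "\<tau> \<in> O'" for O' n
  proof (rule ccontr)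
    assume "\<not> ?thesis"
    then have "eventually (\<lambda>f. f \<notin> O') (filtermap T sequentially)"
      by (auto simp: eventually_filtermap eventually_sequentially)
    moreover have "eventually (\<lambda>f. f \<in> O') (nhds \<tau>)" using that by (rule eventually_nhds_in_open)
    ultimately have "eventually (\<lambda>f. False) (inf (nhds \<tau>) (filtermap T sequentially))"
      unfolding eventually_inf by blast
    then show False using \<tau> by (simp add: eventually_False)
  qed
  have "restrict \<tau> ?F \<in> types L U ?X A"
  proof -
    have "\<exists>a\<in>?X \<rightarrow> universe U. \<forall>\<phi>\<in>F. \<bar>fm_val U \<phi> a - restrict \<tau> ?F \<phi>\<bar> < \<epsilon>"
      if F: "finite F" "F \<subseteq> ?F" "0 < \<epsilon>" for F \<epsilon>
    proof -
      let ?O = "\<Inter>\<psi>\<in>F. {f. \<bar>f \<psi> - \<tau> \<psi>\<bar> < \<epsilon>}"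
      have "open ?O"
        using F(1) by (intro open_INT ballI open_Collect_less continuous_intros) auto
      moreover have "\<tau> \<in> ?O" using F by auto
      ultimately obtain k where "T k \<in> ?O" using freq by blast
      then show ?thesis using F(2) sg[of k] by (intro bexI[of _ "s k \<circ> g"]) (auto simp: T_def subset_iff)
    qed
    then show ?thesis by (simp add: types_def)
  qed
  moreover have "|?X| <o \<kappa>" using I by (intro small_image)
  ultimately obtain b where "realizes L U ?X A b (restrict \<tau> ?F)"
    using sat A unfolding saturated_def by blast
  then have b: "b \<in> ?X \<rightarrow> universe U" "\<And>\<psi>. \<psi> \<in> ?F \<Longrightarrow> fm_val U \<psi> b = \<tau> \<psi>"
    by (auto simp: realizes_iff)
  show ?thesis
  proof (intro bexI[of _ "b \<circ> e"] allI impI)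
    show "b \<circ> e \<in> I \<rightarrow> universe U" using b(1) by auto
    fix \<phi> :: "('f, 'r, 'a, 'v) fm" and \<theta> K
    assume \<phi>: "(\<phi>, \<theta>) \<in> sforms L I A" and K: "closed K"
      and ev: "eventually (\<lambda>k. fm_val U \<phi> (case_sum (s k) id \<circ> \<theta>) \<in> K) sequentially"
    have "(\<phi>, map_sum e id \<circ> \<theta>) \<in> sforms L ?X A" using \<phi> by (fastforce simp: sforms_def)
    then obtain \<psi> where \<psi>: "\<psi> \<in> ?F" "\<And>s. fm_val U \<psi> s = fm_val U \<phi> (case_sum s id \<circ> (map_sum e id \<circ> \<theta>))"
      using formula_of_sform' by metis
    have "fm_val U \<psi> s = fm_val U \<phi> (case_sum (s \<circ> e) id \<circ> \<theta>)" for s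
      unfolding \<psi>(2) by (rule arg_cong[of _ _ "fm_val U \<phi>"]) (auto simp: fun_eq_iff split: sum.split)
    moreover have "fm_val U \<phi> (case_sum (s k \<circ> g \<circ> e) id \<circ> \<theta>) = fm_val U \<phi> (case_sum (s k) id \<circ> \<theta>)" for k
      using \<phi> ge by (intro sform_val_cong) auto
    ultimately have T: "T k \<psi> = fm_val U \<phi> (case_sum (s k) id \<circ> \<theta>)"
      and b': "\<tau> \<psi> = fm_val U \<phi> (case_sum (b \<circ> e) id \<circ> \<theta>)" for k
      using \<psi>(1) b(2)[OF \<psi>(1)] by (simp_all add: T_def)
    \<comment> \<open>The functions with value off \<open>K\<close> at \<psi> form an open set that
      the sequence eventually avoids, so the cluster point is not in it.\<close>
    show "fm_val U \<phi> (case_sum (b \<circ> e) id \<circ> \<theta>) \<in> K"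
    proof (rule ccontr)
      assume "\<not> ?thesis"
      then have "\<tau> \<in> {f. f \<psi> \<in> - K}" using b' by simp
      moreover have "open {f :: ('f, 'r, 'a, 'v) fm \<Rightarrow> real. f \<psi> \<in> - K}"
        using K open_vimage[of "- K" "\<lambda>f :: ('f, 'r, 'a, 'v) fm \<Rightarrow> real. f \<psi>"]
        by (simp add: vimage_def open_Compl)
      moreover obtain n where "\<And>k. k \<ge> n \<Longrightarrow> T k \<psi> \<in> K"
        using ev T by (auto simp: eventually_sequentially)
      ultimately show False using freq[of "{f. f \<psi> \<in> - K}" n] by auto
    qed
  qed
qed

end

section \<open>Morley sequences\<close>

lemma limitin_type_space:
  assumes "p \<in> types L N X A" "\<And>i. a i \<in> X \<rightarrow> universe N"
  shows "limitin (type_space L N X A) (\<lambda>i. tp L N X A (a i)) p sequentially \<longleftrightarrow>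
    (\<forall>\<phi>\<in>formulas L X A. (\<lambda>i. fm_val N \<phi> (a i)) \<longlonglongrightarrow> p \<phi>)"
proof -
  have ext: "p \<in> extensional (formulas L X A)" using assms(1) by (auto simp: types_def)
  have tp: "tp L N X A (a i) \<in> types L N X A" for i
    using assms(2)[of i] by (auto simp: types_def tp_def intro!: bexI[of _ "a i"])
  have "limitin (type_space L N X A) (\<lambda>i. tp L N X A (a i)) p sequentially \<longleftrightarrow>
      (\<forall>\<phi>\<in>formulas L X A. (\<lambda>i. tp L N X A (a i) \<phi>) \<longlonglongrightarrow> p \<phi>)"
    unfolding type_space_def limitin_subtopology limitin_componentwise
    using assms(1) ext tp by (auto simp: tp_def)
  also have "\<dots> \<longleftrightarrow> (\<forall>\<phi>\<in>formulas L X A. (\<lambda>i. fm_val N \<phi> (a i)) \<longlonglongrightarrow> p \<phi>)"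
    by (intro ball_cong refl) (simp add: tp_def)
  finally show ?thesis .
qed

locale monster_over = monster L \<kappa> U V
  for L :: "('f, 'r) language" and \<kappa> :: "'k rel" and U :: "('f, 'r, 'a) mstruct" and V :: "'v itself" +
  fixes M :: "('f, 'r, 'a) mstruct"
  assumes M: "universe M \<subseteq> universe U" and M_small: "|universe M| <o \<kappa>"
begin

text \<open>Bases larger than \<open>M\<close> serve for Morley sequences that are independent of
  further tuples, such as a realization of the other type.\<close>

definition morley_over :: "'a set \<Rightarrow> 'v set \<Rightarrow> (('f, 'r, 'a, 'v) fm \<Rightarrow> real) \<Rightarrow> (nat \<Rightarrow> 'v \<Rightarrow> 'a) \<Rightarrow> bool" where
  "morley_over A X p a \<longleftrightarrow> (\<forall>i. realizes L U X (A \<union> (\<Union>j<i. a j ` X)) (a i) p)"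

lemma morley_over_M: "morley_over (universe M) X p a \<longleftrightarrow> morley_sequence L U M X p a"
  by (simp add: morley_over_def morley_sequence_def)

lemma morley_overD: "morley_over A X p a \<Longrightarrow> realizes L U X A (a i) p"
  unfolding morley_over_def using realizes_mono by (metis Un_upper1)

lemma morley_in: "morley_over A X p a \<Longrightarrow> a i \<in> X \<rightarrow> universe U"
  using morley_overD realizes_iff by metis

lemma morley_mono: "morley_over B X p a \<Longrightarrow> A \<subseteq> B \<Longrightarrow> morley_over A X p a"
  unfolding morley_over_def by (meson Un_mono order_refl realizes_mono)

lemma morley_subseq:
  assumes "morley_over A X p a" "strict_mono h"
  shows "morley_over A X p (\<lambda>i. a (h i))"
  unfolding morley_over_def
proof
  fix i
  have "A \<union> (\<Union>j<i. a (h j) ` X) \<subseteq> A \<union> (\<Union>j<h i. a j ` X)"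
    using assms(2) by (auto simp: strict_mono_def)
  then show "realizes L U X (A \<union> (\<Union>j<i. a (h j) ` X)) (a (h i)) p"
    using assms(1) realizes_mono unfolding morley_over_def by metis
qed

lemma morley_cong:
  assumes "\<And>i x. x \<in> X \<Longrightarrow> a i x = b i x"
  shows "morley_over A X p a = morley_over A X p b"
proof -
  have "a i ` X = b i ` X" for i using assms by (intro image_cong) auto
  moreover have "realizes L U X B (a i) p = realizes L U X B (b i) p" for B i
    using assms by (intro realizes_cong) auto
  ultimately show ?thesis by (simp add: morley_over_def)
qed

lemma gs_converges:
  assumes "generically_stable L U M X p" "morley_over (universe M) X p a" "\<phi> \<in> formulas L X (universe U)"
  shows "(\<lambda>i. fm_val U \<phi> (a i)) \<longlonglongrightarrow> p \<phi>"
proof -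
  have "p \<in> types L U X (universe U)"
    using assms(1) by (simp add: generically_stable_def invariant_type_def)
  from limitin_type_space[OF this morley_in[OF assms(2)]] show ?thesis
    using assms by (auto simp: generically_stable_def morley_over_M)
qed

text \<open>The stages remain small since each adds one small tuple, so a next choice always exists.
  \<open>Q\<close> is left arbitrary because one step may have to add a whole sequence together with
  a further tuple.\<close>

lemma tower:
  fixes Q :: "'a set \<Rightarrow> ('j \<Rightarrow> 'a) \<Rightarrow> bool"
  assumes ex: "\<And>A. A \<subseteq> universe U \<Longrightarrow> |A| <o \<kappa> \<Longrightarrow> \<exists>x\<in>J \<rightarrow> universe U. Q A x"
    and J: "|J| <o \<kappa>" and A0: "A0 \<subseteq> universe U" "|A0| <o \<kappa>"
  obtains x :: "nat \<Rightarrow> 'j \<Rightarrow> 'a" where "\<And>i. x i \<in> J \<rightarrow> universe U"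
    and "\<And>i. Q (A0 \<union> (\<Union>j<i. x j ` J)) (x i)"
proof -
  define pick where "pick A = (SOME x. x \<in> J \<rightarrow> universe U \<and> Q A x)" for A
  define S where "S = rec_nat A0 (\<lambda>_ B. B \<union> pick B ` J)"
  have S: "S 0 = A0" "S (Suc n) = S n \<union> pick (S n) ` J" for n by (simp_all add: S_def)
  have pick: "pick A \<in> J \<rightarrow> universe U" "Q A (pick A)" if "A \<subseteq> universe U" "|A| <o \<kappa>" for A
    using someI_ex[of "\<lambda>x. x \<in> J \<rightarrow> universe U \<and> Q A x"] ex[OF that] unfolding pick_def by blast+
  have inv: "S n \<subseteq> universe U \<and> |S n| <o \<kappa>" for n
  proof (induction n)
    case (Suc n)
    then have "pick (S n) \<in> J \<rightarrow> universe U" using pick by blast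
    then show ?case using Suc by (auto simp: S intro!: small_Un small_image J)
  qed (use A0 in \<open>simp add: S\<close>)
  have eq: "S n = A0 \<union> (\<Union>j<n. pick (S j) ` J)" for n
    by (induction n) (auto simp: S lessThan_Suc)
  show ?thesis
  proof (rule that[of "\<lambda>n. pick (S n)"])
    show "pick (S i) \<in> J \<rightarrow> universe U" for i using inv pick by blast
    show "Q (A0 \<union> (\<Union>j<i. pick (S j) ` J)) (pick (S i))" for i
      unfolding eq[symmetric] using inv[of i] by (intro pick(2)) auto
  qed
qed

lemma morley_exists:
  assumes "p \<in> types L U X (universe U)" "|X| <o \<kappa>" "A \<subseteq> universe U" "|A| <o \<kappa>"
  obtains a where "morley_over A X p a"
proof -
  have "\<exists>x\<in>X \<rightarrow> universe U. realizes L U X B x p" if "B \<subseteq> universe U" "|B| <o \<kappa>" for B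
    using realization_exists[OF assms(1,2) that] realizes_iff by metis
  then show ?thesis
    by (rule tower[of X "\<lambda>B x. realizes L U X B x p" A, OF _ assms(2-4)])
      (use that in \<open>auto simp: morley_over_def\<close>)
qed

lemma realizes_Aut:
  assumes "invariant_type L U M X p" "\<sigma> \<in> Aut L U (universe M)" "A \<subseteq> universe U" "realizes L U X A a p"
  shows "realizes L U X (\<sigma> ` A) (\<sigma> \<circ> a) p"
  using invariant_realizes_Aut[OF struct M] assms by blast

text \<open>Initial segments are conjugate by induction, and a formula mentions only finitely many
  entries; so the full sequences have equal types over \<open>M\<close>, and homogeneity applies to
  them.\<close>

lemma morley_conjugate:
  assumes X: "|X| <o \<kappa>" and p: "invariant_type L U M X p"
    and a: "morley_over (universe M) X p a" and b: "morley_over (universe M) X p b"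
  obtains \<sigma> where "\<sigma> \<in> Aut L U (universe M)" "\<And>i x. x \<in> X \<Longrightarrow> \<sigma> (a i x) = b i x"
proof -
  have fin: "\<exists>\<sigma>\<in>Aut L U (universe M). \<forall>i<n. \<forall>x\<in>X. \<sigma> (a i x) = b i x" for n
  proof (induction n)
    case 0
    then show ?case using Aut_id by blast
  next
    case (Suc n)
    then obtain \<sigma> where \<sigma>: "\<sigma> \<in> Aut L U (universe M)" "\<forall>i<n. \<forall>x\<in>X. \<sigma> (a i x) = b i x" by blast
    let ?A = "universe M \<union> (\<Union>j<n. a j ` X)" and ?B = "universe M \<union> (\<Union>j<n. b j ` X)"
    have sub: "?A \<subseteq> universe U" "?B \<subseteq> universe U" using M morley_in[OF a] morley_in[OF b] by fastforce+
    have "\<sigma> ` a j ` X = b j ` X" if "j < n" for j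
      using \<sigma>(2) that unfolding image_image by (intro image_cong) auto
    then have "\<sigma> ` ?A = ?B" using image_Aut[OF \<sigma>(1) order_refl] by (auto simp: image_Un image_UN)
    \<comment> \<open>The image of \<open>a n\<close> and \<open>b n\<close> realize
      \<open>p\<close> over the same set, which contains all earlier \<open>b j\<close>; an
      automorphism over this set corrects \<sigma> without disturbing what it already
      achieves.\<close>
    then have 1: "realizes L U X ?B (\<sigma> \<circ> a n) p"
      using realizes_Aut[OF p \<sigma>(1) sub(1), of "a n"] a by (simp add: morley_over_def)
    have 2: "realizes L U X ?B (b n) p" using b by (simp add: morley_over_def)
    have "|?B| <o \<kappa>" by (intro small_Un M_small small_UN_image X)
    then obtain \<tau> where \<tau>: "\<tau> \<in> Aut L U ?B" "\<And>x. x \<in> X \<Longrightarrow> \<tau> ((\<sigma> \<circ> a n) x) = b n x"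
      using realizations_conjugate[OF X sub(2) _ 1 2] by metis
    have "\<tau> \<circ> \<sigma> \<in> Aut L U (universe M)"
      using \<tau>(1) \<sigma>(1) Aut_mono[of "universe M" ?B L U] by (intro Aut_comp) auto
    moreover have "(\<tau> \<circ> \<sigma>) (a i x) = b i x" if "i < Suc n" "x \<in> X" for i x
    proof (cases "i = n")
      case False
      then have "b i x \<in> ?B" using that by auto
      then show ?thesis using \<sigma>(2) Aut_fixes[OF \<tau>(1)] that False by auto
    qed (use \<tau>(2) that in simp)
    ultimately show ?case by blast
  qed
  let ?I = "(UNIV :: nat set) \<times> X"
  have in_U: "case_prod a \<in> ?I \<rightarrow> universe U" "case_prod b \<in> ?I \<rightarrow> universe U"
    using morley_in[OF a] morley_in[OF b] by fastforce+
  have "eqtp ?I (universe M) (case_prod a) (case_prod b)"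
  proof (rule eqtpI)
    fix \<phi> :: "('f, 'r, 'a, 'v) fm" and \<theta> assume \<phi>: "(\<phi>, \<theta>) \<in> sforms L ?I (universe M)"
    \<comment> \<open>The positions in the sequence to which \<phi> refers, with 0 as a dummy for
      parameters; they are bounded by some \<open>n\<close>.\<close>
    let ?N = "(\<lambda>v. case \<theta> v of Inl (i, x) \<Rightarrow> i | Inr c \<Rightarrow> 0) ` free_vars \<phi>"
    obtain n where n: "\<And>i. i \<in> ?N \<Longrightarrow> i < n"
      using finite_nat_iff_bounded[of ?N] finite_free_vars by auto
    have "\<theta> v \<in> ({..<n} \<times> X) <+> universe M" if "v \<in> free_vars \<phi>" for v
    proof -
      have "\<theta> v \<in> ?I <+> universe M" using \<phi> that by (auto simp: sforms_def)
      then show ?thesis using n[OF imageI[OF that]] by (auto split: sum.splits)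
    qed
    then have \<phi>': "(\<phi>, \<theta>) \<in> sforms L ({..<n} \<times> X) (universe M)"
      using \<phi> by (auto simp: sforms_def)
    obtain \<sigma> where "\<sigma> \<in> Aut L U (universe M)" "\<forall>i<n. \<forall>x\<in>X. \<sigma> (a i x) = b i x" using fin by blast
    then have "eqtp ({..<n} \<times> X) (universe M) (case_prod a) (case_prod b)"
      using in_U(1) by (intro eqtp_Aut[OF _ M]) (auto simp: Pi_iff)
    then show "fm_val U \<phi> (case_sum (case_prod a) id \<circ> \<theta>) = fm_val U \<phi> (case_sum (case_prod b) id \<circ> \<theta>)"
      using eqtpD \<phi>' by blast
  qed
  from homogeneity[OF M M_small small_nat_Times[OF X] in_U this]
  obtain \<sigma> where "\<sigma> \<in> Aut L U (universe M)" "\<And>i. i \<in> ?I \<Longrightarrow> \<sigma> (case_prod a i) = case_prod b i" by blast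
  then show ?thesis using that[of \<sigma>] by force
qed

lemma morley_Aut:
  assumes p: "invariant_type L U M X p" and a: "morley_over (universe M) X p a"
    and \<sigma>: "\<sigma> \<in> Aut L U (universe M)"
  shows "morley_over (universe M) X p (\<lambda>i. \<sigma> \<circ> a i)"
  unfolding morley_over_def
proof
  fix i
  let ?A = "universe M \<union> (\<Union>j<i. a j ` X)"
  have "?A \<subseteq> universe U" using M morley_in[OF a] by fastforce
  then have "realizes L U X (\<sigma> ` ?A) (\<sigma> \<circ> a i) p"
    using realizes_Aut[OF p \<sigma>] a unfolding morley_over_def by blast
  moreover have "\<sigma> ` ?A = universe M \<union> (\<Union>j<i. (\<sigma> \<circ> a j) ` X)"
    using image_Aut[OF \<sigma> order_refl] by (simp add: image_Un image_UN image_comp)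
  ultimately show "realizes L U X (universe M \<union> (\<Union>j<i. (\<sigma> \<circ> a j) ` X)) (\<sigma> \<circ> a i) p" by simp
qed

text \<open>Homogeneity moves \<open>a\<close> to \<open>b\<close> over \<open>M\<close>, and
  automorphisms over \<open>M\<close> preserve Morley sequences in an invariant type.\<close>

lemma morley_eqtp:
  assumes X: "|X| <o \<kappa>" and p: "invariant_type L U M X p" and a: "morley_over (universe M) X p a"
    and b: "\<And>i. b i \<in> X \<rightarrow> universe U"
    and eq: "eqtp (UNIV \<times> X) (universe M) (case_prod a) (case_prod b)"
  shows "morley_over (universe M) X p b"
proof -
  have "case_prod a \<in> UNIV \<times> X \<rightarrow> universe U" "case_prod b \<in> UNIV \<times> X \<rightarrow> universe U"
    using morley_in[OF a] b by fastforce+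
  from homogeneity[OF M M_small small_nat_Times[OF X] this eq]
  obtain \<sigma> where \<sigma>: "\<sigma> \<in> Aut L U (universe M)" "\<And>i. i \<in> UNIV \<times> X \<Longrightarrow> \<sigma> (case_prod a i) = case_prod b i"
    by blast
  have "morley_over (universe M) X p (\<lambda>i. \<sigma> \<circ> a i)" using morley_Aut[OF p a \<sigma>(1)] .
  moreover have "(\<sigma> \<circ> a i) x = b i x" if "x \<in> X" for i x using \<sigma>(2)[of "(i, x)"] that by simp
  ultimately show ?thesis using morley_cong[of X "\<lambda>i. \<sigma> \<circ> a i" b] by blast
qed

text \<open>In a limit of the pairs \<open>(b k, w k)\<close> the first component realizes
  \<open>p\<close> over \<open>A\<close>, because the \<open>b k\<close> converge to
  \<open>p\<close> there. It can thus be conjugated over \<open>A\<close> to the prescribed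
  \<open>a\<close>, and the second component moves along to \<open>c\<close>. This is how a
  convergent sequence is exchanged for a single realization.\<close>

lemma limit_over_realization:
  fixes X :: "'v set" and w :: "nat \<Rightarrow> 'j \<Rightarrow> 'a"
  assumes X: "|X| <o \<kappa>" and A: "A \<subseteq> universe U" "|A| <o \<kappa>" and a: "realizes L U X A a p"
    and b: "\<And>k. b k \<in> X \<rightarrow> universe U"
    and conv: "\<forall>\<phi>\<in>formulas L X A. (\<lambda>k. fm_val U \<phi> (b k)) \<longlonglongrightarrow> p \<phi>"
    and J: "|J| <o \<kappa>" "|J| \<le>o |UNIV :: 'v set|" and w: "\<And>k. w k \<in> J \<rightarrow> universe U"
  shows "\<exists>c\<in>J \<rightarrow> universe U. \<forall>(\<phi> :: ('f, 'r, 'a, 'v) fm) \<theta> K. (\<phi>, \<theta>) \<in> sforms L (X <+> J) A \<longrightarrow> closed K \<longrightarrow>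
       (\<forall>k. fm_val U \<phi> (case_sum (case_sum (b k) (w k)) id \<circ> \<theta>) \<in> K) \<longrightarrow>
       fm_val U \<phi> (case_sum (case_sum a c) id \<circ> \<theta>) \<in> K"
proof -
  let ?I = "X <+> J"
  have "|X| \<le>o |UNIV :: 'v set|" by (rule card_of_mono1) simp
  then have I: "|?I| <o \<kappa>" "|?I| \<le>o |UNIV :: 'v set|" using X J by (auto intro: small_Plus Plus_vars)
  have in_U: "case_sum (b k) (w k) \<in> ?I \<rightarrow> universe U" for k using b w by fastforce
  obtain t where t: "t \<in> ?I \<rightarrow> universe U"
    and lim: "\<forall>(\<phi> :: ('f, 'r, 'a, 'v) fm) \<theta> K. (\<phi>, \<theta>) \<in> sforms L ?I A \<longrightarrow> closed K \<longrightarrow>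
       eventually (\<lambda>k. fm_val U \<phi> (case_sum (case_sum (b k) (w k)) id \<circ> \<theta>) \<in> K) sequentially \<longrightarrow>
       fm_val U \<phi> (case_sum t id \<circ> \<theta>) \<in> K"
    using limit_tuple[where s = "\<lambda>k. case_sum (b k) (w k)", OF I A in_U] by (elim bexE)
  have "realizes L U X A (t \<circ> Inl) p"
    unfolding realizes_iff
  proof (intro conjI ballI)
    show "t \<circ> Inl \<in> X \<rightarrow> universe U" using t by auto
    fix \<phi> assume \<phi>: "\<phi> \<in> formulas L X A"
    have wf: "wf_fm L \<phi>" and \<eta>: "\<forall>v\<in>free_vars \<phi>. Inl (Inl v) \<in> ?I <+> A"
      and \<eta>': "\<forall>c\<in>params \<phi>. Inr c \<in> ?I <+> A"
      using \<phi> by (auto simp: formulas_def)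
    obtain \<psi> :: "('f, 'r, 'a, 'v) fm" and \<theta> where \<psi>: "(\<psi>, \<theta>) \<in> sforms L ?I A"
      and val: "\<forall>(N :: ('f, 'r, 'a) mstruct) s b g.
       (\<forall>v\<in>free_vars \<phi>. b v = case_sum s id (Inl (Inl v))) \<longrightarrow>
       (\<forall>c\<in>params \<phi>. g c = case_sum s id (Inr c)) \<longrightarrow>
       fm_val N (map_fm id id g id \<phi>) b = fm_val N \<psi> (case_sum s id \<circ> \<theta>)"
      using sform_assign[where \<eta> = "\<lambda>v. Inl (Inl v)" and \<eta>' = Inr, OF infinite_vars wf \<eta> \<eta>'] by (elim exE conjE)
    have eq: "fm_val U \<psi> (case_sum s id \<circ> \<theta>) = fm_val U \<phi> (s \<circ> Inl)" for s
      using val[rule_format, of "s \<circ> Inl" s id U] map_fm_id[of \<phi>] by simp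
    \<comment> \<open>Membership in a closed ball is a closed condition that holds eventually, so it
      passes to the limit tuple.\<close>
    have cb: "fm_val U \<phi> (t \<circ> Inl) \<in> cball (p \<phi>) \<epsilon>" if "\<epsilon> > 0" for \<epsilon>
    proof -
      have "eventually (\<lambda>k. fm_val U \<phi> (b k) \<in> cball (p \<phi>) \<epsilon>) sequentially"
        using tendstoD[OF bspec[OF conv \<phi>] that]
        by (rule eventually_mono) (simp add: dist_commute)
      then show ?thesis
        using lim[rule_format, OF \<psi>, of "cball (p \<phi>) \<epsilon>"] unfolding eq by (simp add: comp_def)
    qed
    have "dist (p \<phi>) (fm_val U \<phi> (t \<circ> Inl)) \<le> 0"
    proof (rule field_le_epsilon)
      show "dist (p \<phi>) (fm_val U \<phi> (t \<circ> Inl)) \<le> 0 + e" if "0 < e" for e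
        using cb[OF that] by simp
    qed
    then show "fm_val U \<phi> (t \<circ> Inl) = p \<phi>" by simp
  qed
  from realizations_conjugate[OF X A this a]
  obtain \<sigma> where \<sigma>: "\<sigma> \<in> Aut L U A" "\<And>x. x \<in> X \<Longrightarrow> \<sigma> ((t \<circ> Inl) x) = a x" by blast
  show ?thesis
  proof (intro bexI[of _ "\<sigma> \<circ> t \<circ> Inr"] allI impI)
    show "\<sigma> \<circ> t \<circ> Inr \<in> J \<rightarrow> universe U"
      using Aut_in[OF \<sigma>(1)] funcset_mem[OF t, of "Inr _"] by (auto simp: Plus_def)
    fix \<phi> :: "('f, 'r, 'a, 'v) fm" and \<theta> K
    assume *: "(\<phi>, \<theta>) \<in> sforms L ?I A" "closed K"
      "\<forall>k. fm_val U \<phi> (case_sum (case_sum (b k) (w k)) id \<circ> \<theta>) \<in> K"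
    have "fm_val U \<phi> (case_sum (case_sum a (\<sigma> \<circ> t \<circ> Inr)) id \<circ> \<theta>) =
        fm_val U \<phi> (case_sum (\<sigma> \<circ> t) \<sigma> \<circ> \<theta>)"
      using *(1) \<sigma>(2) Aut_fixes[OF \<sigma>(1)] by (intro sform_val_cong) auto
    also have "\<dots> = fm_val U \<phi> (case_sum t id \<circ> \<theta>)" by (rule sform_val_Aut[OF struct \<sigma>(1) *(1) A(1) t])
    also have "\<dots> \<in> K" using * by (intro lim[rule_format]) auto
    finally show "fm_val U \<phi> (case_sum (case_sum a (\<sigma> \<circ> t \<circ> Inr)) id \<circ> \<theta>) \<in> K" .
  qed
qed

text \<open>
  Replace \<open>b\<close> by a realization over a Morley sequence \<open>c\<close> of \<open>p\<close>.  On \<open>c\<close> the formula then has the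
  constant value given by \<open>q\<close>, which by generic stability is its value in \<open>p\<close>.
\<close>

lemma generically_stable_commute:
  fixes X Y :: "'v set"
  assumes X: "|X| <o \<kappa>" and Y: "|Y| <o \<kappa>"
    and p: "generically_stable L U M X p" and q: "invariant_type L U M Y q"
    and A: "universe M \<subseteq> A" "A \<subseteq> universe U" "|A| <o \<kappa>"
    and b: "realizes L U Y A b q" and a: "realizes L U X (A \<union> b ` Y) a p"
  shows "realizes L U Y (A \<union> a ` X) b q"
proof -
  have inv: "invariant_type L U M X p" using p by (simp add: generically_stable_def)
  then have pt: "p \<in> types L U X (universe U)" and qt: "q \<in> types L U Y (universe U)"
    using q by (auto simp: invariant_type_def)
  obtain c where c: "morley_over A X p c" using morley_exists[OF pt X A(2,3)] .
  let ?B = "A \<union> (\<Union>i. c i ` X)"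
  have B: "?B \<subseteq> universe U" "|?B| <o \<kappa>"
    using A morley_in[OF c] by (auto intro!: small_Un small_UN_image X)
  obtain b' where b': "realizes L U Y ?B b' q" using realization_exists[OF qt Y B] .
  then have b'A: "realizes L U Y A b' q" by (rule realizes_mono) auto
  have bU: "b \<in> Y \<rightarrow> universe U" "b' \<in> Y \<rightarrow> universe U" using b b' by (auto simp: realizes_iff)
  let ?D = "A \<union> b' ` Y"
  have D: "?D \<subseteq> universe U" "|?D| <o \<kappa>" using A bU by (auto intro!: small_Un small_image Y)
  obtain a' where a': "realizes L U X ?D a' p" using realization_exists[OF pt X D] .
  then have a'A: "realizes L U X A a' p" by (rule realizes_mono) auto
  have aU: "a \<in> X \<rightarrow> universe U" "a' \<in> X \<rightarrow> universe U" using a a' by (auto simp: realizes_iff)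
  \<comment> \<open>The statement is first proved for a pair \<open>(a', b')\<close> with
    \<open>b'\<close> chosen over the whole sequence \<open>c\<close>; the given pair
    \<open>(a, b)\<close> is conjugate to it over \<open>A\<close>.\<close>
  have claim: "realizes L U Y (A \<union> a' ` X) b' q"
    unfolding realizes_iff
  proof (intro conjI ballI)
    fix \<xi> assume \<xi>: "\<xi> \<in> formulas L Y (A \<union> a' ` X)"
    have "\<exists>\<tau>\<in>Aut L U A. \<forall>x\<in>X. \<tau> (a' x) = c i x" for i
      using realizations_conjugate[OF X A(2,3) a'A morley_overD[OF c, of i]] by metis
    then obtain \<tau> where \<tau>: "\<And>i. \<tau> i \<in> Aut L U A" "\<And>i x. x \<in> X \<Longrightarrow> \<tau> i (a' x) = c i x" by metis
    \<comment> \<open>The entries of \<open>a'\<close> in \<xi> are turned into variables and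
      \<open>b'\<close> becomes a parameter, which gives \<zeta>; evaluating \<zeta> at
      \<open>c i\<close> is then evaluating the copy of \<xi> under \<open>\<tau> i\<close> at
      \<open>b'\<close>.\<close>
    let ?\<eta> = "\<lambda>v. Inr (b' v)" and ?\<eta>' = "\<lambda>d. if d \<in> A then Inr d else Inl (inv_into X a' d)"
    have \<eta>: "\<forall>v\<in>free_vars \<xi>. ?\<eta> v \<in> X <+> ?D" using \<xi> by (auto simp: formulas_def)
    have \<eta>': "\<forall>d\<in>params \<xi>. ?\<eta>' d \<in> X <+> ?D"
      using \<xi> by (auto simp: formulas_def intro!: inv_into_into)
    have wf: "wf_fm L \<xi>" using \<xi> by (simp add: formulas_def)
    obtain \<psi> :: "('f, 'r, 'a, 'v) fm" and \<theta> where \<psi>: "(\<psi>, \<theta>) \<in> sforms L X ?D"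
      and val: "\<forall>(N :: ('f, 'r, 'a) mstruct) s b g.
        (\<forall>v\<in>free_vars \<xi>. b v = case_sum s id (?\<eta> v)) \<longrightarrow>
        (\<forall>d\<in>params \<xi>. g d = case_sum s id (?\<eta>' d)) \<longrightarrow>
        fm_val N (map_fm id id g id \<xi>) b = fm_val N \<psi> (case_sum s id \<circ> \<theta>)"
      using sform_assign[where \<eta> = ?\<eta> and \<eta>' = ?\<eta>', OF infinite_vars wf \<eta> \<eta>'] by (elim exE conjE)
    obtain \<zeta> where \<zeta>: "\<zeta> \<in> formulas L X ?D"
      "\<And>(N :: ('f, 'r, 'a) mstruct) s. fm_val N \<zeta> s = fm_val N \<psi> (case_sum s id \<circ> \<theta>)"
      using formula_of_sform'[OF \<psi>] by metis
    have par: "d \<in> A \<or> (d \<notin> A \<and> inv_into X a' d \<in> X \<and> a' (inv_into X a' d) = d)" if "d \<in> params \<xi>" for d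
      using \<xi> that by (auto simp: formulas_def intro: inv_into_into f_inv_into_f)
    have \<tau>par: "\<tau> i d = case_sum (c i) id (?\<eta>' d)" "\<tau> i d \<in> ?B" if "d \<in> params \<xi>" for i d
    proof -
      have "\<tau> i d = case_sum (c i) id (?\<eta>' d) \<and> \<tau> i d \<in> ?B"
      proof (cases "d \<in> A")
        case True
        then show ?thesis using Aut_fixes[OF \<tau>(1)[of i]] by simp
      next
        case False
        then have "inv_into X a' d \<in> X" "a' (inv_into X a' d) = d" using par[OF that] by auto
        then have "\<tau> i d = c i (inv_into X a' d)" using \<tau>(2)[of "inv_into X a' d" i] by simp
        then show ?thesis using False \<open>inv_into X a' d \<in> X\<close> by auto
      qed
      then show "\<tau> i d = case_sum (c i) id (?\<eta>' d)" "\<tau> i d \<in> ?B" by blast+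
    qed
    have "fm_val U (map_fm id id (\<tau> i) id \<xi>) b' = fm_val U \<zeta> (c i)" for i
      unfolding \<zeta>(2)
    proof (rule val[rule_format])
      show "\<tau> i d = case_sum (c i) id (?\<eta>' d)" if "d \<in> params \<xi>" for d using \<tau>par(1)[OF that] .
    qed simp
    moreover have "fm_val U (map_fm id id (\<tau> i) id \<xi>) b' = q \<xi>" for i
    proof -
      have "\<tau> i ` params \<xi> \<subseteq> ?B" by (rule image_subsetI) (rule \<tau>par(2))
      then have "map_fm id id (\<tau> i) id \<xi> \<in> formulas L Y ?B" using map_formulas[OF \<xi>] by blast
      then have "fm_val U (map_fm id id (\<tau> i) id \<xi>) b' = q (map_fm id id (\<tau> i) id \<xi>)"
        using b' by (auto simp: realizes_iff)
      also have "\<dots> = q \<xi>"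
      proof -
        have "\<xi> \<in> formulas L Y (universe U)" using \<xi> A(2) aU by (auto simp: formulas_def)
        then show ?thesis using q \<tau>(1)[of i] A(1) unfolding invariant_type_def Aut_def by blast
      qed
      finally show ?thesis .
    qed
    moreover have "(\<lambda>i. fm_val U \<zeta> (c i)) \<longlonglongrightarrow> p \<zeta>"
      using formulas_mono[OF \<zeta>(1) D(1)] by (rule gs_converges[OF p morley_mono[OF c A(1)]])
    ultimately have "p \<zeta> = q \<xi>" by (simp add: LIMSEQ_const_iff)
    moreover have "p \<zeta> = fm_val U \<zeta> a'" using a' \<zeta>(1) by (simp add: realizes_iff)
    moreover have "fm_val U (map_fm id id id id \<xi>) b' = fm_val U \<zeta> a'"
      unfolding \<zeta>(2)
    proof (rule val[rule_format])
      show "id d = case_sum a' id (?\<eta>' d)" if "d \<in> params \<xi>" for d using par[OF that] by auto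
    qed simp
    ultimately show "fm_val U \<xi> b' = q \<xi>" using map_fm_id[of \<xi>] by simp
  qed (use bU in simp)
  \<comment> \<open>Transfer back to \<open>(a, b)\<close>: \<open>\<sigma>1\<close> matches
    \<open>b\<close> with \<open>b'\<close>, then \<open>\<sigma>2\<close> matches the image of
    \<open>a\<close> with \<open>a'\<close> while fixing \<open>b'\<close>; \<tau> inverts the
    composition.\<close>
  obtain \<sigma>1 where \<sigma>1: "\<sigma>1 \<in> Aut L U A" "\<And>y. y \<in> Y \<Longrightarrow> \<sigma>1 (b y) = b' y"
    using realizations_conjugate[OF Y A(2,3) b b'A] by blast
  have "\<sigma>1 ` (A \<union> b ` Y) = ?D"
    unfolding image_Un image_Aut[OF \<sigma>1(1) order_refl] image_image using \<sigma>1(2) by auto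
  moreover have "\<sigma>1 \<in> Aut L U (universe M)" using \<sigma>1(1) Aut_mono[OF A(1)] by blast
  moreover have "A \<union> b ` Y \<subseteq> universe U" using A bU by auto
  ultimately have "realizes L U X ?D (\<sigma>1 \<circ> a) p" using realizes_Aut[OF inv _ _ a] by metis
  from realizations_conjugate[OF X D this a']
  obtain \<sigma>2 where \<sigma>2: "\<sigma>2 \<in> Aut L U ?D" "\<And>x. x \<in> X \<Longrightarrow> \<sigma>2 (\<sigma>1 (a x)) = a' x" by (metis comp_apply)
  have \<sigma>2A: "\<sigma>2 \<in> Aut L U A" using \<sigma>2(1) Aut_mono[of A ?D L U] by blast
  obtain \<tau> where \<tau>: "\<tau> \<in> Aut L U A" "\<And>x. x \<in> universe U \<Longrightarrow> \<tau> ((\<sigma>2 \<circ> \<sigma>1) x) = x"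
    using Aut_inv[OF struct Aut_comp[OF \<sigma>2A \<sigma>1(1)] A(2)] by metis
  have \<tau>M: "\<tau> \<in> Aut L U (universe M)" using \<tau>(1) Aut_mono[OF A(1)] by blast
  have \<tau>a: "\<tau> (a' x) = a x" if "x \<in> X" for x
    using \<tau>(2)[of "a x"] \<sigma>2(2)[OF that] aU that by (auto simp: Pi_iff)
  have \<tau>b: "\<tau> (b' y) = b y" if "y \<in> Y" for y
  proof -
    have "b y \<in> universe U" using bU(1) that by auto
    moreover have "\<sigma>2 (b' y) = b' y" using Aut_fixes[OF \<sigma>2(1)] that by blast
    ultimately show ?thesis using \<tau>(2)[of "b y"] \<sigma>1(2)[OF that] by (metis comp_apply)
  qed
  have "A \<union> a' ` X \<subseteq> universe U" using A aU by auto
  from realizes_Aut[OF q \<tau>M this claim]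
  have "realizes L U Y (\<tau> ` (A \<union> a' ` X)) (\<tau> \<circ> b') q" .
  moreover have "\<tau> ` (A \<union> a' ` X) = A \<union> a ` X"
    unfolding image_Un image_Aut[OF \<tau>(1) order_refl] image_image using \<tau>a by auto
  ultimately show ?thesis using realizes_cong[of Y "\<tau> \<circ> b'" b L U] \<tau>b by simp
qed

end

lemma not_tendsto_subseq:
  fixes f :: "nat \<Rightarrow> real"
  assumes "\<not> f \<longlonglongrightarrow> l"
  shows "\<exists>\<epsilon>>0. \<exists>h :: nat \<Rightarrow> nat. strict_mono h \<and> (\<forall>i. \<epsilon> \<le> \<bar>f (h i) - l\<bar>)"
proof -
  obtain \<epsilon> where \<epsilon>: "\<epsilon> > 0" "\<And>n. \<exists>i\<ge>n. \<not> dist (f i) l < \<epsilon>"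
    using assms unfolding lim_sequentially by metis
  have "infinite {i. \<not> dist (f i) l < \<epsilon>}"
    unfolding infinite_nat_iff_unbounded_le using \<epsilon>(2) by auto
  then obtain h where h: "strict_mono (h :: nat \<Rightarrow> nat)" "\<And>i. h i \<in> {i. \<not> dist (f i) l < \<epsilon>}"
    using infinite_enumerate by blast
  have "\<epsilon> \<le> \<bar>f (h i) - l\<bar>" for i using h(2)[of i] by (auto simp: dist_real_def)
  then show ?thesis using \<epsilon>(1) h(1) by blast
qed

text \<open>The indices of the \<open>m\<close>-th block, enumerated by \<open>k\<close>, increase,
  so restricting a Morley sequence to a block leaves it Morley.\<close>

lemma strict_mono_prod_encode: "strict_mono (\<lambda>k. prod_encode (m, k))"
  unfolding strict_mono_Suc_iff by (simp add: prod_encode_def)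

section \<open>The product of two generically stable types\<close>

text \<open>Here \<open>s\<close> stands for the Morley product. Its realizations over small sets
  are described by \<open>s_iff\<close> inside \<open>U\<close>, so the convergence argument does
  not refer to the larger monster model.\<close>

locale stable_product = monster_over L \<kappa> U V M
  for L :: "('f, 'r) language" and \<kappa> :: "'k rel" and U :: "('f, 'r, 'a) mstruct" and V :: "'v itself" and M +
  fixes X Y :: "'v set" and p q s :: "('f, 'r, 'a, 'v) fm \<Rightarrow> real"
  assumes X: "|X| <o \<kappa>" and Y: "|Y| <o \<kappa>" and disjoint: "X \<inter> Y = {}"
    and p: "generically_stable L U M X p" and q: "generically_stable L U M Y q"
    and s: "invariant_type L U M (X \<union> Y) s"
    and s_iff: "\<And>A e. universe M \<subseteq> A \<Longrightarrow> A \<subseteq> universe U \<Longrightarrow> |A| <o \<kappa> \<Longrightarrow>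
      realizes L U (X \<union> Y) A e s \<longleftrightarrow> realizes L U Y A e q \<and> realizes L U X (A \<union> e ` Y) e p"
begin

lemma p_inv: "invariant_type L U M X p" and q_inv: "invariant_type L U M Y q"
  and p_types: "p \<in> types L U X (universe U)" and q_types: "q \<in> types L U Y (universe U)"
  using p q by (auto simp: generically_stable_def invariant_type_def)

text \<open>Row \<open>i\<close> consists of a Morley sequence \<open>B i\<close> in
  \<open>q\<close> over all earlier rows, followed by \<open>a i\<close> realizing \<open>p\<close>
  over the earlier rows and all of \<open>B i\<close>. This is the order of choice in the product,
  so any selection of one entry \<open>B i (l i)\<close> per row yields a Morley sequence in
  \<open>s\<close>.\<close>

lemma morley_array:
  shows "\<exists>(B :: nat \<Rightarrow> nat \<Rightarrow> 'v \<Rightarrow> 'a) a. morley_over (universe M) X p a \<and>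
    (\<forall>i. morley_over (universe M) Y q (B i)) \<and>
    (\<forall>l. morley_over (universe M) (X \<union> Y) s (\<lambda>i. override_on (B i (l i)) (a i) X))"
proof -
  let ?J = "((UNIV :: nat set) \<times> Y) <+> X"
  \<comment> \<open>One row is coded as a single tuple: \<open>Inl (k, y)\<close> is the coordinate
    \<open>y\<close> of the \<open>k\<close>-th entry, and \<open>Inr\<close> gives the coordinates
    of \<open>a i\<close>.\<close>
  define Bx :: "(nat \<times> 'v + 'v \<Rightarrow> 'a) \<Rightarrow> nat \<Rightarrow> 'v \<Rightarrow> 'a" where "Bx x = (\<lambda>k y. x (Inl (k, y)))" for x
  define Q where "Q A x \<longleftrightarrow> morley_over A Y q (Bx x) \<and>
    realizes L U X (A \<union> (\<Union>k. Bx x k ` Y)) (x \<circ> Inr) p" for A x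
  have ex: "\<exists>x\<in>?J \<rightarrow> universe U. Q A x" if A: "A \<subseteq> universe U" "|A| <o \<kappa>" for A
  proof -
    obtain b where b: "morley_over A Y q b" using morley_exists[OF q_types Y A] .
    let ?A = "A \<union> (\<Union>k. b k ` Y)"
    have A': "?A \<subseteq> universe U" "|?A| <o \<kappa>"
      using A morley_in[OF b] by (auto intro!: small_Un small_UN_image Y)
    obtain c where c: "realizes L U X ?A c p" using realization_exists[OF p_types X A'] .
    let ?x = "case_sum (case_prod b) c"
    have "Bx ?x = b" "?x \<circ> Inr = c" by (auto simp: Bx_def fun_eq_iff)
    then have "Q A ?x" using b c by (simp add: Q_def)
    moreover have "?x \<in> ?J \<rightarrow> universe U"
      using morley_in[OF b] c by (auto simp: realizes_iff Pi_iff)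
    ultimately show ?thesis by blast
  qed
  have J: "|?J| <o \<kappa>" by (intro small_Plus small_nat_Times X Y)
  have "\<exists>x :: nat \<Rightarrow> nat \<times> 'v + 'v \<Rightarrow> 'a.
      \<forall>i. x i \<in> ?J \<rightarrow> universe U \<and> Q (universe M \<union> (\<Union>j<i. x j ` ?J)) (x i)"
  proof (rule tower[of ?J Q "universe M", OF ex J M M_small])
    fix x :: "nat \<Rightarrow> nat \<times> 'v + 'v \<Rightarrow> 'a"
    assume "\<And>i. x i \<in> ?J \<rightarrow> universe U" "\<And>i. Q (universe M \<union> (\<Union>j<i. x j ` ?J)) (x i)"
    then show ?thesis by (intro exI[of _ x] allI conjI)
  qed
  then obtain x :: "nat \<Rightarrow> nat \<times> 'v + 'v \<Rightarrow> 'a"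
    where x': "\<forall>i. x i \<in> ?J \<rightarrow> universe U \<and> Q (universe M \<union> (\<Union>j<i. x j ` ?J)) (x i)" by (rule exE)
  have x: "x i \<in> ?J \<rightarrow> universe U" "Q (universe M \<union> (\<Union>j<i. x j ` ?J)) (x i)" for i
    using x'[rule_format, of i] by simp_all
  define B where "B i = Bx (x i)" for i
  define a where "a i = x i \<circ> Inr" for i
  let ?S = "\<lambda>i. universe M \<union> (\<Union>j<i. x j ` ?J)"
  have Bm: "morley_over (?S i) Y q (B i)"
    and ar: "realizes L U X (?S i \<union> (\<Union>k. B i k ` Y)) (a i) p" for i
    using x(2)[of i] by (auto simp: Q_def B_def a_def)
  have xJ: "B j k y \<in> x j ` ?J" if "y \<in> Y" for j k y
    unfolding B_def Bx_def using that by (intro imageI) auto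
  have xJ': "a j v \<in> x j ` ?J" if "v \<in> X" for j v
    unfolding a_def comp_def using that by (intro imageI) auto
  have aJ: "a j ` X \<subseteq> x j ` ?J" for j using xJ' by (rule image_subsetI)
  have xU: "x j ` ?J \<subseteq> universe U" for j using x(1)[of j] by (rule funcset_image)
  show ?thesis
  proof (intro exI[of _ B] exI[of _ a] conjI allI)
    show "morley_over (universe M) X p a"
      unfolding morley_over_def
    proof
      fix i
      have "universe M \<union> (\<Union>j<i. a j ` X) \<subseteq> ?S i \<union> (\<Union>k. B i k ` Y)"
        using aJ by (intro le_supI1 Un_mono UN_mono order_refl)
      then show "realizes L U X (universe M \<union> (\<Union>j<i. a j ` X)) (a i) p"
        using ar realizes_mono by metis
    qed
    show "morley_over (universe M) Y q (B i)" for i using Bm by (rule morley_mono) auto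
    fix l :: "nat \<Rightarrow> nat"
    let ?e = "\<lambda>i. override_on (B i (l i)) (a i) X"
    show "morley_over (universe M) (X \<union> Y) s ?e"
      unfolding morley_over_def
    proof
      fix i
      let ?A = "universe M \<union> (\<Union>j<i. ?e j ` (X \<union> Y))"
      have "?e j v \<in> x j ` ?J" if "v \<in> X \<union> Y" for j v
        using that xJ[of v j "l j"] xJ'[of v j] by (cases "v \<in> X") auto
      then have e: "?e j ` (X \<union> Y) \<subseteq> x j ` ?J" for j by (rule image_subsetI)
      have AS: "?A \<subseteq> ?S i" by (intro Un_mono UN_mono order_refl e)
      also have "?S i \<subseteq> universe U" by (intro Un_least UN_least M xU)
      finally have A: "?A \<subseteq> universe U" .
      have "|?A| <o \<kappa>" by (intro small_Un M_small small_UN_image X Y)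
      moreover have "realizes L U Y ?A (?e i) q"
      proof -
        have "realizes L U Y ?A (B i (l i)) q" using morley_overD[OF Bm] AS by (rule realizes_mono)
        moreover have "realizes L U Y ?A (?e i) q = realizes L U Y ?A (B i (l i)) q"
          using disjoint by (intro realizes_cong) (auto simp: override_on_def)
        ultimately show ?thesis by (simp only:)
      qed
      moreover have "realizes L U X (?A \<union> ?e i ` Y) (?e i) p"
      proof -
        have "?e i ` Y = B i (l i) ` Y"
          using disjoint by (intro image_cong) (auto simp: override_on_def)
        also have "\<dots> \<subseteq> (\<Union>k. B i k ` Y)" by (rule UN_upper) simp
        finally have "realizes L U X (?A \<union> ?e i ` Y) (a i) p"
          by (intro realizes_mono[OF ar] Un_mono AS)
        moreover have "realizes L U X (?A \<union> ?e i ` Y) (?e i) p = realizes L U X (?A \<union> ?e i ` Y) (a i) p"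
          by (intro realizes_cong) simp
        ultimately show ?thesis by (simp only:)
      qed
      ultimately show "realizes L U (X \<union> Y) ?A (?e i) s" using s_iff[of ?A "?e i"] A by simp
    qed
  qed
qed

text \<open>Here \<open>b\<close> is chosen after \<open>a\<close>, opposite to the definition of
  the product. As \<open>q\<close> is generically stable, commutation restores the required order;
  invariance of \<open>s\<close> then removes \<tau> from the parameters.\<close>

lemma product_value:
  assumes \<phi>: "\<phi> \<in> formulas L (X \<union> Y) (universe U)" and \<tau>: "\<tau> \<in> Aut L U (universe M)"
    and a: "realizes L U X (universe M \<union> \<tau> ` params \<phi>) a p"
    and b: "realizes L U Y (universe M \<union> \<tau> ` params \<phi> \<union> a ` X) b q"
  shows "fm_val U (map_fm id id \<tau> id \<phi>) (override_on b a X) = s \<phi>"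
proof -
  let ?A = "universe M \<union> \<tau> ` params \<phi>" and ?e = "override_on b a X"
  have "|?A| <o \<kappa>" by (intro small_Un M_small small_finite finite_imageI finite_params)
  moreover have "?A \<subseteq> universe U"
    using M \<phi> Aut_image[OF \<tau>, of "params \<phi>"] by (auto simp: formulas_def)
  ultimately have A: "universe M \<subseteq> ?A" "?A \<subseteq> universe U" "|?A| <o \<kappa>" by auto
  have "realizes L U Y ?A b q" using b by (rule realizes_mono) auto
  moreover have "realizes L U X (?A \<union> b ` Y) a p"
    using generically_stable_commute[OF Y X q p_inv A a b] .
  moreover have "?e ` Y = b ` Y" using disjoint by (intro image_cong) (auto simp: override_on_def)
  moreover have "realizes L U Y ?A ?e q = realizes L U Y ?A b q"
    using disjoint by (intro realizes_cong) (auto simp: override_on_def)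
  moreover have "realizes L U X (?A \<union> b ` Y) ?e p = realizes L U X (?A \<union> b ` Y) a p"
    by (intro realizes_cong) auto
  ultimately have "realizes L U (X \<union> Y) ?A ?e s" using s_iff[OF A, of ?e] by simp
  moreover have "map_fm id id \<tau> id \<phi> \<in> formulas L (X \<union> Y) ?A"
    by (rule map_formulas[OF \<phi>]) auto
  ultimately have "fm_val U (map_fm id id \<tau> id \<phi>) ?e = s (map_fm id id \<tau> id \<phi>)"
    by (simp add: realizes_iff)
  also have "\<dots> = s \<phi>" using s \<phi> \<tau> by (simp add: invariant_type_def Aut_def)
  finally show ?thesis .
qed

lemma no_bad_sequence:
  assumes e: "morley_over (universe M) (X \<union> Y) s e" and \<phi>: "\<phi> \<in> formulas L (X \<union> Y) (universe U)"
    and \<epsilon>: "\<epsilon> > 0" and bad: "\<And>i. \<epsilon> \<le> \<bar>fm_val U \<phi> (e i) - s \<phi>\<bar>"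
  shows False
proof -

  \<comment> \<open>Conjugates of the parameters that are bad along the array\<close>
  let ?M = "universe M" and ?P = "params \<phi>"
  \<comment> \<open>The set of bad values; being closed, it survives all the limits below.\<close>
  define K where "K = {r. \<epsilon> \<le> \<bar>r - s \<phi>\<bar>}"
  have K: "closed K" unfolding K_def by (intro closed_Collect_le continuous_intros)
  have wf: "wf_fm L \<phi>" and fv: "free_vars \<phi> \<subseteq> X \<union> Y" and P: "?P \<subseteq> universe U"
    using \<phi> by (auto simp: formulas_def)
  have XY: "|X \<union> Y| <o \<kappa>" by (intro small_Un X Y)
  obtain B a0 where a0: "morley_over ?M X p a0" and B': "\<forall>i. morley_over ?M Y q (B i)"
    and Ba': "\<forall>l. morley_over ?M (X \<union> Y) s (\<lambda>i. override_on (B i (l i)) (a0 i) X)"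
    using morley_array by (elim exE conjE)
  note B = B'[rule_format] and Ba = Ba'[rule_format]
  \<comment> \<open>\<open>i\<close> belongs to the block \<open>fst (prod_decode i)\<close>.\<close>
  define sel where "sel l i = (let m = fst (prod_decode i) in if m < length l then l ! m else 0)"
    for l :: "nat list" and i
  \<comment> \<open>For each list \<open>l\<close> both \<open>e\<close> and the sequence selected
    from the array are Morley in \<open>s\<close>, hence conjugate over \<open>M\<close>;
    \<open>\<sigma> l\<close> takes the parameters of \<phi> to the conjugate
    \<open>c\<^sub>l\<close>. Blocks beyond the length of \<open>l\<close> select the entry 0 by
    default.\<close>
  have "\<exists>\<sigma>\<in>Aut L U ?M. \<forall>i. \<forall>x\<in>X \<union> Y. \<sigma> (e i x) = override_on (B i (sel l i)) (a0 i) X x" for l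
    using morley_conjugate[OF XY s e Ba[of "sel l"]] by metis
  then obtain \<sigma> where \<sigma>: "\<And>l. \<sigma> l \<in> Aut L U ?M"
    and \<sigma>e: "\<And>l i x. x \<in> X \<union> Y \<Longrightarrow> \<sigma> l (e i x) = override_on (B i (sel l i)) (a0 i) X x"
    by metis
  have badB: "fm_val U (map_fm id id (\<sigma> l) id \<phi>) (override_on (B i (sel l i)) (a0 i) X) \<in> K" for l i
  proof -
    have "fm_val U (map_fm id id (\<sigma> l) id \<phi>) (override_on (B i (sel l i)) (a0 i) X) =
        fm_val U (map_fm id id (\<sigma> l) id \<phi>) (\<sigma> l \<circ> e i)"
      using fv \<sigma>e by (intro fm_val_cong) (auto simp: subset_iff)
    also have "\<dots> = fm_val U \<phi> (e i)" by (rule fm_val_Aut[OF struct \<sigma> \<phi> order_refl morley_in[OF e]])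
    finally show ?thesis using bad by (simp add: K_def)
  qed

  \<comment> \<open>Passing to a single realization of the first type\<close>
  let ?C = "\<Union>l. \<sigma> l ` ?P"
  let ?A1 = "?M \<union> ?C"
  \<comment> \<open>The lists prescribe only finitely many blocks each, so there are countably many
    of them; all conjugates together stay small and \<open>a\<close> can be chosen over all of
    them.\<close>
  have "countable ?C" by (intro countable_UN countable_image) (auto intro: countable_finite finite_params)
  then have A1_small: "|?A1| <o \<kappa>" by (intro small_Un M_small small_countable)
  have \<sigma>P: "\<sigma> l c \<in> universe U" if "c \<in> ?P" for l c using Aut_in[OF \<sigma>] P that by blast
  then have A1: "?A1 \<subseteq> universe U" using M by blast
  obtain a where a: "realizes L U X ?A1 a p" using realization_exists[OF p_types X A1 A1_small] .
  then have aU: "a \<in> X \<rightarrow> universe U" by (simp add: realizes_iff)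
  \<comment> \<open>The value of \<phi> at \<open>a\<close>, \<open>b\<close> and the parameters
    moved by \<open>g\<close>; thus \<open>ev g b \<in> K\<close> says that this triple is
    bad.\<close>
  define ev where "ev g b = fm_val U (map_fm id id g id \<phi>) (override_on b a X)" for g b
  \<comment> \<open>The limit inside the \<open>m\<close>-th block.\<close>
  have step1: "\<exists>b. (\<forall>k. b k \<in> Y \<rightarrow> universe U) \<and> morley_over ?M Y q b \<and>
      (\<forall>l. m < length l \<longrightarrow> ev (\<sigma> l) (b (l ! m)) \<in> K)" for m
  proof -
    let ?J = "(UNIV :: nat set) \<times> Y" and ?i = "\<lambda>k. prod_encode (m, k)"
    \<comment> \<open>Along block \<open>m\<close> the tuple that accompanies \<open>a0 i\<close> is
      the entire Morley sequence \<open>B i\<close>.\<close>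
    let ?w = "\<lambda>k'. case_prod (B (?i k'))" and ?a = "\<lambda>k'. a0 (?i k')"
    have w: "?w k' \<in> ?J \<rightarrow> universe U" for k' using morley_in[OF B] by (auto simp: Pi_iff)
    have conv: "\<forall>\<psi>\<in>formulas L X ?A1. (\<lambda>k'. fm_val U \<psi> (?a k')) \<longlonglongrightarrow> p \<psi>"
      using gs_converges[OF p morley_subseq[OF a0 strict_mono_prod_encode] formulas_mono[OF _ A1]] by blast
    obtain c where c: "c \<in> ?J \<rightarrow> universe U" and
      lim: "\<forall>(\<phi> :: ('f, 'r, 'a, 'v) fm) \<theta> K. (\<phi>, \<theta>) \<in> sforms L (X <+> ?J) ?A1 \<longrightarrow> closed K \<longrightarrow>
        (\<forall>k'. fm_val U \<phi> (case_sum (case_sum (?a k') (?w k')) id \<circ> \<theta>) \<in> K) \<longrightarrow>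
        fm_val U \<phi> (case_sum (case_sum a c) id \<circ> \<theta>) \<in> K"
      using limit_over_realization[where b = ?a and w = ?w, OF X A1 A1_small a morley_in[OF a0] conv
          small_nat_Times[OF Y] nat_Times_vars w] by (elim bexE)
    define b where "b = curry c"
    have bc: "case_prod b = c" by (simp add: b_def)
    have bU: "b k \<in> Y \<rightarrow> universe U" for k using c by (auto simp: b_def Pi_iff)
    \<comment> \<open>All rows have the same type over \<open>M\<close>, being Morley sequences in
      \<open>q\<close>; a singleton is closed, so the limit row has this type as well.\<close>
    have "eqtp ?J ?M (case_prod (B 0)) (case_prod b)"
    proof (rule eqtpI)
      fix \<psi> :: "('f, 'r, 'a, 'v) fm" and \<theta> assume \<psi>: "(\<psi>, \<theta>) \<in> sforms L ?J ?M"
      let ?\<theta> = "map_sum Inr id \<circ> \<theta> :: 'v \<Rightarrow> ('v + nat \<times> 'v) + 'a"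
      have \<psi>': "(\<psi>, ?\<theta>) \<in> sforms L (X <+> ?J) ?A1"
        using \<psi> by (fastforce simp: sforms_def)
      have eq: "case_sum (case_sum x w) id \<circ> ?\<theta> = case_sum w id \<circ> \<theta>" for x :: "'v \<Rightarrow> 'a" and w
        by (auto simp: fun_eq_iff split: sum.split)
      have "fm_val U \<psi> (case_sum (?w k') id \<circ> \<theta>) = fm_val U \<psi> (case_sum (case_prod (B 0)) id \<circ> \<theta>)" for k'
      proof -
        obtain \<rho> where "\<rho> \<in> Aut L U ?M" "\<And>k y. y \<in> Y \<Longrightarrow> \<rho> (B (?i k') k y) = B 0 k y"
          using morley_conjugate[OF Y q_inv B B] by metis
        then have "eqtp ?J ?M (?w k') (case_prod (B 0))"
          using w by (intro eqtp_Aut[OF _ M]) auto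
        then show ?thesis using eqtpD \<psi> by blast
      qed
      then have "fm_val U \<psi> (case_sum (case_sum a c) id \<circ> ?\<theta>) \<in> {fm_val U \<psi> (case_sum (case_prod (B 0)) id \<circ> \<theta>)}"
        by (intro lim[rule_format, OF \<psi>' closed_singleton]) (simp only: eq singleton_iff)
      then show "fm_val U \<psi> (case_sum (case_prod (B 0)) id \<circ> \<theta>) = fm_val U \<psi> (case_sum (case_prod b) id \<circ> \<theta>)"
        by (simp only: eq bc singleton_iff)
    qed
    then have "morley_over ?M Y q b" by (rule morley_eqtp[where a = "B 0" and b = b, OF Y q_inv B bU])
    moreover have "ev (\<sigma> l) (b (l ! m)) \<in> K" if l: "m < length l" for l
    proof -
      let ?\<eta> = "\<lambda>v. if v \<in> X then Inl (Inl v) else Inl (Inr (l ! m, v))" and ?\<eta>' = "\<lambda>c. Inr (\<sigma> l c)"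
      have \<eta>: "\<forall>v\<in>free_vars \<phi>. ?\<eta> v \<in> (X <+> ?J) <+> ?A1" using fv by auto
      have \<eta>': "\<forall>c\<in>?P. ?\<eta>' c \<in> (X <+> ?J) <+> ?A1" by auto
      obtain \<psi> :: "('f, 'r, 'a, 'v) fm" and \<theta> where \<psi>: "(\<psi>, \<theta>) \<in> sforms L (X <+> ?J) ?A1"
        and val: "\<forall>(N :: ('f, 'r, 'a) mstruct) s b g. (\<forall>v\<in>free_vars \<phi>. b v = case_sum s id (?\<eta> v)) \<longrightarrow>
          (\<forall>c\<in>?P. g c = case_sum s id (?\<eta>' c)) \<longrightarrow>
          fm_val N (map_fm id id g id \<phi>) b = fm_val N \<psi> (case_sum s id \<circ> \<theta>)"
        using sform_assign[where \<eta> = ?\<eta> and \<eta>' = ?\<eta>', OF infinite_vars wf \<eta> \<eta>'] by (elim exE conjE)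
      have "fm_val U \<psi> (case_sum (case_sum (?a k') (?w k')) id \<circ> \<theta>) \<in> K" for k'
      proof -
        \<comment> \<open>Throughout block \<open>m\<close> the selected entry is the one at
          \<open>l ! m\<close>, so the same formula is bad along the whole block.\<close>
        have "sel l (?i k') = l ! m" using l by (simp add: sel_def)
        then have "fm_val U (map_fm id id (\<sigma> l) id \<phi>) (override_on (B (?i k') (l ! m)) (?a k') X) \<in> K"
          using badB[of l "?i k'"] by simp
        moreover have "fm_val U (map_fm id id (\<sigma> l) id \<phi>) (override_on (B (?i k') (l ! m)) (?a k') X) =
            fm_val U \<psi> (case_sum (case_sum (?a k') (?w k')) id \<circ> \<theta>)"
          by (rule val[rule_format]) (auto simp: override_on_def)
        ultimately show ?thesis by simp
      qed
      then have "fm_val U \<psi> (case_sum (case_sum a c) id \<circ> \<theta>) \<in> K" by (rule lim[rule_format, OF \<psi> K])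
      moreover have "ev (\<sigma> l) (b (l ! m)) = fm_val U \<psi> (case_sum (case_sum a c) id \<circ> \<theta>)"
        unfolding ev_def by (rule val[rule_format]) (auto simp: override_on_def b_def)
      ultimately show ?thesis by simp
    qed
    ultimately show ?thesis using bU by blast
  qed
  obtain b where bU: "\<And>m k. b m k \<in> Y \<rightarrow> universe U" and b: "\<And>m. morley_over ?M Y q (b m)"
    and evb: "\<And>m l. m < length l \<Longrightarrow> ev (\<sigma> l) (b m (l ! m)) \<in> K"
    using step1 by metis

  \<comment> \<open>Replacing the sequences of the blocks by one Morley sequence\<close>
  let ?A2 = "?M \<union> a ` X \<union> (\<Union>m. case_prod (b m) ` (UNIV \<times> Y))"
  have A2: "?A2 \<subseteq> universe U" using M aU bU by (auto simp: Pi_iff)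
  have A2_small: "|?A2| <o \<kappa>"
    by (intro small_Un M_small small_image X small_UN_image small_nat_Times Y)
  \<comment> \<open>The sequence that is to replace the \<open>b m k\<close>; it is Morley over
    \<open>M\<close>, \<open>a\<close> and all of them.\<close>
  obtain y where y: "morley_over ?A2 Y q y" using morley_exists[OF q_types Y A2 A2_small] .
  have yU: "y j \<in> Y \<rightarrow> universe U" for j using morley_in[OF y] .
  let ?MA = "?M \<union> a ` X"
  have MA: "?MA \<subseteq> universe U" "|?MA| <o \<kappa>" using M aU by (auto intro!: small_Un M_small small_image X)
  \<comment> \<open>The moved parameters have the same type over \<open>M\<close> and
    \<open>a\<close> as those moved by \<open>\<sigma> []\<close>, so they are conjugates of the
    original ones that remain independent of \<open>a\<close>. The list \<open>[]\<close> is just a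
    reference point.\<close>
  define good where "good g \<longleftrightarrow> g \<in> ?P \<rightarrow> universe U \<and> eqtp ?P ?MA (\<sigma> []) g" for g
  have P_small: "|?P| <o \<kappa>" "|?P| \<le>o |UNIV :: 'v set|"
    using finite_params small_finite finite_vars_card by blast+
  \<comment> \<open>Having a prescribed type over a fixed set is a closed condition.\<close>
  have good_lim: "good g"
    if g: "g \<in> ?P \<rightarrow> universe U" and gk: "\<And>k. good (gk k)" and A: "?MA \<subseteq> A"
      and lim: "\<And>(\<psi> :: ('f, 'r, 'a, 'v) fm) \<theta> K. (\<psi>, \<theta>) \<in> sforms L ?P A \<Longrightarrow> closed K \<Longrightarrow>
        (\<And>k :: nat. fm_val U \<psi> (case_sum (gk k) id \<circ> \<theta>) \<in> K) \<Longrightarrow> fm_val U \<psi> (case_sum g id \<circ> \<theta>) \<in> K"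
    for g gk A
    unfolding good_def
  proof (intro conjI g eqtpI)
    fix \<psi> :: "('f, 'r, 'a, 'v) fm" and \<theta> assume \<psi>: "(\<psi>, \<theta>) \<in> sforms L ?P ?MA"
    then have "fm_val U \<psi> (case_sum (gk k) id \<circ> \<theta>) = fm_val U \<psi> (case_sum (\<sigma> []) id \<circ> \<theta>)" for k
      using gk[of k] eqtpD[of ?P ?MA "\<sigma> []" "gk k" \<psi> \<theta>] by (simp add: good_def)
    moreover have "(\<psi>, \<theta>) \<in> sforms L ?P A" using sforms_mono[OF \<psi> A] .
    ultimately have "fm_val U \<psi> (case_sum g id \<circ> \<theta>) \<in> {fm_val U \<psi> (case_sum (\<sigma> []) id \<circ> \<theta>)}"
      by (intro lim closed_singleton) auto
    then show "fm_val U \<psi> (case_sum (\<sigma> []) id \<circ> \<theta>) = fm_val U \<psi> (case_sum g id \<circ> \<theta>)" by simp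
  qed
  have good_\<sigma>: "good (\<sigma> l)" for l
  proof -
    obtain \<tau> where \<tau>: "\<tau> \<in> Aut L U ?M" "\<And>x. x \<in> universe U \<Longrightarrow> \<tau> (\<sigma> [] x) = x"
      using Aut_inv[OF struct \<sigma> M] by metis
    \<comment> \<open>This takes the reference parameters to those of \<open>l\<close> over
      \<open>M\<close> but may move \<open>a\<close>. Both \<open>a\<close> and its image realize
      \<open>p\<close> over the new parameters, so \<open>\<rho>'\<close> brings \<open>a\<close>
      back.\<close>
    let ?\<rho> = "\<sigma> l \<circ> \<tau>"
    have \<rho>: "?\<rho> \<in> Aut L U ?M" using Aut_comp[OF \<sigma> \<tau>(1)] .
    have \<rho>\<sigma>: "?\<rho> (\<sigma> [] c) = \<sigma> l c" if "c \<in> ?P" for c using \<tau>(2)[of c] P that by auto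
    let ?A = "?M \<union> \<sigma> [] ` ?P" and ?B = "?M \<union> \<sigma> l ` ?P"
    have sub: "?A \<subseteq> ?A1" "?B \<subseteq> ?A1" by auto
    have "?\<rho> ` ?A = ?B"
      unfolding image_Un image_Aut[OF \<rho> order_refl] image_image using \<rho>\<sigma> by auto
    then have 1: "realizes L U X ?B (?\<rho> \<circ> a) p"
      using realizes_Aut[OF p_inv \<rho> order_trans[OF sub(1) A1] realizes_mono[OF a sub(1)]] by (simp only:)
    have 2: "realizes L U X ?B a p" using realizes_mono[OF a sub(2)] .
    have B': "?B \<subseteq> universe U" "|?B| <o \<kappa>"
      using sub(2) A1 by (blast, intro small_Un M_small small_finite finite_imageI finite_params)
    obtain \<rho>' where \<rho>': "\<rho>' \<in> Aut L U ?B" "\<And>x. x \<in> X \<Longrightarrow> \<rho>' (?\<rho> (a x)) = a x"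
      using realizations_conjugate[OF X B' 1 2] by (metis comp_apply)
    have "\<rho>' \<circ> ?\<rho> \<in> Aut L U ?M"
      using Aut_comp[OF _ \<rho>] \<rho>'(1) Aut_mono[of ?M ?B L U] by blast
    then have "\<rho>' \<circ> ?\<rho> \<in> Aut L U ?MA" using \<rho>'(2) by (auto simp: Aut_def)
    moreover have "(\<rho>' \<circ> ?\<rho>) (\<sigma> [] c) = \<sigma> l c" if "c \<in> ?P" for c
      using \<rho>\<sigma>[OF that] Aut_fixes[OF \<rho>'(1), of "\<sigma> l c"] that by simp
    moreover have "\<sigma> [] \<in> ?P \<rightarrow> universe U" using \<sigma>P by auto
    ultimately have "eqtp ?P ?MA (\<sigma> []) (\<sigma> l)" by (intro eqtp_Aut[OF _ MA(1)]) auto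
    then show ?thesis using \<sigma>P by (auto simp: good_def)
  qed
  \<comment> \<open>The limit \<open>k \<rightarrow> \<infinity>\<close> in block \<open>m\<close> turns the varying \<open>b m k\<close> into \<open>y m\<close>.\<close>
  have claim: "\<exists>g. good g \<and> (\<forall>j<m. ev g (y j) \<in> K) \<and> (\<forall>j. m \<le> j \<and> j < n \<longrightarrow> ev g (b j (l ! j)) \<in> K)"
    if "m \<le> n" "length l = n" for m n l
    using that
  proof (induction m arbitrary: l)
    case 0
    then show ?case using good_\<sigma>[of l] evb[of _ l] by (intro exI[of _ "\<sigma> l"]) auto
  next
    case (Suc m)
    \<comment> \<open>The induction hypothesis is used with every value \<open>k\<close> at place
      \<open>m\<close> of the list; the limit over \<open>k\<close> then replaces block
      \<open>m\<close>.\<close>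
    have "\<exists>g. good g \<and> (\<forall>j<m. ev g (y j) \<in> K) \<and>
        (\<forall>j. m \<le> j \<and> j < n \<longrightarrow> ev g (b j (l[m := k] ! j)) \<in> K)" for k
      using Suc.prems by (intro Suc.IH) auto
    then obtain gk where gk: "\<And>k. good (gk k)" "\<And>k j. j < m \<Longrightarrow> ev (gk k) (y j) \<in> K"
      "\<And>k j. m \<le> j \<Longrightarrow> j < n \<Longrightarrow> ev (gk k) (b j (l[m := k] ! j)) \<in> K"
      by metis
    let ?A = "?A2 \<union> (\<Union>j<m. y j ` Y)"
    have A: "?A \<subseteq> universe U" using A2 yU by (auto simp: Pi_iff)
    have A_small: "|?A| <o \<kappa>" by (rule small_Un[OF A2_small small_UN_image[OF Y]])
    have ym: "realizes L U Y ?A (y m) q" using y by (simp add: morley_over_def)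
    have gkU: "gk k \<in> ?P \<rightarrow> universe U" for k using gk(1) by (simp add: good_def)
    have conv: "\<forall>\<psi>\<in>formulas L Y ?A. (\<lambda>k. fm_val U \<psi> (b m k)) \<longlonglongrightarrow> q \<psi>"
      using gs_converges[OF q b formulas_mono[OF _ A]] by blast
    obtain g where g: "g \<in> ?P \<rightarrow> universe U" and
      lim: "\<forall>(\<psi> :: ('f, 'r, 'a, 'v) fm) \<theta> K. (\<psi>, \<theta>) \<in> sforms L (Y <+> ?P) ?A \<longrightarrow> closed K \<longrightarrow>
        (\<forall>k. fm_val U \<psi> (case_sum (case_sum (b m k) (gk k)) id \<circ> \<theta>) \<in> K) \<longrightarrow>
        fm_val U \<psi> (case_sum (case_sum (y m) g) id \<circ> \<theta>) \<in> K"
      using limit_over_realization[where b = "b m" and w = gk, OF Y A A_small ym bU conv P_small gkU]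
      by (elim bexE)
    have "good g"
    proof (rule good_lim[OF g gk(1), of ?A])
      fix \<psi> :: "('f, 'r, 'a, 'v) fm" and \<theta> K
      assume \<psi>: "(\<psi>, \<theta>) \<in> sforms L ?P ?A" "closed K"
        "\<And>k. fm_val U \<psi> (case_sum (gk k) id \<circ> \<theta>) \<in> K"
      let ?\<theta> = "map_sum Inr id \<circ> \<theta> :: 'v \<Rightarrow> ('v + 'a) + 'a"
      have eq: "case_sum (case_sum x w) id \<circ> ?\<theta> = case_sum w id \<circ> \<theta>" for x :: "'v \<Rightarrow> 'a" and w
        by (auto simp: fun_eq_iff split: sum.split)
      have "(\<psi>, ?\<theta>) \<in> sforms L (Y <+> ?P) ?A" using \<psi>(1) by (fastforce simp: sforms_def)
      from lim[rule_format, OF this \<psi>(2)] show "fm_val U \<psi> (case_sum g id \<circ> \<theta>) \<in> K"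
        unfolding eq using \<psi>(3) by blast
    qed auto
    \<comment> \<open>For the blocks other than \<open>m\<close> the second argument is fixed: it is
      an earlier \<open>y j\<close> or a later \<open>b j (l ! j)\<close>, and both lie in the base
      of the limit.\<close>
    moreover have ev_lim: "ev g d \<in> K" if d: "d ` Y \<subseteq> ?A" "\<And>k. ev (gk k) d \<in> K" for d
    proof -
      let ?\<eta> = "\<lambda>v. if v \<in> X then Inr (a v) else Inr (d v)" and ?\<eta>' = "\<lambda>c. Inl (Inr c)"
      have \<eta>: "\<forall>v\<in>free_vars \<phi>. ?\<eta> v \<in> (Y <+> ?P) <+> ?A" using fv d(1) by auto
      have \<eta>': "\<forall>c\<in>?P. ?\<eta>' c \<in> (Y <+> ?P) <+> ?A" by auto
      obtain \<psi> :: "('f, 'r, 'a, 'v) fm" and \<theta> where \<psi>: "(\<psi>, \<theta>) \<in> sforms L (Y <+> ?P) ?A"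
        and val: "\<forall>(N :: ('f, 'r, 'a) mstruct) s b g. (\<forall>v\<in>free_vars \<phi>. b v = case_sum s id (?\<eta> v)) \<longrightarrow>
          (\<forall>c\<in>?P. g c = case_sum s id (?\<eta>' c)) \<longrightarrow>
          fm_val N (map_fm id id g id \<phi>) b = fm_val N \<psi> (case_sum s id \<circ> \<theta>)"
        using sform_assign[where \<eta> = ?\<eta> and \<eta>' = ?\<eta>', OF infinite_vars wf \<eta> \<eta>'] by (elim exE conjE)
      have eq: "ev h d = fm_val U \<psi> (case_sum (case_sum t h) id \<circ> \<theta>)" for h t
        unfolding ev_def by (rule val[rule_format]) (auto simp: override_on_def)
      have "fm_val U \<psi> (case_sum (case_sum (b m k) (gk k)) id \<circ> \<theta>) \<in> K" for k
        using d(2)[of k] by (simp only: eq[of "gk k" "b m k"])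
      then show ?thesis unfolding eq[of g "y m"] by (rule lim[rule_format, OF \<psi> K])
    qed
    \<comment> \<open>Here the second argument itself varies with \<open>k\<close>, so it occupies
      the indices whose limit is \<open>y m\<close>.\<close>
    moreover have "ev g (y m) \<in> K"
    proof -
      let ?\<eta> = "\<lambda>v. if v \<in> X then Inr (a v) else Inl (Inl v)" and ?\<eta>' = "\<lambda>c. Inl (Inr c)"
      have \<eta>: "\<forall>v\<in>free_vars \<phi>. ?\<eta> v \<in> (Y <+> ?P) <+> ?A" using fv by auto
      have \<eta>': "\<forall>c\<in>?P. ?\<eta>' c \<in> (Y <+> ?P) <+> ?A" by auto
      obtain \<psi> :: "('f, 'r, 'a, 'v) fm" and \<theta> where \<psi>: "(\<psi>, \<theta>) \<in> sforms L (Y <+> ?P) ?A"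
        and val: "\<forall>(N :: ('f, 'r, 'a) mstruct) s b g. (\<forall>v\<in>free_vars \<phi>. b v = case_sum s id (?\<eta> v)) \<longrightarrow>
          (\<forall>c\<in>?P. g c = case_sum s id (?\<eta>' c)) \<longrightarrow>
          fm_val N (map_fm id id g id \<phi>) b = fm_val N \<psi> (case_sum s id \<circ> \<theta>)"
        using sform_assign[where \<eta> = ?\<eta> and \<eta>' = ?\<eta>', OF infinite_vars wf \<eta> \<eta>'] by (elim exE conjE)
      have eq: "ev h t = fm_val U \<psi> (case_sum (case_sum t h) id \<circ> \<theta>)" for h t
        unfolding ev_def by (rule val[rule_format]) (auto simp: override_on_def)
      have "ev (gk k) (b m k) \<in> K" for k using gk(3)[of m k] Suc.prems by simp
      then show ?thesis unfolding eq by (rule lim[rule_format, OF \<psi> K])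
    qed
    moreover have "ev g (y j) \<in> K" if "j < m" for j
      using that gk(2) by (intro ev_lim) auto
    moreover have "ev g (b j (l ! j)) \<in> K" if "Suc m \<le> j" "j < n" for j
    proof (rule ev_lim)
      show "b j (l ! j) ` Y \<subseteq> ?A" by force
      show "ev (gk k) (b j (l ! j)) \<in> K" for k using gk(3)[of j k] that by simp
    qed
    ultimately show ?case by (intro exI[of _ g]) (auto simp: less_Suc_eq)
  qed

  \<comment> \<open>The limit over all blocks and the contradiction\<close>
  have "\<exists>g. good g \<and> (\<forall>j<n. ev g (y j) \<in> K)" for n
    using claim[of n n "replicate n 0"] by auto
  then obtain gn where gn: "\<And>n. good (gn n)" "\<And>n j. j < n \<Longrightarrow> ev (gn n) (y j) \<in> K" by metis
  let ?A3 = "?MA \<union> (\<Union>j. y j ` Y)"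
  have A3: "?A3 \<subseteq> universe U" "|?A3| <o \<kappa>"
    using MA yU by (auto simp: Pi_iff intro!: small_Un small_UN_image Y)
  have gnU: "gn n \<in> ?P \<rightarrow> universe U" for n using gn(1) by (simp add: good_def)
  \<comment> \<open>Each \<open>y j\<close> is covered by all \<open>gn n\<close> with
    \<open>n > j\<close>, so a limit of these is bad for all \<open>y j\<close> at once.\<close>
  obtain g where g: "g \<in> ?P \<rightarrow> universe U"
    and lim: "\<forall>(\<psi> :: ('f, 'r, 'a, 'v) fm) \<theta> K. (\<psi>, \<theta>) \<in> sforms L ?P ?A3 \<longrightarrow> closed K \<longrightarrow>
       eventually (\<lambda>n. fm_val U \<psi> (case_sum (gn n) id \<circ> \<theta>) \<in> K) sequentially \<longrightarrow>
       fm_val U \<psi> (case_sum g id \<circ> \<theta>) \<in> K"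
    using limit_tuple[where s = gn, OF P_small A3 gnU] by (elim bexE)
  have good_g: "good g"
    by (rule good_lim[of g gn ?A3, OF g gn(1)]) (auto intro: lim[rule_format])
  have ev_g: "ev g (y j) \<in> K" for j
  proof -
    let ?\<eta> = "\<lambda>v. if v \<in> X then Inr (a v) else Inr (y j v)" and ?\<eta>' = "Inl"
    have \<eta>: "\<forall>v\<in>free_vars \<phi>. ?\<eta> v \<in> ?P <+> ?A3" using fv by auto
    have \<eta>': "\<forall>c\<in>?P. ?\<eta>' c \<in> ?P <+> ?A3" by auto
    obtain \<psi> :: "('f, 'r, 'a, 'v) fm" and \<theta> where \<psi>: "(\<psi>, \<theta>) \<in> sforms L ?P ?A3"
      and val: "\<forall>(N :: ('f, 'r, 'a) mstruct) s b g. (\<forall>v\<in>free_vars \<phi>. b v = case_sum s id (?\<eta> v)) \<longrightarrow>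
        (\<forall>c\<in>?P. g c = case_sum s id (?\<eta>' c)) \<longrightarrow>
        fm_val N (map_fm id id g id \<phi>) b = fm_val N \<psi> (case_sum s id \<circ> \<theta>)"
      using sform_assign[where \<eta> = ?\<eta> and \<eta>' = ?\<eta>', OF infinite_vars wf \<eta> \<eta>'] by (elim exE conjE)
    have eq: "ev h (y j) = fm_val U \<psi> (case_sum h id \<circ> \<theta>)" for h
      unfolding ev_def by (rule val[rule_format]) (auto simp: override_on_def)
    have "eventually (\<lambda>n. ev (gn n) (y j) \<in> K) sequentially"
      using eventually_gt_at_top[of j] by (rule eventually_mono) (rule gn(2))
    then show ?thesis unfolding eq by (rule lim[rule_format, OF \<psi> K])
  qed
  have \<sigma>0: "\<sigma> [] \<in> ?P \<rightarrow> universe U" using \<sigma>P by auto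
  \<comment> \<open>As \<open>g\<close> is good, its values are the images of the reference
    parameters under an automorphism fixing \<open>M\<close> and \<open>a\<close>; so
    \<open>a\<close> realizes \<open>p\<close> also over the values of \<open>g\<close>.\<close>
  obtain \<tau> where \<tau>: "\<tau> \<in> Aut L U ?MA" "\<And>c. c \<in> ?P \<Longrightarrow> \<tau> (\<sigma> [] c) = g c"
    using homogeneity[OF MA P_small(1) \<sigma>0 g] good_g unfolding good_def by metis
  have \<tau>M: "\<tau> \<in> Aut L U ?M" using \<tau>(1) Aut_mono[of ?M ?MA L U] by blast
  let ?\<tau> = "\<tau> \<circ> \<sigma> []"
  have \<tau>': "?\<tau> \<in> Aut L U ?M" using Aut_comp[OF \<tau>M \<sigma>] .
  let ?A = "?M \<union> ?\<tau> ` ?P"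
  have a': "realizes L U X ?A a p"
  proof -
    have sub: "?M \<union> \<sigma> [] ` ?P \<subseteq> ?A1" by auto
    have "realizes L U X (\<tau> ` (?M \<union> \<sigma> [] ` ?P)) (\<tau> \<circ> a) p"
      by (rule realizes_Aut[OF p_inv \<tau>M order_trans[OF sub A1] realizes_mono[OF a sub]])
    moreover have "\<tau> ` (?M \<union> \<sigma> [] ` ?P) = ?A"
      unfolding image_Un image_Aut[OF \<tau>M order_refl] image_comp ..
    moreover have "(\<tau> \<circ> a) x = a x" if "x \<in> X" for x using Aut_fixes[OF \<tau>(1)] that by simp
    ultimately show ?thesis using realizes_cong[of X "\<tau> \<circ> a" a L U ?A p] by simp
  qed
  have A: "?A \<union> a ` X \<subseteq> universe U" "|?A \<union> a ` X| <o \<kappa>"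
    using M aU Aut_image[OF \<tau>' P]
    by (blast, intro small_Un M_small small_finite finite_imageI finite_params small_image X)
  obtain y' where y': "realizes L U Y (?A \<union> a ` X) y' q" using realization_exists[OF q_types Y A] .
  \<comment> \<open>The formula \<xi> below is \<phi> with \<open>a\<close> and the values of
    \<open>g\<close> as parameters, a formula in \<open>Y\<close> alone. Its value in
    \<open>q\<close> is \<open>s \<phi>\<close> when computed by \<open>y'\<close>, and a limit of
    elements of \<open>K\<close> when computed along \<open>y\<close>; this puts
    \<open>s \<phi>\<close> into \<open>K\<close>.\<close>
  let ?\<eta> = "\<lambda>v. if v \<in> X then Inr (a v) else Inl v" and ?\<eta>' = "\<lambda>c. Inr (g c)"
  have \<eta>: "\<forall>v\<in>free_vars \<phi>. ?\<eta> v \<in> Y <+> (?A \<union> a ` X)" using fv by auto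
  have \<eta>': "\<forall>c\<in>?P. ?\<eta>' c \<in> Y <+> (?A \<union> a ` X)" using \<tau>(2) by force
  obtain \<psi> :: "('f, 'r, 'a, 'v) fm" and \<theta> where \<psi>: "(\<psi>, \<theta>) \<in> sforms L Y (?A \<union> a ` X)"
    and val: "\<forall>(N :: ('f, 'r, 'a) mstruct) s b g. (\<forall>v\<in>free_vars \<phi>. b v = case_sum s id (?\<eta> v)) \<longrightarrow>
      (\<forall>c\<in>?P. g c = case_sum s id (?\<eta>' c)) \<longrightarrow>
      fm_val N (map_fm id id g id \<phi>) b = fm_val N \<psi> (case_sum s id \<circ> \<theta>)"
    using sform_assign[where \<eta> = ?\<eta> and \<eta>' = ?\<eta>', OF infinite_vars wf \<eta> \<eta>'] by (elim exE conjE)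
  obtain \<xi> where \<xi>: "\<xi> \<in> formulas L Y (?A \<union> a ` X)"
    "\<And>(N :: ('f, 'r, 'a) mstruct) s. fm_val N \<xi> s = fm_val N \<psi> (case_sum s id \<circ> \<theta>)"
    using formula_of_sform'[OF \<psi>] by metis
  have eq: "ev g t = fm_val U \<xi> t" for t
    unfolding ev_def \<xi>(2) by (rule val[rule_format]) (auto simp: override_on_def)
  have "q \<xi> = fm_val U \<xi> y'" using y' \<xi>(1) by (simp add: realizes_iff)
  also have "\<dots> = ev g y'" by (rule eq[symmetric])
  also have "\<dots> = fm_val U (map_fm id id ?\<tau> id \<phi>) (override_on y' a X)"
    unfolding ev_def using map_params_cong[of \<phi> g ?\<tau>] \<tau>(2) by simp
  also have "\<dots> = s \<phi>" by (rule product_value[OF \<phi> \<tau>' a' y'])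
  finally have "q \<xi> = s \<phi>" .
  moreover have "(\<lambda>j. fm_val U \<xi> (y j)) \<longlonglongrightarrow> q \<xi>"
    by (rule gs_converges[OF q morley_mono[OF y] formulas_mono[OF \<xi>(1) A(1)]]) auto
  moreover have "fm_val U \<xi> (y j) \<in> K" for j using ev_g unfolding eq .
  ultimately have "s \<phi> \<in> K" using closed_sequentially[OF K, of "\<lambda>j. fm_val U \<xi> (y j)"] by simp
  then show False using \<epsilon> by (simp add: K_def)
qed

lemma product_converges:
  assumes "morley_over (universe M) (X \<union> Y) s e" "\<phi> \<in> formulas L (X \<union> Y) (universe U)"
  shows "(\<lambda>i. fm_val U \<phi> (e i)) \<longlonglongrightarrow> s \<phi>"
proof (rule ccontr)
  assume "\<not> ?thesis"
  then obtain \<epsilon> h where "\<epsilon> > 0" "strict_mono (h :: nat \<Rightarrow> nat)"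
    "\<And>i. \<epsilon> \<le> \<bar>fm_val U \<phi> (e (h i)) - s \<phi>\<bar>"
    using not_tendsto_subseq by metis
  then show False using no_bad_sequence[OF morley_subseq[OF assms(1)] assms(2)] by blast
qed

theorem product_generically_stable: "generically_stable L U M (X \<union> Y) s"
  unfolding generically_stable_def
proof (intro conjI s allI impI)
  fix e assume "morley_sequence L U M (X \<union> Y) s e"
  then have e: "morley_over (universe M) (X \<union> Y) s e" by (simp add: morley_over_M)
  have "s \<in> types L U (X \<union> Y) (universe U)" using s by (simp add: invariant_type_def)
  from limitin_type_space[where a = e, OF this morley_in[OF e]]
  show "limitin (type_space L U (X \<union> Y) (universe U)) (\<lambda>i. tp L U (X \<union> Y) (universe U) (e i)) s sequentially"
    using product_converges[OF e] by blast
qed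

end

section \<open>Elementary extensions\<close>

text \<open>Elementarity is given for formulas without parameters at total assignments into the
  smaller structure. Parameters are therefore turned into variables, and variables that do not occur
  free get a default value \<open>u\<close>.\<close>

lemma elem_fm_val:
  fixes \<phi> :: "('f, 'r, 'a, 'v) fm"
  assumes inf: "infinite (UNIV :: 'v set)" and el: "elem_substructure TYPE('v) L N N'"
    and \<phi>: "\<phi> \<in> formulas L X (universe N)" and s: "s \<in> X \<rightarrow> universe N"
  shows "fm_val N \<phi> s = fm_val N' \<phi> s"
proof -
  have wf: "wf_fm L \<phi>" using \<phi> by (simp add: formulas_def)
  obtain \<psi> :: "('f, 'r, 'a, 'v) fm" and \<theta> where \<psi>: "(\<psi>, \<theta>) \<in> sforms L (free_vars \<phi>) (params \<phi>)"
    and val: "\<And>(N :: ('f, 'r, 'a) mstruct) g s.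
      fm_val N (map_fm id id g id \<phi>) s = fm_val N \<psi> (case_sum s g \<circ> \<theta>)"
    using sform_of_formula[OF inf wf] by metis
  obtain u where u: "u \<in> universe N" using el by (auto simp: elem_substructure_def is_structure_def)
  let ?s = "\<lambda>v. if v \<in> free_vars \<psi> then (case_sum s id \<circ> \<theta>) v else u"
  have "case_sum s id x \<in> universe N" if "x \<in> free_vars \<phi> <+> params \<phi>" for x
    using that \<phi> s by (auto simp: formulas_def Pi_iff)
  then have "?s v \<in> universe N" for v using \<psi> u by (auto simp: sforms_def subset_iff image_iff)
  then have "fm_val N \<psi> ?s = fm_val N' \<psi> ?s"
    using el \<psi> unfolding elem_substructure_def sforms_def by blast
  moreover have "fm_val K \<phi> s = fm_val K \<psi> ?s" for K :: "('f, 'r, 'a) mstruct"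
  proof -
    have "fm_val K \<phi> s = fm_val K \<psi> (case_sum s id \<circ> \<theta>)" using val[of K id s] map_fm_id[of \<phi>] by simp
    also have "\<dots> = fm_val K \<psi> ?s" by (rule fm_val_cong) simp
    finally show ?thesis .
  qed
  ultimately show ?thesis by simp
qed

lemma realizes_elem:
  fixes p :: "('f, 'r, 'a, 'v) fm \<Rightarrow> real"
  assumes "infinite (UNIV :: 'v set)" "elem_substructure TYPE('v) L N N'" "A \<subseteq> universe N"
    and "a \<in> X \<rightarrow> universe N"
  shows "realizes L N X A a p \<longleftrightarrow> realizes L N' X A a p"
proof -
  have "universe N \<subseteq> universe N'" using assms(2) by (simp add: elem_substructure_def)
  moreover have "fm_val N \<phi> a = fm_val N' \<phi> a" if "\<phi> \<in> formulas L X A" for \<phi> :: "('f, 'r, 'a, 'v) fm"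
    using elem_fm_val[OF assms(1,2) formulas_mono[OF that assms(3)] assms(4)] .
  ultimately show ?thesis using assms(4) unfolding realizes_iff by (auto simp: Pi_iff)
qed

lemma types_elem:
  fixes p :: "('f, 'r, 'a, 'v) fm \<Rightarrow> real"
  assumes inf: "infinite (UNIV :: 'v set)" and el: "elem_substructure TYPE('v) L N N'"
    and A: "A \<subseteq> universe N" and p: "p \<in> types L N X A"
  shows "p \<in> types L N' X A"
proof -
  have "\<exists>a\<in>X \<rightarrow> universe N'. \<forall>\<phi>\<in>F. \<bar>fm_val N' \<phi> a - p \<phi>\<bar> < \<epsilon>"
    if F: "finite F" "F \<subseteq> formulas L X A" "0 < \<epsilon>" for F \<epsilon>
  proof -
    obtain a where a: "a \<in> X \<rightarrow> universe N" "\<forall>\<phi>\<in>F. \<bar>fm_val N \<phi> a - p \<phi>\<bar> < \<epsilon>"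
      using p F unfolding types_def mem_Collect_eq by meson
    have "fm_val N \<phi> a = fm_val N' \<phi> a" if "\<phi> \<in> F" for \<phi>
      using elem_fm_val[OF inf el formulas_mono[OF subsetD[OF F(2) that] A] a(1)] .
    moreover have "universe N \<subseteq> universe N'" using el by (simp add: elem_substructure_def)
    ultimately show ?thesis using a by (intro bexI[of _ a]) (auto simp: Pi_iff)
  qed
  then show ?thesis using p by (simp add: types_def)
qed

text \<open>The two halves of reading a block of infima as one infimum over assignments: a lower
  bound, and an assignment that nearly attains it.\<close>

lemma fm_val_Infs:
  assumes N: "is_structure L N" and \<phi>: "wf_fm L \<phi>" "params \<phi> \<subseteq> universe N"
  shows "s \<in> UNIV \<rightarrow> universe N \<Longrightarrow> t \<in> UNIV \<rightarrow> universe N \<Longrightarrow> (\<And>v. v \<notin> set vs \<Longrightarrow> t v = s v) \<Longrightarrow>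
      fm_val N (foldr Inf vs \<phi>) s \<le> fm_val N \<phi> t"
    and "s \<in> UNIV \<rightarrow> universe N \<Longrightarrow> fm_val N (foldr Inf vs \<phi>) s < \<delta> \<Longrightarrow>
      \<exists>t\<in>UNIV \<rightarrow> universe N. fm_val N \<phi> t < \<delta>"
proof -
  have wf: "wf_fm L (foldr Inf vs \<phi>)" "params (foldr Inf vs \<phi>) \<subseteq> universe N" for vs
    using \<phi> by (induction vs) auto
  have bdd: "bdd_below ((\<lambda>a. fm_val N (foldr Inf vs \<phi>) (s(v := a))) ` universe N)"
    if "s \<in> UNIV \<rightarrow> universe N" for s v vs
  proof (rule bdd_belowI2)
    fix a assume "a \<in> universe N"
    then have "fm_val N (foldr Inf vs \<phi>) (s(v := a)) \<in> {0..1}"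
      using fm_val_in_unit[OF N wf, of "s(v := a)"] that by (auto simp: Pi_iff)
    then show "0 \<le> fm_val N (foldr Inf vs \<phi>) (s(v := a))" by simp
  qed
  show "s \<in> UNIV \<rightarrow> universe N \<Longrightarrow> t \<in> UNIV \<rightarrow> universe N \<Longrightarrow> (\<And>v. v \<notin> set vs \<Longrightarrow> t v = s v) \<Longrightarrow>
      fm_val N (foldr Inf vs \<phi>) s \<le> fm_val N \<phi> t"
  proof (induction vs arbitrary: s)
    case Nil
    then have "t = s" by auto
    then show ?case by simp
  next
    case (Cons v vs)
    have "fm_val N (foldr Inf (v # vs) \<phi>) s \<le> fm_val N (foldr Inf vs \<phi>) (s(v := t v))"
      using bdd[OF Cons.prems(1)] Cons.prems(2) by (auto intro!: cINF_lower)
    also have "\<dots> \<le> fm_val N \<phi> t" using Cons.prems by (intro Cons.IH) (auto simp: Pi_iff)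
    finally show ?case .
  qed
  show "s \<in> UNIV \<rightarrow> universe N \<Longrightarrow> fm_val N (foldr Inf vs \<phi>) s < \<delta> \<Longrightarrow>
      \<exists>t\<in>UNIV \<rightarrow> universe N. fm_val N \<phi> t < \<delta>"
  proof (induction vs arbitrary: s)
    case (Cons v vs)
    have "universe N \<noteq> {}" using N by (simp add: is_structure_def)
    then obtain a where "a \<in> universe N" "fm_val N (foldr Inf vs \<phi>) (s(v := a)) < \<delta>"
      using Cons.prems(2) cINF_less_iff[OF _ bdd[OF Cons.prems(1)]] by auto
    moreover from this(1) Cons.prems(1) have "s(v := a) \<in> UNIV \<rightarrow> universe N" by (auto simp: Pi_iff)
    ultimately show ?case by (intro Cons.IH)
  qed auto
qed

text \<open>Approximating finitely many values is one condition, whose infimum over the finitely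
  many variables in \<open>X\<close> is a formula over \<open>A\<close>. Its value is 0 in
  \<open>N'\<close> because of \<open>t\<close>, hence 0 in \<open>N\<close> by elementarity, so
  \<open>N\<close> contains approximate solutions.\<close>

lemma type_in_elementary_substructure:
  fixes t :: "'v \<Rightarrow> 'a" and N :: "('f, 'r, 'a) mstruct"
  assumes inf: "infinite (UNIV :: 'v set)" and el: "elem_substructure TYPE('v) L N N'"
    and X: "finite X" and A: "A \<subseteq> universe N" and t: "t \<in> X \<rightarrow> universe N'"
  shows "tp L N' X A t \<in> types L N X A"
proof -
  have N: "is_structure L N" and N': "is_structure L N'" and sub: "universe N \<subseteq> universe N'"
    using el by (auto simp: elem_substructure_def)
  have "\<exists>a\<in>X \<rightarrow> universe N. \<forall>\<phi>\<in>F. \<bar>fm_val N \<phi> a - tp L N' X A t \<phi>\<bar> < \<epsilon>"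
    if F: "finite F" "F \<subseteq> formulas L X A" "0 < \<epsilon>" for F \<epsilon>
  proof -
    obtain fs where fs: "set fs = F" using finite_list[OF F(1)] by blast
    obtain vs where vs: "set vs = X" using finite_list[OF X] by blast
    define r where "r i = fm_val N' (fs ! i) t" for i
    define n where "n = length fs"
    \<comment> \<open>For \<open>0\<close>--\<open>1\<close>-valued arguments and \<open>r\<close> the truncated sum is again \<open>0\<close>--\<open>1\<close>-valued.\<close>
    define u where "u x = min 1 (\<Sum>i<n. \<bar>x i - r i\<bar>)" for x :: "nat \<Rightarrow> real"
    have fsF: "fs ! i \<in> formulas L X A" if "i < n" for i using that fs F(2) by (auto simp: n_def)
    have rd: "is_discrete L \<Longrightarrow> r i \<in> {0, 1}" if "i < n" for i
      using fm_val_in_unit[OF N', of "fs ! i" t] fsF[OF that] A sub t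
      by (force simp: r_def formulas_def Pi_iff)
    have "is_connective L u"
      unfolding is_connective_def
    proof (intro conjI impI allI)
      show "continuous_on {x. \<forall>i. x i \<in> {0..1}} u"
        unfolding u_def by (intro continuous_intros continuous_on_product_then_coordinatewise)
      show "u x \<in> {0..1}" for x by (auto simp: u_def intro: sum_nonneg)
      fix x :: "nat \<Rightarrow> real" assume d: "is_discrete L" and x: "\<forall>i. x i \<in> {0, 1}"
      show "u x \<in> {0, 1}"
      proof (cases "\<forall>i<n. x i = r i")
        case False
        then obtain i where i: "i < n" "x i \<noteq> r i" by blast
        then have "\<bar>x i - r i\<bar> = 1" using rd[OF i(1) d] x[rule_format, of i] by auto
        moreover have "\<bar>x i - r i\<bar> \<le> (\<Sum>i<n. \<bar>x i - r i\<bar>)" using i(1) by (intro member_le_sum) auto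
        ultimately show ?thesis by (simp add: u_def)
      qed (simp add: u_def)
    qed
    then have wf: "wf_fm L (Conn u fs)" using fs F(2) by (auto simp: list_all_iff formulas_def)
    have par: "params (Conn u fs) \<subseteq> A" and fv: "free_vars (Conn u fs) \<subseteq> X"
      using fs F(2) by (auto simp: formulas_def)
    have val: "fm_val K (Conn u fs) a = min 1 (\<Sum>i<n. \<bar>fm_val K (fs ! i) a - r i\<bar>)"
      for K :: "('f, 'r, 'a) mstruct" and a
      by (simp add: u_def n_def)
    have Infs: "foldr Inf ws (Conn u fs) \<in> formulas L (X - set ws) A" for ws
      using wf par fv by (induction ws) (auto simp: formulas_def)
    obtain c where c: "c \<in> universe N" using N by (auto simp: is_structure_def)
    \<comment> \<open>Assignments have to be total, so \<open>t\<close> is filled up by an element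
      \<open>c\<close>.\<close>
    define t' where "t' v = (if v \<in> X then t v else c)" for v
    have "fm_val N' (foldr Inf vs (Conn u fs)) (\<lambda>_. c) \<le> fm_val N' (Conn u fs) t'"
      using wf par A sub c t vs by (intro fm_val_Infs(1)[OF N']) (auto simp: t'_def Pi_iff)
    also have "\<dots> = fm_val N' (Conn u fs) t"
      using fv by (intro fm_val_cong) (auto simp: t'_def)
    also have "\<dots> = 0" unfolding val r_def by simp
    finally have "fm_val N' (foldr Inf vs (Conn u fs)) (\<lambda>_. c) \<le> 0" .
    moreover have "fm_val N (foldr Inf vs (Conn u fs)) (\<lambda>_. c) = fm_val N' (foldr Inf vs (Conn u fs)) (\<lambda>_. c)"
      by (rule elem_fm_val[OF inf el formulas_mono[OF Infs A]]) (use c in simp)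
    \<comment> \<open>Below 1 the truncation in \<open>u\<close> is inactive, so the sum itself, and
      with it each of its terms, is below \<epsilon>.\<close>
    ultimately have "fm_val N (foldr Inf vs (Conn u fs)) (\<lambda>_. c) < min 1 \<epsilon>" using F(3) by simp
    from fm_val_Infs(2)[OF N wf _ _ this] par A c
    obtain a where a: "a \<in> UNIV \<rightarrow> universe N" "fm_val N (Conn u fs) a < min 1 \<epsilon>" by auto
    have "\<bar>fm_val N \<phi> a - tp L N' X A t \<phi>\<bar> < \<epsilon>" if "\<phi> \<in> F" for \<phi>
    proof -
      have "\<phi> \<in> set fs" using that fs by simp
      then obtain i where i: "i < n" "\<phi> = fs ! i" by (auto simp: in_set_conv_nth n_def)
      have "\<bar>fm_val N (fs ! i) a - r i\<bar> \<le> (\<Sum>i<n. \<bar>fm_val N (fs ! i) a - r i\<bar>)"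
        using i(1) by (intro member_le_sum) auto
      also have "\<dots> < \<epsilon>" using a(2) unfolding val by (auto simp: min_def split: if_splits)
      finally show ?thesis using i fsF by (simp add: tp_def r_def)
    qed
    then show ?thesis using a(1) by (intro bexI[of _ a]) auto
  qed
  then show ?thesis by (simp add: types_def tp_def)
qed

section \<open>The invariant extension to the larger monster model\<close>

locale monster_extension = monster_over L \<kappa> U V M + big: monster L \<kappa>' U' V
  for L :: "('f, 'r) language" and \<kappa> :: "'k rel" and U :: "('f, 'r, 'a) mstruct" and V :: "'v itself"
    and M :: "('f, 'r, 'a) mstruct" and \<kappa>' :: "'l rel" and U' :: "('f, 'r, 'a) mstruct" +
  assumes el: "elem_substructure TYPE('v) L U U'" and U_small: "|universe U| <o \<kappa>'" and \<kappa>_le: "\<kappa> \<le>o \<kappa>'"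
begin

lemma UU': "universe U \<subseteq> universe U'" using el by (simp add: elem_substructure_def)

lemma MU': "universe M \<subseteq> universe U'" using M UU' by blast

lemma big_small: "|A| <o \<kappa> \<Longrightarrow> |A| <o \<kappa>'" using \<kappa>_le ordLess_ordLeq_trans by blast

lemma elem_val:
  fixes \<phi> :: "('f, 'r, 'a, 'v) fm"
  shows "\<phi> \<in> formulas L X (universe U) \<Longrightarrow> s \<in> X \<rightarrow> universe U \<Longrightarrow> fm_val U \<phi> s = fm_val U' \<phi> s"
  using elem_fm_val[OF infinite_vars el] .

text \<open>The type of \<open>P\<close> over \<open>M\<close> is finitely satisfiable in
  \<open>U\<close> because \<open>U\<close> is elementary in \<open>U'\<close>, and it is realized
  there by saturation; homogeneity of \<open>U'\<close> turns this copy into an automorphism over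
  \<open>M\<close>.\<close>

lemma move_into_U:
  assumes P: "finite P" "P \<subseteq> universe U'"
  obtains \<sigma> where "\<sigma> \<in> Aut L U' (universe M)" "\<sigma> ` P \<subseteq> universe U"
proof -
  obtain j :: "'a \<Rightarrow> 'v" where j: "inj_on j P"
    using finite_vars_card[OF P(1)] card_of_ordLeq[of P "UNIV :: 'v set"] by auto
  let ?X = "j ` P"
  define t where "t = inv_into P j"
  have tj: "t (j c) = c" if "c \<in> P" for c using j that by (simp add: t_def)
  then have tX: "t \<in> ?X \<rightarrow> universe U'" using P(2) by auto
  have "tp L U' ?X (universe M) t \<in> types L U ?X (universe M)"
    using type_in_elementary_substructure[OF infinite_vars el _ M tX] P(1) by blast
  moreover have "|?X| <o \<kappa>" using P(1) by (intro small_finite) simp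
  ultimately obtain b where b: "realizes L U ?X (universe M) b (tp L U' ?X (universe M) t)"
    using sat M M_small unfolding saturated_def by blast
  then have bU: "b \<in> ?X \<rightarrow> universe U"
    and bt: "\<And>\<psi>. \<psi> \<in> formulas L ?X (universe M) \<Longrightarrow> fm_val U \<psi> b = fm_val U' \<psi> t"
    by (auto simp: realizes_iff tp_def)
  have "big.eqtp P (universe M) id (b \<circ> j)"
  proof (rule big.eqtpI)
    fix \<phi> :: "('f, 'r, 'a, 'v) fm" and \<theta> assume \<phi>: "(\<phi>, \<theta>) \<in> sforms L P (universe M)"
    have "(\<phi>, map_sum j id \<circ> \<theta>) \<in> sforms L ?X (universe M)" using \<phi> by (fastforce simp: sforms_def)
    then obtain \<psi> where \<psi>: "\<psi> \<in> formulas L ?X (universe M)"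
      "\<And>(N :: ('f, 'r, 'a) mstruct) s. fm_val N \<psi> s = fm_val N \<phi> (case_sum s id \<circ> (map_sum j id \<circ> \<theta>))"
      using formula_of_sform' by metis
    have eq: "fm_val N \<psi> s = fm_val N \<phi> (case_sum (s \<circ> j) id \<circ> \<theta>)" for N :: "('f, 'r, 'a) mstruct" and s
      unfolding \<psi>(2) by (rule arg_cong[of _ _ "fm_val N \<phi>"]) (auto simp: fun_eq_iff split: sum.split)
    have "fm_val U' \<phi> (case_sum id id \<circ> \<theta>) = fm_val U' \<phi> (case_sum (t \<circ> j) id \<circ> \<theta>)"
      using \<phi> tj by (intro sform_val_cong) auto
    also have "\<dots> = fm_val U' \<psi> t" by (rule eq[symmetric])
    also have "\<dots> = fm_val U \<psi> b" by (rule bt[OF \<psi>(1), symmetric])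
    also have "\<dots> = fm_val U' \<psi> b" by (rule elem_val[OF formulas_mono[OF \<psi>(1) M] bU])
    also have "\<dots> = fm_val U' \<phi> (case_sum (b \<circ> j) id \<circ> \<theta>)" by (rule eq)
    finally show "fm_val U' \<phi> (case_sum id id \<circ> \<theta>) = fm_val U' \<phi> (case_sum (b \<circ> j) id \<circ> \<theta>)" .
  qed
  moreover have "id \<in> P \<rightarrow> universe U'" "b \<circ> j \<in> P \<rightarrow> universe U'"
    using P(2) bU UU' by (auto simp: Pi_iff)
  ultimately obtain \<sigma> where \<sigma>: "\<sigma> \<in> Aut L U' (universe M)" "\<And>c. c \<in> P \<Longrightarrow> \<sigma> (id c) = (b \<circ> j) c"
    using big.homogeneity[OF MU' big_small[OF M_small] big.small_finite[OF P(1)]] by metis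
  then have "\<sigma> ` P \<subseteq> universe U" using bU by auto
  then show ?thesis using that \<sigma>(1) by blast
qed

text \<open>Both images have in \<open>U\<close> the type over \<open>M\<close> that
  \<open>P\<close> has in \<open>U'\<close>, so homogeneity of \<open>U\<close> applies.\<close>

lemma moves_conjugate:
  assumes P: "finite P" "P \<subseteq> universe U'"
    and \<sigma>: "\<sigma> \<in> Aut L U' (universe M)" "\<sigma> ` P \<subseteq> universe U"
    and \<tau>: "\<tau> \<in> Aut L U' (universe M)" "\<tau> ` P \<subseteq> universe U"
  obtains \<rho> where "\<rho> \<in> Aut L U (universe M)" "\<And>c. c \<in> P \<Longrightarrow> \<rho> (\<sigma> c) = \<tau> c"
proof -
  have eq: "fm_val U \<phi> (case_sum \<sigma> id \<circ> \<theta>) = fm_val U' \<phi> (case_sum id id \<circ> \<theta>)"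
    if \<phi>: "(\<phi>, \<theta>) \<in> sforms L P (universe M)" and \<sigma>: "\<sigma> \<in> Aut L U' (universe M)" "\<sigma> ` P \<subseteq> universe U"
    for \<phi> :: "('f, 'r, 'a, 'v) fm" and \<theta> \<sigma>
  proof -
    have in_U: "case_sum \<sigma> id x \<in> universe U" if "x \<in> P <+> universe M" for x using that \<sigma>(2) M by auto
    have "fm_val U \<phi> (case_sum \<sigma> id \<circ> \<theta>) = fm_val U' \<phi> (case_sum \<sigma> id \<circ> \<theta>)"
      using \<phi> in_U by (intro elem_val[of _ "free_vars \<phi>"]) (auto simp: sforms_def formulas_def subset_iff)
    also have "\<dots> = fm_val U' \<phi> (case_sum (\<sigma> \<circ> id) \<sigma> \<circ> \<theta>)"
      using \<phi> Aut_fixes[OF \<sigma>(1)] by (intro sform_val_cong) auto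
    also have "\<dots> = fm_val U' \<phi> (case_sum id id \<circ> \<theta>)"
      using P(2) by (intro sform_val_Aut[OF big.struct \<sigma>(1) \<phi> MU']) auto
    finally show ?thesis .
  qed
  have "eqtp P (universe M) \<sigma> \<tau>"
    by (rule eqtpI) (simp only: eq[OF _ \<sigma>] eq[OF _ \<tau>])
  moreover have "\<sigma> \<in> P \<rightarrow> universe U" "\<tau> \<in> P \<rightarrow> universe U" using \<sigma>(2) \<tau>(2) by auto
  ultimately show ?thesis using homogeneity[OF M M_small small_finite[OF P(1)]] that by metis
qed

text \<open>The value at \<phi> is found by moving its finitely many parameters into
  \<open>U\<close> over \<open>M\<close>; for invariant \<open>p\<close> the choice of the
  automorphism is immaterial by \<open>ext_eq\<close>.\<close>

definition ext :: "'v set \<Rightarrow> (('f, 'r, 'a, 'v) fm \<Rightarrow> real) \<Rightarrow> ('f, 'r, 'a, 'v) fm \<Rightarrow> real" where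
  "ext X p = restrict (\<lambda>\<phi>. p (map_fm id id
     (SOME \<sigma>. \<sigma> \<in> Aut L U' (universe M) \<and> \<sigma> ` params \<phi> \<subseteq> universe U) id \<phi>)) (formulas L X (universe U'))"

lemma ext_eq:
  assumes p: "invariant_type L U M X p" and \<phi>: "\<phi> \<in> formulas L X (universe U')"
    and \<tau>: "\<tau> \<in> Aut L U' (universe M)" "\<tau> ` params \<phi> \<subseteq> universe U"
  shows "ext X p \<phi> = p (map_fm id id \<tau> id \<phi>)"
proof -
  define \<sigma> where "\<sigma> = (SOME \<sigma>. \<sigma> \<in> Aut L U' (universe M) \<and> \<sigma> ` params \<phi> \<subseteq> universe U)"
  have "\<sigma> \<in> Aut L U' (universe M) \<and> \<sigma> ` params \<phi> \<subseteq> universe U"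
    unfolding \<sigma>_def by (rule someI[of _ \<tau>]) (use \<tau> in blast)
  then have \<sigma>: "\<sigma> \<in> Aut L U' (universe M)" "\<sigma> ` params \<phi> \<subseteq> universe U" by auto
  have P: "params \<phi> \<subseteq> universe U'" using \<phi> by (simp add: formulas_def)
  obtain \<rho> where \<rho>: "\<rho> \<in> Aut L U (universe M)" "\<And>c. c \<in> params \<phi> \<Longrightarrow> \<rho> (\<sigma> c) = \<tau> c"
    using moves_conjugate[OF finite_params P \<sigma> \<tau>] by blast
  have "map_fm id id \<sigma> id \<phi> \<in> formulas L X (universe U)" using map_formulas[OF \<phi> \<sigma>(2)] .
  then have "p (map_fm id id \<rho> id (map_fm id id \<sigma> id \<phi>)) = p (map_fm id id \<sigma> id \<phi>)"
    using p \<rho>(1) by (simp add: invariant_type_def Aut_def)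
  moreover have "map_fm id id \<rho> id (map_fm id id \<sigma> id \<phi>) = map_fm id id \<tau> id \<phi>"
    unfolding map_params_comp using \<rho>(2) by (intro map_params_cong) simp
  moreover have "ext X p \<phi> = p (map_fm id id \<sigma> id \<phi>)" using \<phi> by (simp add: ext_def \<sigma>_def)
  ultimately show ?thesis by simp
qed

lemma ext_restrict:
  assumes p: "invariant_type L U M X p" and \<phi>: "\<phi> \<in> formulas L X (universe U)"
  shows "ext X p \<phi> = p \<phi>"
proof -
  have "ext X p \<phi> = p (map_fm id id id id \<phi>)"
    using \<phi> by (intro ext_eq[OF p formulas_mono[OF \<phi> UU'] Aut_id]) (simp add: formulas_def)
  then show ?thesis by (simp only: map_fm_id)
qed

text \<open>One automorphism moves the parameters of all formulas in \<open>F\<close> into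
  \<open>U\<close>; an approximate solution found there is carried back by its inverse.\<close>

lemma ext_types:
  assumes p: "invariant_type L U M X p"
  shows "ext X p \<in> types L U' X (universe U')"
proof -
  have pt: "p \<in> types L U X (universe U)" using p by (simp add: invariant_type_def)
  have "\<exists>a\<in>X \<rightarrow> universe U'. \<forall>\<phi>\<in>F. \<bar>fm_val U' \<phi> a - ext X p \<phi>\<bar> < \<epsilon>"
    if F: "finite F" "F \<subseteq> formulas L X (universe U')" "0 < \<epsilon>" for F \<epsilon>
  proof -
    let ?P = "\<Union>\<phi>\<in>F. params \<phi>"
    have "finite ?P" using F(1) finite_params by blast
    moreover have "?P \<subseteq> universe U'" using F(2) by (auto simp: formulas_def)
    ultimately obtain \<sigma> where \<sigma>: "\<sigma> \<in> Aut L U' (universe M)" "\<sigma> ` ?P \<subseteq> universe U"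
      using move_into_U by metis
    have \<sigma>\<phi>: "\<sigma> ` params \<phi> \<subseteq> universe U" if "\<phi> \<in> F" for \<phi> using \<sigma>(2) that by blast
    then have F': "map_fm id id \<sigma> id \<phi> \<in> formulas L X (universe U)" if "\<phi> \<in> F" for \<phi>
      using map_formulas[of \<phi> L X "universe U'" \<sigma>] F(2) that by blast
    have "finite (map_fm id id \<sigma> id ` F) \<and> map_fm id id \<sigma> id ` F \<subseteq> formulas L X (universe U) \<and> 0 < \<epsilon>"
      using F F' by blast
    then obtain a where a: "a \<in> X \<rightarrow> universe U"
      "\<forall>\<psi>\<in>map_fm id id \<sigma> id ` F. \<bar>fm_val U \<psi> a - p \<psi>\<bar> < \<epsilon>"
      using pt unfolding types_def mem_Collect_eq by meson
    obtain \<tau> where \<tau>: "\<tau> \<in> Aut L U' (universe M)" "\<And>x. x \<in> universe U' \<Longrightarrow> \<sigma> (\<tau> x) = x"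
      using Aut_inv[OF big.struct \<sigma>(1) MU'] by metis
    have aU': "a x \<in> universe U'" if "x \<in> X" for x using a(1) UU' that by auto
    then have \<tau>a: "\<tau> \<circ> a \<in> X \<rightarrow> universe U'" using Aut_in[OF \<tau>(1)] by auto
    have "\<bar>fm_val U' \<phi> (\<tau> \<circ> a) - ext X p \<phi>\<bar> < \<epsilon>" if "\<phi> \<in> F" for \<phi>
    proof -
      have \<phi>: "\<phi> \<in> formulas L X (universe U')" using F(2) that by blast
      have "fm_val U' \<phi> (\<tau> \<circ> a) = fm_val U' (map_fm id id \<sigma> id \<phi>) (\<sigma> \<circ> (\<tau> \<circ> a))"
        by (rule fm_val_Aut[OF big.struct \<sigma>(1) \<phi> order_refl \<tau>a, symmetric])
      also have "\<dots> = fm_val U' (map_fm id id \<sigma> id \<phi>) a"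
        using \<phi> \<tau>(2) aU' by (intro fm_val_cong) (auto simp: formulas_def)
      also have "\<dots> = fm_val U (map_fm id id \<sigma> id \<phi>) a" by (rule elem_val[OF F'[OF that] a(1), symmetric])
      finally show ?thesis using a(2) that ext_eq[OF p \<phi> \<sigma>(1) \<sigma>\<phi>[OF that]] by auto
    qed
    then show ?thesis using \<tau>a by blast
  qed
  then show ?thesis by (simp add: types_def ext_def)
qed

lemma ext_invariant:
  assumes p: "invariant_type L U M X p"
  shows "invariant_type L U' M X (ext X p)"
  unfolding invariant_type_def
proof (intro conjI allI impI ballI ext_types[OF p])
  fix \<tau> and \<phi> :: "('f, 'r, 'a, 'v) fm"
  assume "automorphism L U' \<tau> \<and> (\<forall>m\<in>universe M. \<tau> m = m)" and \<phi>: "\<phi> \<in> formulas L X (universe U')"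
  then have \<tau>: "\<tau> \<in> Aut L U' (universe M)" by (simp add: Aut_def)
  have P: "params \<phi> \<subseteq> universe U'" using \<phi> by (simp add: formulas_def)
  have \<tau>P: "\<tau> ` params \<phi> \<subseteq> universe U'" using Aut_image[OF \<tau> P] .
  obtain \<sigma> where \<sigma>: "\<sigma> \<in> Aut L U' (universe M)" "\<sigma> ` \<tau> ` params \<phi> \<subseteq> universe U"
    using move_into_U[OF finite_imageI[OF finite_params] \<tau>P] by blast
  have "ext X p (map_fm id id \<tau> id \<phi>) = p (map_fm id id \<sigma> id (map_fm id id \<tau> id \<phi>))"
    using \<sigma>(2) by (intro ext_eq[OF p map_formulas[OF \<phi> \<tau>P] \<sigma>(1)]) simp
  also have "\<dots> = p (map_fm id id (\<sigma> \<circ> \<tau>) id \<phi>)" by (simp only: map_params_comp)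
  also have "\<dots> = ext X p \<phi>"
    using \<sigma>(2) by (intro ext_eq[OF p \<phi> Aut_comp[OF \<sigma>(1) \<tau>], symmetric]) (simp add: image_comp)
  finally show "ext X p (map_fm id id \<tau> id \<phi>) = ext X p \<phi>" .
qed

text \<open>For uniqueness, invariance reduces the value of a candidate at any formula to its value
  at a formula over \<open>U\<close>, where it is given by \<open>p\<close>.\<close>

lemma invariant_extension_eq:
  assumes p: "invariant_type L U M X p"
  shows "invariant_extension L U' U M X p = ext X p"
  unfolding invariant_extension_def
proof (rule the_equality)
  have "p \<in> extensional (formulas L X (universe U))" using p by (auto simp: invariant_type_def types_def)
  then have "restrict (ext X p) (formulas L X (universe U)) = p"
    using ext_restrict[OF p] by (auto simp: fun_eq_iff restrict_def extensional_def)
  then show "invariant_type L U' M X (ext X p) \<and> restrict (ext X p) (formulas L X (universe U)) = p"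
    using ext_invariant[OF p] by blast
next
  fix r assume r: "invariant_type L U' M X r \<and> restrict r (formulas L X (universe U)) = p"
  show "r = ext X p"
  proof (rule extensionalityI[of _ "formulas L X (universe U')"])
    show "r \<in> extensional (formulas L X (universe U'))" using r by (auto simp: invariant_type_def types_def)
    show "ext X p \<in> extensional (formulas L X (universe U'))" by (simp add: ext_def)
    fix \<phi> :: "('f, 'r, 'a, 'v) fm" assume \<phi>: "\<phi> \<in> formulas L X (universe U')"
    then have P: "params \<phi> \<subseteq> universe U'" by (simp add: formulas_def)
    obtain \<sigma> where \<sigma>: "\<sigma> \<in> Aut L U' (universe M)" "\<sigma> ` params \<phi> \<subseteq> universe U"
      using move_into_U[OF finite_params P] by blast
    have "r \<phi> = r (map_fm id id \<sigma> id \<phi>)" using r \<phi> \<sigma>(1) by (simp add: invariant_type_def Aut_def)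
    also have "\<dots> = p (map_fm id id \<sigma> id \<phi>)"
      using r map_formulas[OF \<phi> \<sigma>(2)] by (auto simp: restrict_def)
    also have "\<dots> = ext X p \<phi>" by (rule ext_eq[OF p \<phi> \<sigma>, symmetric])
    finally show "r \<phi> = ext X p \<phi>" .
  qed
qed

section \<open>The Morley product computed inside the smaller model\<close>

lemma pair_exists:
  fixes X Y :: "'v set"
  assumes X: "|X| <o \<kappa>" and Y: "|Y| <o \<kappa>" and disjoint: "X \<inter> Y = {}"
    and p: "p \<in> types L U X (universe U)" and q: "q \<in> types L U Y (universe U)"
    and A: "A \<subseteq> universe U" "|A| <o \<kappa>"
  obtains e where "realizes L U Y A e q" "realizes L U X (A \<union> e ` Y) e p"
proof -
  obtain b where b: "realizes L U Y A b q" using realization_exists[OF q Y A] .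
  let ?A = "A \<union> b ` Y"
  have A': "?A \<subseteq> universe U" "|?A| <o \<kappa>"
    using A b by (auto simp: realizes_iff intro!: small_Un small_image Y)
  obtain a where a: "realizes L U X ?A a p" using realization_exists[OF p X A'] .
  let ?e = "override_on b a X"
  have "realizes L U Y A ?e q = realizes L U Y A b q"
    using disjoint by (intro realizes_cong) (auto simp: override_on_def)
  moreover have "?e ` Y = b ` Y" using disjoint by (intro image_cong) (auto simp: override_on_def)
  moreover have "realizes L U X ?A ?e p = realizes L U X ?A a p" by (intro realizes_cong) simp
  ultimately show ?thesis using that[of ?e] a b by simp
qed

text \<open>To find the value at \<phi> it is enough to realize \<open>q\<close> and then
  \<open>p\<close> in \<open>U\<close> over \<open>M\<close> and the parameters of \<phi>, as such a
  pair is conjugate to one chosen in \<open>U'\<close> over all of \<open>U\<close>. Since such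
  pairs exist for every \<phi>, the type in the definition of the product is unique.\<close>

lemma morley_product_eq:
  fixes X Y :: "'v set"
  assumes X: "|X| <o \<kappa>" and Y: "|Y| <o \<kappa>" and disjoint: "X \<inter> Y = {}"
    and p: "invariant_type L U M X p" and q: "invariant_type L U M Y q"
  shows "morley_product L U' U M X Y p q \<in> extensional (formulas L (X \<union> Y) (universe U)) \<and>
    (\<forall>\<phi>\<in>formulas L (X \<union> Y) (universe U). \<forall>e.
      realizes L U Y (universe M \<union> params \<phi>) e q \<longrightarrow>
      realizes L U X (universe M \<union> params \<phi> \<union> e ` Y) e p \<longrightarrow>
      morley_product L U' U M X Y p q \<phi> = fm_val U \<phi> e)"
proof -
  let ?F = "formulas L (X \<union> Y) (universe U) :: ('f, 'r, 'a, 'v) fm set"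
  let ?r = "ext X p"
  have pt: "p \<in> types L U X (universe U)" and qt: "q \<in> types L U Y (universe U)"
    using p q by (auto simp: invariant_type_def)
  define R where "R s \<longleftrightarrow> (\<exists>a b. realizes L U' Y (universe U) b q \<and>
    realizes L U' X (universe U \<union> b ` Y) a ?r \<and>
    s = tp L U' (X \<union> Y) (universe U) (override_on b a X))" for s
  define Q where "Q \<phi> e \<longleftrightarrow> realizes L U Y (universe M \<union> params \<phi>) e q \<and>
    realizes L U X (universe M \<union> params \<phi> \<union> e ` Y) e p" for \<phi> :: "('f, 'r, 'a, 'v) fm" and e
  have val: "s \<phi> = fm_val U \<phi> e" if "R s" and \<phi>: "\<phi> \<in> ?F" and "Q \<phi> e" for s \<phi> e
  proof -
    obtain a b where b: "realizes L U' Y (universe U) b q"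
      and a: "realizes L U' X (universe U \<union> b ` Y) a ?r"
      and s: "s = tp L U' (X \<union> Y) (universe U) (override_on b a X)"
      using \<open>R s\<close> by (auto simp: R_def)
    let ?A = "universe M \<union> params \<phi>"
    have eq: "realizes L U Y ?A e q" and ep: "realizes L U X (?A \<union> e ` Y) e p"
      using \<open>Q \<phi> e\<close> by (auto simp: Q_def)
    have eU: "e \<in> Y \<rightarrow> universe U" "e \<in> X \<rightarrow> universe U" using eq ep by (auto simp: realizes_iff)
    have A: "?A \<subseteq> universe U" using M \<phi> by (auto simp: formulas_def)
    then have A': "?A \<subseteq> universe U'" using UU' by blast
    have A_small: "|?A| <o \<kappa>'" by (intro big_small small_Un M_small small_finite finite_params)
    have 1: "realizes L U' Y ?A b q" using realizes_mono[OF b A] .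
    have 2: "realizes L U' Y ?A e q" using realizes_elem[OF infinite_vars el A eU(1)] eq by blast
    \<comment> \<open>First \<open>b\<close> is moved to \<open>e\<close> on \<open>Y\<close>, over
      \<open>M\<close> and the parameters of \<phi>; afterwards \<open>a\<close> is moved to
      \<open>e\<close> on \<open>X\<close> while the entries of \<open>e\<close> on \<open>Y\<close>
      stay fixed.\<close>
    obtain \<sigma> where \<sigma>: "\<sigma> \<in> Aut L U' ?A" "\<And>y. y \<in> Y \<Longrightarrow> \<sigma> (b y) = e y"
      using big.realizations_conjugate[OF big_small[OF Y] A' A_small 1 2] by blast
    have \<sigma>M: "\<sigma> \<in> Aut L U' (universe M)" using \<sigma>(1) Aut_mono[of "universe M" ?A] by blast
    let ?B = "?A \<union> e ` Y"
    have B: "?B \<subseteq> universe U" using A eU by auto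
    have bU: "b \<in> Y \<rightarrow> universe U'" and aU: "a \<in> X \<rightarrow> universe U'" using a b by (auto simp: realizes_iff)
    have bA: "?A \<union> b ` Y \<subseteq> universe U'" using A' bU by auto
    have "realizes L U' X (?A \<union> b ` Y) a ?r" by (rule realizes_mono[OF a Un_mono[OF A order_refl]])
    then have "realizes L U' X (\<sigma> ` (?A \<union> b ` Y)) (\<sigma> \<circ> a) ?r"
      by (rule invariant_realizes_Aut[OF big.struct MU' ext_invariant[OF p] \<sigma>M bA])
    moreover have "\<sigma> ` (?A \<union> b ` Y) = ?B"
      unfolding image_Un[of _ ?A] image_Aut[OF \<sigma>(1) order_refl] image_image using \<sigma>(2) by auto
    ultimately have 3: "realizes L U' X ?B (\<sigma> \<circ> a) ?r" by (simp only:)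
    have "realizes L U' X ?B e p" using realizes_elem[OF infinite_vars el B eU(2)] ep by blast
    then have 4: "realizes L U' X ?B e ?r"
      using ext_restrict[OF p] formulas_mono[OF _ B] unfolding realizes_iff by metis
    have B': "?B \<subseteq> universe U'" using B UU' by blast
    have B_small: "|?B| <o \<kappa>'"
      by (intro big_small small_Un M_small small_finite finite_params small_image Y)
    obtain \<tau> where \<tau>: "\<tau> \<in> Aut L U' ?B" "\<And>x. x \<in> X \<Longrightarrow> \<tau> ((\<sigma> \<circ> a) x) = e x"
      using big.realizations_conjugate[OF big_small[OF X] B' B_small 3 4] by blast
    have \<tau>A: "\<tau> \<in> Aut L U' ?A" using \<tau>(1) Aut_mono[of ?A ?B] by blast
    let ?\<rho> = "\<tau> \<circ> \<sigma>" and ?c = "override_on b a X"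
    have \<rho>: "?\<rho> \<in> Aut L U' ?A" using Aut_comp[OF \<tau>A \<sigma>(1)] .
    have c: "?c \<in> X \<union> Y \<rightarrow> universe U'" using aU bU by (auto simp: override_on_def Pi_iff)
    have \<rho>c: "(?\<rho> \<circ> ?c) v = e v" if "v \<in> X \<union> Y" for v
      using that \<tau>(2)[of v] \<sigma>(2)[of v] Aut_fixes[OF \<tau>(1), of "e v"] by (cases "v \<in> X") auto
    have "s \<phi> = fm_val U' \<phi> ?c" using \<phi> s by (simp add: tp_def)
    also have "\<dots> = fm_val U' (map_fm id id ?\<rho> id \<phi>) (?\<rho> \<circ> ?c)"
      by (rule fm_val_Aut[OF big.struct \<rho> formulas_mono[OF \<phi> UU'] order_refl c, symmetric])
    also have "map_fm id id ?\<rho> id \<phi> = \<phi>" using Aut_fixes[OF \<rho>] by (intro map_params_id) blast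
    also have "fm_val U' \<phi> (?\<rho> \<circ> ?c) = fm_val U' \<phi> e"
      using \<phi> \<rho>c by (intro fm_val_cong) (auto simp: formulas_def)
    also have "\<dots> = fm_val U \<phi> e" using eU by (intro elem_val[OF \<phi>, symmetric]) auto
    finally show ?thesis .
  qed
  have ex: "\<exists>e. Q \<phi> e" if "\<phi> \<in> ?F" for \<phi>
  proof -
    have "universe M \<union> params \<phi> \<subseteq> universe U" using M that by (auto simp: formulas_def)
    moreover have "|universe M \<union> params \<phi>| <o \<kappa>" by (intro small_Un M_small small_finite finite_params)
    ultimately show ?thesis using pair_exists[OF X Y disjoint pt qt] unfolding Q_def by metis
  qed
  \<comment> \<open>Existence: \<open>U\<close> is small for \<open>U'\<close>, so saturation
    realizes \<open>q\<close> over \<open>U\<close>, and then the extension of \<open>p\<close> over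
    \<open>U\<close> and \<open>b\<close>.\<close>
  have "q \<in> types L U' Y (universe U)" using types_elem[OF infinite_vars el order_refl qt] .
  then obtain b where b: "realizes L U' Y (universe U) b q"
    using big.sat UU' U_small big_small[OF Y] unfolding saturated_def by blast
  let ?B = "universe U \<union> b ` Y"
  have B: "?B \<subseteq> universe U'" "|?B| <o \<kappa>'"
    using UU' b by (auto simp: realizes_iff intro!: big.small_Un U_small big.small_image big_small[OF Y])
  obtain a where "realizes L U' X ?B a ?r"
    using big.realization_exists[OF ext_types[OF p] big_small[OF X] B] .
  then obtain s0 where s0: "R s0" using b unfolding R_def by blast
  have ext: "s \<in> extensional ?F" if "R s" for s using that by (auto simp: R_def tp_def)
  have "s = s0" if "R s" for s
  proof (rule extensionalityI[OF ext[OF that] ext[OF s0]])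
    fix \<phi> assume \<phi>: "\<phi> \<in> ?F"
    then obtain e where "Q \<phi> e" using ex by blast
    then show "s \<phi> = s0 \<phi>" using val[OF that \<phi>] val[OF s0 \<phi>] by simp
  qed
  then have "(THE s. R s) = s0" using s0 by blast
  moreover have "morley_product L U' U M X Y p q = (THE s. R s)"
    unfolding morley_product_def invariant_extension_eq[OF p] R_def ..
  ultimately have R: "R (morley_product L U' U M X Y p q)" using s0 by simp
  show ?thesis using ext[OF R] val[OF R] unfolding Q_def by blast
qed

text \<open>The value formula for the product gives one half of \<open>s_iff\<close>. For the other
  half, a realization of the product over \<open>A\<close> is conjugate over \<open>A\<close> to a
  pair obtained by realizing \<open>q\<close> and then \<open>p\<close>, and invariance preserves
  these properties.\<close>

lemma stable_product_morley_product:
  fixes X Y :: "'v set"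
  assumes X: "|X| <o \<kappa>" and Y: "|Y| <o \<kappa>" and disjoint: "X \<inter> Y = {}"
    and p: "generically_stable L U M X p" and q: "generically_stable L U M Y q"
  shows "stable_product L \<kappa> U M X Y p q (morley_product L U' U M X Y p q)"
proof -
  let ?F = "formulas L (X \<union> Y) (universe U) :: ('f, 'r, 'a, 'v) fm set"
  have p_inv: "invariant_type L U M X p" and q_inv: "invariant_type L U M Y q"
    using p q by (auto simp: generically_stable_def)
  then have pt: "p \<in> types L U X (universe U)" and qt: "q \<in> types L U Y (universe U)"
    by (auto simp: invariant_type_def)
  define s where "s = morley_product L U' U M X Y p q"
  have val: "s \<phi> = fm_val U \<phi> e"
    if "\<phi> \<in> ?F" "realizes L U Y (universe M \<union> params \<phi>) e q"
      "realizes L U X (universe M \<union> params \<phi> \<union> e ` Y) e p" for \<phi> e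
    using morley_product_eq[OF X Y disjoint p_inv q_inv] that unfolding s_def by blast
  have ext: "s \<in> extensional ?F"
    using morley_product_eq[OF X Y disjoint p_inv q_inv] unfolding s_def by blast
  have realizes_s: "realizes L U (X \<union> Y) A e s"
    if A: "universe M \<subseteq> A" "A \<subseteq> universe U"
      and e: "realizes L U Y A e q" "realizes L U X (A \<union> e ` Y) e p" for A e
    unfolding realizes_iff
  proof (intro conjI ballI)
    show "e \<in> X \<union> Y \<rightarrow> universe U" using e by (auto simp: realizes_iff Pi_iff)
    fix \<phi> assume \<phi>: "\<phi> \<in> formulas L (X \<union> Y) A"
    then have sub: "universe M \<union> params \<phi> \<subseteq> A" using A by (auto simp: formulas_def)
    show "fm_val U \<phi> e = s \<phi>"
      by (rule val[OF formulas_mono[OF \<phi> A(2)] realizes_mono[OF e(1) sub]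
            realizes_mono[OF e(2) Un_mono[OF sub order_refl]], symmetric])
  qed
  have "s \<in> types L U (X \<union> Y) (universe U)"
  proof -
    have "\<exists>a\<in>X \<union> Y \<rightarrow> universe U. \<forall>\<phi>\<in>F. \<bar>fm_val U \<phi> a - s \<phi>\<bar> < \<epsilon>"
      if F: "finite F" "F \<subseteq> ?F" "0 < \<epsilon>" for F \<epsilon>
    proof -
      \<comment> \<open>A single pair chosen over the parameters of all formulas in \<open>F\<close>
        attains the prescribed values exactly.\<close>
      let ?P = "\<Union>\<phi>\<in>F. params \<phi>"
      let ?A = "universe M \<union> ?P"
      have "finite ?P" using F(1) finite_params by blast
      then have "|?A| <o \<kappa>" by (intro small_Un M_small small_finite)
      moreover have A: "?A \<subseteq> universe U" using M F(2) by (auto simp: formulas_def)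
      ultimately obtain e where "realizes L U Y ?A e q" "realizes L U X (?A \<union> e ` Y) e p"
        using pair_exists[OF X Y disjoint pt qt] by metis
      then have e: "realizes L U (X \<union> Y) ?A e s" using realizes_s[OF _ A] by blast
      have "\<phi> \<in> formulas L (X \<union> Y) ?A" if "\<phi> \<in> F" for \<phi> using F(2) that by (auto simp: formulas_def)
      then show ?thesis using e F(3) by (intro bexI[of _ e]) (auto simp: realizes_iff)
    qed
    then show ?thesis using ext by (simp add: types_def)
  qed
  moreover have "s (map_fm id id \<tau> id \<phi>) = s \<phi>"
    if \<tau>: "\<tau> \<in> Aut L U (universe M)" and \<phi>: "\<phi> \<in> ?F" for \<tau> \<phi>
  proof -
    let ?A = "universe M \<union> params \<phi>" and ?\<phi> = "map_fm id id \<tau> id \<phi>"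
    have A: "?A \<subseteq> universe U" using M \<phi> by (auto simp: formulas_def)
    have "|?A| <o \<kappa>" by (intro small_Un M_small small_finite finite_params)
    \<comment> \<open>The pair moved by \<tau> computes the value at the moved formula, and \<tau>
      preserves values of formulas.\<close>
    then obtain e where e: "realizes L U Y ?A e q" "realizes L U X (?A \<union> e ` Y) e p"
      using pair_exists[OF X Y disjoint pt qt A] by metis
    have eU: "e \<in> X \<union> Y \<rightarrow> universe U" using e by (auto simp: realizes_iff Pi_iff)
    then have AY: "?A \<union> e ` Y \<subseteq> universe U" using A by auto
    have im: "\<tau> ` ?A = universe M \<union> params ?\<phi>"
      using image_Aut[OF \<tau> order_refl] by (simp add: image_Un)
    have im': "\<tau> ` (?A \<union> e ` Y) = universe M \<union> params ?\<phi> \<union> (\<tau> \<circ> e) ` Y"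
      unfolding image_Un[of _ ?A] im image_comp ..
    have "\<tau> ` params \<phi> \<subseteq> universe U" using A Aut_image[OF \<tau>, of "params \<phi>"] by auto
    then have "s ?\<phi> = fm_val U ?\<phi> (\<tau> \<circ> e)"
      using realizes_Aut[OF q_inv \<tau> A e(1)] realizes_Aut[OF p_inv \<tau> AY e(2)] unfolding im im'
      by (intro val map_formulas[OF \<phi>])
    also have "\<dots> = fm_val U \<phi> e" by (rule fm_val_Aut[OF struct \<tau> \<phi> order_refl eU])
    also have "\<dots> = s \<phi>" by (rule val[OF \<phi> e, symmetric])
    finally show ?thesis .
  qed
  ultimately have s_inv: "invariant_type L U M (X \<union> Y) s"
    by (simp add: invariant_type_def Aut_def)
  have s_iff: "realizes L U (X \<union> Y) A e s \<longleftrightarrow> realizes L U Y A e q \<and> realizes L U X (A \<union> e ` Y) e p"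
    if A: "universe M \<subseteq> A" "A \<subseteq> universe U" "|A| <o \<kappa>" for A e
  proof
    assume e: "realizes L U (X \<union> Y) A e s"
    obtain e' where e': "realizes L U Y A e' q" "realizes L U X (A \<union> e' ` Y) e' p"
      using pair_exists[OF X Y disjoint pt qt A(2,3)] by metis
    have "realizes L U (X \<union> Y) A e' s" using realizes_s[OF A(1,2) e'] .
    then obtain \<sigma> where \<sigma>: "\<sigma> \<in> Aut L U A" "\<And>x. x \<in> X \<union> Y \<Longrightarrow> \<sigma> (e' x) = e x"
      using realizations_conjugate[OF small_Un[OF X Y] A(2,3) _ e] by metis
    have \<sigma>M: "\<sigma> \<in> Aut L U (universe M)" using \<sigma>(1) Aut_mono[OF A(1)] by blast
    have \<sigma>A: "\<sigma> ` A = A" using image_Aut[OF \<sigma>(1) order_refl] .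
    have AY: "A \<union> e' ` Y \<subseteq> universe U" using A e'(1) by (auto simp: realizes_iff)
    have im: "\<sigma> ` (A \<union> e' ` Y) = A \<union> e ` Y"
      unfolding image_Un \<sigma>A image_image using \<sigma>(2) by auto
    have "realizes L U Y A (\<sigma> \<circ> e') q" using realizes_Aut[OF q_inv \<sigma>M A(2) e'(1)] unfolding \<sigma>A .
    moreover have "realizes L U Y A (\<sigma> \<circ> e') q = realizes L U Y A e q"
      using \<sigma>(2) by (intro realizes_cong) auto
    moreover have "realizes L U X (A \<union> e ` Y) (\<sigma> \<circ> e') p"
      using realizes_Aut[OF p_inv \<sigma>M AY e'(2)] unfolding im .
    moreover have "realizes L U X (A \<union> e ` Y) (\<sigma> \<circ> e') p = realizes L U X (A \<union> e ` Y) e p"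
      using \<sigma>(2) by (intro realizes_cong) auto
    ultimately show "realizes L U Y A e q \<and> realizes L U X (A \<union> e ` Y) e p" by simp
  next
    assume "realizes L U Y A e q \<and> realizes L U X (A \<union> e ` Y) e p"
    then show "realizes L U (X \<union> Y) A e s" using realizes_s[OF A(1,2)] by blast
  qed
  show ?thesis unfolding s_def[symmetric]
    by unfold_locales (fact X Y disjoint p q s_inv | erule (2) s_iff)+
qed

end

theorem theorem5p4:
  fixes L :: "('f, 'r) language"
    and T :: "('f, 'r, 'a, 'v) fm set"
    and U U' M :: "('f, 'r, 'a) mstruct"
    and \<kappa> :: "'k rel" and \<kappa>' :: "'l rel"
    and X Y :: "'v set"
    and p q :: "('f, 'r, 'a, 'v) fm \<Rightarrow> real"
  assumes "infinite (UNIV :: 'v set)"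
    and "monster_model L T \<kappa> U"
    and "elem_substructure TYPE('v) L M U" and "|universe M| <o \<kappa>"
    and "|X| <o \<kappa>" and "|Y| <o \<kappa>" and "X \<inter> Y = {}"
    and "monster_model L T \<kappa>' U'"
    and "elem_substructure TYPE('v) L U U'" and "|universe U| <o \<kappa>'" and "\<kappa> \<le>o \<kappa>'"
    and "generically_stable L U M X p"
    and "generically_stable L U M Y q"
  shows "generically_stable L U M (X \<union> Y) (morley_product L U' U M X Y p q)"

proof -
  have M: "universe M \<subseteq> universe U" using assms(3) by (simp add: elem_substructure_def)
  interpret monster_extension L \<kappa> U "TYPE('v)" M \<kappa>' U'
    using assms M by unfold_locales (simp_all add: monster_model_def)
  interpret stable_product L \<kappa> U "TYPE('v)" M X Y p q "morley_product L U' U M X Y p q"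
    using stable_product_morley_product assms by blast
  show ?thesis by (rule product_generically_stable)
qed

end
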